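(* Let $E(\mathbb{Z}/n\mathbb{Z})$ denote the size of the largest subset of the residues modulo $n$ which does not contain a three-term geometric progression. Then for $n\ge 3$, \[E(\mathbb{Z}/n\mathbb{Z}) \ll \frac{n(\log \log n)^5}{(\log n)^{1/2}},\] with an absolute implied constant.
   Context: A three-term geometric progression in $\mathbb{Z}/n\mathbb{Z}$ is a triple $(a, ar, ar^2)$ of three distinct residues modulo $n$, where $a, r \in \mathbb{Z}/n\mathbb{Z}$. *)

theory Defs
  imports Complex_Main "HOL-Number_Theory.Residues"
begin

definition three_term_GP :: "nat \<Rightarrow> int \<times> int \<times> int \<Rightarrow> bool" where
  "three_term_GP n t \<longleftrightarrow>
     (let R = residue_ring (int n) in
      \<exists>a \<in> carrier R. \<exists>r \<in> carrier R.
        t = (a, a \<otimes>\<^bsub>R\<^esub> r, a \<otimes>\<^bsub>R\<^esub> (r [^]\<^bsub>R\<^esub> (2::nat))) \<and>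
        distinct [a, a \<otimes>\<^bsub>R\<^esub> r, a \<otimes>\<^bsub>R\<^esub> (r [^]\<^bsub>R\<^esub> (2::nat))])"

definition GP_free :: "nat \<Rightarrow> int set \<Rightarrow> bool" where
  "GP_free n A \<longleftrightarrow>
     (\<forall>x y z. three_term_GP n (x, y, z) \<longrightarrow> \<not> {x, y, z} \<subseteq> A)"

text \<open>The maximum ranges over a finite set of cardinalities for \<open>n > 0\<close>; the set is nonempty
  because the empty set is progression-free.\<close>

definition E :: "nat \<Rightarrow> nat" where
  "E n = Max {card A | A. A \<subseteq> carrier (residue_ring (int n)) \<and> GP_free n A}"

end

theory Submission
  imports Defs "HOL-Library.Function_Algebras"
    "HOL-Analysis.Harmonic_Numbers" "HOL-Real_Asymp.Real_Asymp"
begin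

text \<open>Splitting the residues modulo \<open>n\<close> according to their gcd with \<open>n\<close>, one class is a copy of the group
  of units modulo \<open>m\<close> for each \<open>m\<close> dividing \<open>n\<close>, and a geometric progression of units is an
  arithmetic progression of an abelian group. So what is needed is a version of Bourgain's bound in
  Roth's theorem for an arbitrary finite abelian group \<open>G\<close>: a set of density \<open>\<alpha>\<close>
  on a Bohr set either has many progressions, or has density at least \<open>\<alpha> (1 + c \<alpha>)\<close> on
  a translate of a smaller Bohr set with one more character, or has density at least \<open>7/4 \<alpha>\<close>
  along \<open>t + 2 W\<close> for a smaller Bohr set \<open>W\<close>. There are \<open>O(1/\<alpha>)\<close> steps up to logarithms,
  so the rank stays below about \<open>1/\<alpha>\<close> and the final Bohr set has size about
  \<open>|G| exp (- 1/\<alpha>^2)\<close> up to logarithms, which is where the exponent \<open>1/2\<close> comes from.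

  Doubling is not injective when \<open>G\<close> has even order. In the last case the set is
  therefore replaced by its pull-back under \<open>x \<mapsto> t + 2 x\<close>, which turns the subgroup of degenerate differences
  from \<open>G[2^k]\<close> into \<open>G[2^(k+1)]\<close>. As each such step multiplies the density by \<open>7/4 > sqrt 2\<close>, and the
  group of units modulo \<open>m\<close> has at most \<open>2^(\<omega>(m) + 4)\<close> square roots of 1, with
  \<open>\<omega>(m) \<le> (1 + o(1)) ln m / ln (ln m)\<close>, this subgroup stays smaller than \<open>m^(9/10)\<close>.\<close>

subsection \<open>Characters and Bohr sets\<close>

text \<open>With l = ln m and L = ln l, every increment shrinks the radius by a fixed power of l,
  which costs a factor exp(O(rank * L)) in the size of the Bohr set. There are O(L / \<alpha>)
  steps, so the total loss is exp(O(L^3 / \<alpha>^2)). For \<alpha> = L^5 / sqrt l this is exp(O(l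
  / L^7)), below every fixed power of m; \<alpha> of order L^(3/2) / sqrt l would already control
  this loss. The loss comparable to a power of m comes from degenerate progressions: distinctness of
  the three terms says nothing about differences d with 2 d = 0, so these cannot be excluded. The
  constant 7/4 is therefore confined from both sides: it exceeds sqrt 2 because of the 2-torsion,
  and it is below 2 because the lower bound for the number of progressions must stay positive.
  Progressions x, y, 2 y - x are counted by their midpoint y, which runs over a much smaller Bohr
  set than x. A character then enters only through its value at 2 y, so that no division by 2 is
  ever performed.\<close>

definition unit_char :: "('a::ab_group_add \<Rightarrow> complex) \<Rightarrow> bool" where
  "unit_char \<xi> \<longleftrightarrow> (\<forall>x y. \<xi> (x + y) = \<xi> x * \<xi> y) \<and> (\<forall>x. norm (\<xi> x) = 1)"

lemma unit_char_add: "unit_char \<xi> \<Longrightarrow> \<xi> (x + y) = \<xi> x * \<xi> y"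
  and unit_char_norm: "unit_char \<xi> \<Longrightarrow> norm (\<xi> x) = 1"
  by (simp_all add: unit_char_def)

lemma unit_char_zero: assumes "unit_char \<xi>" shows "\<xi> 0 = 1"
proof -
  have "\<xi> 0 * \<xi> 0 = \<xi> 0 * 1" using unit_char_add[OF assms, of 0 0] by simp
  moreover have "\<xi> 0 \<noteq> 0" using unit_char_norm[OF assms, of 0] by auto
  ultimately show ?thesis by (metis mult_left_cancel)
qed

lemma unit_char_uminus: assumes "unit_char \<xi>" shows "\<xi> (- x) = cnj (\<xi> x)"
proof -
  have 1: "\<xi> x * \<xi> (- x) = 1"
    using unit_char_add[OF assms, of x "- x"] unit_char_zero[OF assms] by simp
  have 2: "\<xi> x * cnj (\<xi> x) = 1"
    using unit_char_norm[OF assms, of x] by (simp add: complex_norm_square[symmetric])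
  have "\<xi> x \<noteq> 0" using unit_char_norm[OF assms, of x] by auto
  then show ?thesis using 1 2 by (metis mult_left_cancel)
qed

lemma unit_char_diff: "unit_char \<xi> \<Longrightarrow> \<xi> (x - y) = \<xi> x * cnj (\<xi> y)"
  using unit_char_add[of \<xi> x "- y"] unit_char_uminus[of \<xi> y] by simp

lemma unit_char_diff_minus_one:
  assumes "unit_char \<xi>" shows "norm (\<xi> (x - y) - 1) = norm (\<xi> x - \<xi> y)"
proof -
  have "\<xi> x = \<xi> (x - y) * \<xi> y" using unit_char_add[OF assms, of "x - y" y] by simp
  then have "\<xi> x - \<xi> y = (\<xi> (x - y) - 1) * \<xi> y" by (simp add: algebra_simps)
  then show ?thesis by (simp add: norm_mult unit_char_norm[OF assms])
qed

lemma unit_char_double: "unit_char \<xi> \<Longrightarrow> unit_char (\<lambda>y. \<xi> (y + y))"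
  by (simp add: unit_char_def norm_mult algebra_simps)

section \<open>Densities and approximate translation invariance\<close>

definition dens :: "'a::ab_group_add set \<Rightarrow> 'a set \<Rightarrow> 'a \<Rightarrow> real" where
  "dens A S t = (\<Sum>w\<in>S. indicat_real A (t + w)) / card S"

text \<open>Regularity of Bohr sets, reduced to the one consequence that averaging arguments use:
  shifts at the small scale \<open>S\<close> hardly change \<open>B\<close>.\<close>

definition approx_inv :: "real \<Rightarrow> 'a::ab_group_add set \<Rightarrow> 'a set \<Rightarrow> bool" where
  "approx_inv \<eta> B S \<longleftrightarrow> (\<forall>t\<in>S. real (card {x \<in> B. x + t \<notin> B}) \<le> \<eta> * real (card B))"

lemma approx_inv_mono: "approx_inv \<eta> B S \<Longrightarrow> S' \<subseteq> S \<Longrightarrow> approx_inv \<eta> B S'"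
  by (auto simp: approx_inv_def)

text \<open>The two sums differ only over \<open>P - B\<close> and \<open>B - P\<close>. The first
  set is controlled by the shift by \<open>t\<close>, the second by the shift by \<open>- t\<close>,
  hence the factor 2.\<close>

lemma approx_inv_sum:
  fixes h :: "'a::ab_group_add \<Rightarrow> 'b::real_normed_vector"
  assumes "approx_inv \<eta> B S" "finite B" "t \<in> S" "- t \<in> S" "\<And>x. norm (h x) \<le> c"
  shows "norm ((\<Sum>x\<in>B. h (x + t)) - (\<Sum>x\<in>B. h x)) \<le> 2 * \<eta> * c * card B"
proof -
  define P where "P = (\<lambda>x. x + t) ` B"
  have inj: "inj_on (\<lambda>x. x + t) S'" for S' by (auto simp: inj_on_def)
  have finP: "finite P" using assms(2) P_def by auto
  have c0: "c \<ge> 0" using assms(5)[of 0] norm_ge_zero order_trans by blast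
  have s: "(\<Sum>x\<in>B. h (x + t)) = sum h P"
    unfolding P_def by (subst sum.reindex[OF inj]) (simp add: o_def)
  have "sum h P = sum h (P - B) + sum h (P \<inter> B)"
    using sum.Int_Diff[OF finP, of h B] by (simp add: add.commute)
  moreover have "sum h B = sum h (B - P) + sum h (P \<inter> B)"
    using sum.Int_Diff[OF assms(2), of h P] by (simp add: Int_commute add.commute)
  ultimately have d: "sum h P - sum h B = sum h (P - B) - sum h (B - P)" by simp
  have "P - B = (\<lambda>x. x + t) ` {x \<in> B. x + t \<notin> B}" by (auto simp: P_def)
  then have "card (P - B) = card {x \<in> B. x + t \<notin> B}" by (simp add: card_image inj)
  then have c1: "real (card (P - B)) \<le> \<eta> * card B" using assms by (auto simp: approx_inv_def)
  have "B - P \<subseteq> {x \<in> B. x + (- t) \<notin> B}"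
  proof
    fix x assume x: "x \<in> B - P"
    have "x + (- t) \<notin> B"
    proof
      assume "x + - t \<in> B"
      then have "(x + - t) + t \<in> P" unfolding P_def by blast
      then show False using x by simp
    qed
    then show "x \<in> {x \<in> B. x + (- t) \<notin> B}" using x by simp
  qed
  then have "card (B - P) \<le> card {x \<in> B. x + (- t) \<notin> B}"
    using assms(2) by (intro card_mono) auto
  then have c2: "real (card (B - P)) \<le> \<eta> * card B"
    using assms(1,4) by (auto simp: approx_inv_def intro: order_trans[rotated])
  have "norm (sum h (P - B)) \<le> (\<eta> * card B) * c"
    using sum_norm_bound[of "P - B" h c] assms(5) mult_right_mono[OF c1 c0] by fastforce
  moreover have "norm (sum h (B - P)) \<le> (\<eta> * card B) * c"
    using sum_norm_bound[of "B - P" h c] assms(5) mult_right_mono[OF c2 c0] by fastforce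
  moreover have "norm (sum h P - sum h B) \<le> norm (sum h (P - B)) + norm (sum h (B - P))"
    unfolding d by (rule norm_triangle_ineq4)
  ultimately show ?thesis unfolding s by (simp add: algebra_simps)
qed

lemma card_le_fibres:
  assumes "finite S" "finite T" "c ` S \<subseteq> T" "\<And>x. x \<in> S \<Longrightarrow> card {y \<in> S. c y = c x} \<le> N"
  shows "card S \<le> card T * N"
proof -
  have "S = (\<Union>v\<in>c ` S. {y \<in> S. c y = v})" by auto
  then have "card S \<le> (\<Sum>v\<in>c ` S. card {y \<in> S. c y = v})"
    using card_UN_le[of "c ` S" "\<lambda>v. {y \<in> S. c y = v}"] assms(1) by simp
  also have "\<dots> \<le> (\<Sum>v\<in>c ` S. N)" using assms(4) by (intro sum_mono) auto
  also have "\<dots> = card (c ` S) * N" by simp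
  also have "\<dots> \<le> card T * N" using assms(2,3) by (simp add: card_mono)
  finally show ?thesis .
qed

text \<open>\<open>G\<close> is a finite subgroup of an arbitrary additive type, and the characters
  are homomorphisms on the whole type, so they can be translated and composed with doubling without
  side conditions. Orthogonality at the nonzero points is the form in which duality enters.\<close>

locale fourier_group =
  fixes G :: "'a::ab_group_add set" and X :: "('a \<Rightarrow> complex) set"
  assumes finite_G: "finite G" and zero_G: "0 \<in> G"
    and diff_G: "x \<in> G \<Longrightarrow> y \<in> G \<Longrightarrow> x - y \<in> G"
    and finite_X: "finite X" and X_nonempty: "X \<noteq> {}"
    and X_char: "\<xi> \<in> X \<Longrightarrow> unit_char \<xi>"
    and orthogonality: "x \<in> G \<Longrightarrow> x \<noteq> 0 \<Longrightarrow> (\<Sum>\<xi>\<in>X. \<xi> x) = 0"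
begin

lemma uminus_G: "x \<in> G \<Longrightarrow> - x \<in> G"
  using diff_G[OF zero_G, of x] by simp

lemma add_G: "x \<in> G \<Longrightarrow> y \<in> G \<Longrightarrow> x + y \<in> G"
  using diff_G[of x "- y"] uminus_G by simp

lemma sum_G_shift: "t \<in> G \<Longrightarrow> (\<Sum>x\<in>G. h (x + t)) = (\<Sum>x\<in>G. h x)"
  by (rule sum.reindex_bij_witness[of _ "\<lambda>x. x - t" "\<lambda>x. x + t"]) (auto intro: add_G diff_G)

text \<open>Closeness to 1 is measured by the chord and not by the argument, so radius 2 gives all
  of \<open>G\<close>.\<close>

definition bohr :: "('a \<Rightarrow> complex) set \<Rightarrow> real \<Rightarrow> 'a set" where
  "bohr \<Gamma> \<rho> = {x \<in> G. \<forall>\<gamma>\<in>\<Gamma>. norm (\<gamma> x - 1) \<le> \<rho>}"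

lemma bohr_subset_G: "bohr \<Gamma> \<rho> \<subseteq> G" by (auto simp: bohr_def)

lemma finite_bohr: "finite (bohr \<Gamma> \<rho>)" using finite_G bohr_subset_G by (rule finite_subset[rotated])

lemma bohr_mono: "\<Gamma> \<subseteq> \<Gamma>' \<Longrightarrow> \<rho>' \<le> \<rho> \<Longrightarrow> bohr \<Gamma>' \<rho>' \<subseteq> bohr \<Gamma> \<rho>"
  by (fastforce simp: bohr_def)

lemma zero_bohr: "\<forall>\<gamma>\<in>\<Gamma>. unit_char \<gamma> \<Longrightarrow> \<rho> \<ge> 0 \<Longrightarrow> 0 \<in> bohr \<Gamma> \<rho>"
  by (auto simp: bohr_def zero_G unit_char_zero)

lemma card_bohr_pos: "\<forall>\<gamma>\<in>\<Gamma>. unit_char \<gamma> \<Longrightarrow> \<rho> \<ge> 0 \<Longrightarrow> card (bohr \<Gamma> \<rho>) > 0"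
  using zero_bohr finite_bohr by (metis card_gt_0_iff empty_iff)

lemma uminus_bohr:
  assumes "\<forall>\<gamma>\<in>\<Gamma>. unit_char \<gamma>" "x \<in> bohr \<Gamma> \<rho>" shows "- x \<in> bohr \<Gamma> \<rho>"
proof -
  have "norm (\<gamma> (- x) - 1) = norm (\<gamma> x - 1)" if "\<gamma> \<in> \<Gamma>" for \<gamma>
    using unit_char_diff_minus_one[of \<gamma> 0 x] unit_char_zero[of \<gamma>] assms(1) that
    by (simp add: norm_minus_commute)
  then show ?thesis using assms(2) by (auto simp: bohr_def uminus_G)
qed

lemma add_bohr:
  assumes "\<forall>\<gamma>\<in>\<Gamma>. unit_char \<gamma>" "x \<in> bohr \<Gamma> \<rho>" "y \<in> bohr \<Gamma> \<sigma>"
  shows "x + y \<in> bohr \<Gamma> (\<rho> + \<sigma>)"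
proof -
  have "norm (\<gamma> (x + y) - 1) \<le> \<rho> + \<sigma>" if "\<gamma> \<in> \<Gamma>" for \<gamma>
  proof -
    have u: "unit_char \<gamma>" using assms(1) that by blast
    have eq: "\<gamma> (x + y) - 1 = \<gamma> x * (\<gamma> y - 1) + (\<gamma> x - 1)"
      by (simp add: unit_char_add[OF u] algebra_simps)
    have "norm (\<gamma> (x + y) - 1) \<le> norm (\<gamma> y - 1) + norm (\<gamma> x - 1)"
      unfolding eq using norm_triangle_ineq[of "\<gamma> x * (\<gamma> y - 1)" "\<gamma> x - 1"]
      by (simp add: norm_mult unit_char_norm[OF u])
    then show ?thesis using assms(2,3) that by (fastforce simp: bohr_def)
  qed
  then show ?thesis using assms(2,3) by (auto simp: bohr_def add_G)
qed

lemma bohr_doubling: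
  assumes "finite \<Gamma>" "\<forall>\<gamma>\<in>\<Gamma>. unit_char \<gamma>" "\<rho> > 0"
  shows "card (bohr \<Gamma> (2 * \<rho>)) \<le> 81 ^ card \<Gamma> * card (bohr \<Gamma> \<rho>)"
proof -
  \<comment> \<open>Two points whose character values all lie in the same cells of a square grid of mesh \<open>\<rho> / 2\<close>
    differ by an element of the smaller Bohr set; per character, 81 cells meet the larger disc.\<close>
  define p where "p = (\<lambda>z::complex. (\<lfloor>2 * Re (z - 1) / \<rho>\<rfloor>, \<lfloor>2 * Im (z - 1) / \<rho>\<rfloor>))"
  define c where "c = (\<lambda>x. \<lambda>\<gamma>\<in>\<Gamma>. p (\<gamma> x))"
  define T where "T = PiE \<Gamma> (\<lambda>_. {-4..4::int} \<times> {-4..4::int})"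
  have cardT: "card T = 81 ^ card \<Gamma>"
    using assms(1) by (simp add: T_def card_PiE)
  have rng: "\<lfloor>2 * u / \<rho>\<rfloor> \<in> {-4..4}" if "\<bar>u\<bar> \<le> 2 * \<rho>" for u
  proof -
    have "-4 \<le> 2 * u / \<rho>" "2 * u / \<rho> \<le> 4" using that assms(3) by (auto simp: field_simps abs_le_iff)
    then show ?thesis by (simp add: le_floor_iff floor_le_iff)
  qed
  have "card (bohr \<Gamma> (2 * \<rho>)) \<le> card T * card (bohr \<Gamma> \<rho>)"
  proof (rule card_le_fibres)
    show "c ` bohr \<Gamma> (2 * \<rho>) \<subseteq> T"
    proof (intro image_subsetI)
      fix x assume x: "x \<in> bohr \<Gamma> (2 * \<rho>)"
      have "p (\<gamma> x) \<in> {-4..4} \<times> {-4..4}" if "\<gamma> \<in> \<Gamma>" for \<gamma>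
      proof -
        have "norm (\<gamma> x - 1) \<le> 2 * \<rho>" using x that by (auto simp: bohr_def)
        then have "\<bar>Re (\<gamma> x - 1)\<bar> \<le> 2 * \<rho>" "\<bar>Im (\<gamma> x - 1)\<bar> \<le> 2 * \<rho>"
          using abs_Re_le_cmod[of "\<gamma> x - 1"] abs_Im_le_cmod[of "\<gamma> x - 1"] by linarith+
        then show ?thesis using rng unfolding p_def by blast
      qed
      then show "c x \<in> T" by (auto simp: c_def T_def)
    qed
    fix x assume x: "x \<in> bohr \<Gamma> (2 * \<rho>)"
    have "(\<lambda>y. y - x) ` {y \<in> bohr \<Gamma> (2 * \<rho>). c y = c x} \<subseteq> bohr \<Gamma> \<rho>"
    proof (intro image_subsetI)
      fix y assume y: "y \<in> {y \<in> bohr \<Gamma> (2 * \<rho>). c y = c x}"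
      have "norm (\<gamma> (y - x) - 1) \<le> \<rho>" if g: "\<gamma> \<in> \<Gamma>" for \<gamma>
      proof -
        have "p (\<gamma> y) = p (\<gamma> x)"
          using y g by (auto simp: c_def dest!: fun_cong[of _ _ \<gamma>])
        then have e: "\<lfloor>2 * Re (\<gamma> y - 1) / \<rho>\<rfloor> = \<lfloor>2 * Re (\<gamma> x - 1) / \<rho>\<rfloor>"
          "\<lfloor>2 * Im (\<gamma> y - 1) / \<rho>\<rfloor> = \<lfloor>2 * Im (\<gamma> x - 1) / \<rho>\<rfloor>"
          by (auto simp: p_def)
        have fl: "\<bar>u - v\<bar> < 1" if "\<lfloor>u\<rfloor> = \<lfloor>v\<rfloor>" for u v :: real using that by linarith
        have "\<bar>2 * Re (\<gamma> y - 1) / \<rho> - 2 * Re (\<gamma> x - 1) / \<rho>\<bar> < 1"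
          "\<bar>2 * Im (\<gamma> y - 1) / \<rho> - 2 * Im (\<gamma> x - 1) / \<rho>\<bar> < 1" using fl e by blast+
        then have "\<bar>Re (\<gamma> y - \<gamma> x)\<bar> < \<rho> / 2" "\<bar>Im (\<gamma> y - \<gamma> x)\<bar> < \<rho> / 2"
          using assms(3) by (auto simp: field_simps abs_less_iff abs_if)
        then have "norm (\<gamma> y - \<gamma> x) \<le> \<rho>" using cmod_le[of "\<gamma> y - \<gamma> x"] by linarith
        then show ?thesis using unit_char_diff_minus_one assms(2) g by metis
      qed
      then show "y - x \<in> bohr \<Gamma> \<rho>" using x y by (auto simp: bohr_def diff_G)
    qed
    then have "card ((\<lambda>y. y - x) ` {y \<in> bohr \<Gamma> (2 * \<rho>). c y = c x}) \<le> card (bohr \<Gamma> \<rho>)"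
      by (rule card_mono[OF finite_bohr])
    then show "card {y \<in> bohr \<Gamma> (2 * \<rho>). c y = c x} \<le> card (bohr \<Gamma> \<rho>)"
      by (subst (asm) card_image) (auto simp: inj_on_def)
  qed (use finite_bohr assms(1) in \<open>auto simp: T_def intro: finite_PiE\<close>)
  then show ?thesis by (simp add: cardT)
qed

text \<open>The radius is halved \<open>j\<close> times, starting from 2, where the Bohr set is
  \<open>G\<close>.\<close>

lemma card_bohr_ge:
  assumes "finite \<Gamma>" "\<forall>\<gamma>\<in>\<Gamma>. unit_char \<gamma>"
  shows "card G \<le> 81 ^ (j * card \<Gamma>) * card (bohr \<Gamma> (2 / 2 ^ j))"
proof (induction j)
  case 0
  have "norm (\<gamma> x - 1) \<le> 2" if "\<gamma> \<in> \<Gamma>" for \<gamma> x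
    using norm_triangle_ineq4[of "\<gamma> x" 1] unit_char_norm[of \<gamma>] assms(2) that by auto
  then have "bohr \<Gamma> 2 = G" by (auto simp: bohr_def)
  then show ?case by simp
next
  case (Suc j)
  have "card (bohr \<Gamma> (2 / 2 ^ j)) \<le> 81 ^ card \<Gamma> * card (bohr \<Gamma> (2 / 2 ^ Suc j))"
    using bohr_doubling[OF assms, of "2 / 2 ^ Suc j"] by simp
  then have "81 ^ (j * card \<Gamma>) * card (bohr \<Gamma> (2 / 2 ^ j)) \<le>
      81 ^ (j * card \<Gamma>) * (81 ^ card \<Gamma> * card (bohr \<Gamma> (2 / 2 ^ Suc j)))" by simp
  with Suc have "card G \<le> 81 ^ (j * card \<Gamma>) * (81 ^ card \<Gamma> * card (bohr \<Gamma> (2 / 2 ^ Suc j)))"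
    by (rule order_trans)
  then show ?case by (simp only: mult_Suc mult_Suc_right power_add mult_ac)
qed

text \<open>Pigeonhole over \<open>M\<close> equal steps from radius \<rho> to 2 \<rho>: if each
  step enlarged the Bohr set by a factor above 1 + \<eta>, the total growth would exceed the
  doubling constant. A step with little growth begins at a radius \<open>r\<close> that is almost
  invariant under shifts of size \<rho> / M.\<close>

lemma bohr_regular:
  assumes "finite \<Gamma>" "\<forall>\<gamma>\<in>\<Gamma>. unit_char \<gamma>" "\<rho> > 0" "M > 0" "card \<Gamma> \<le> D" "\<eta> > 0"
    "81 ^ D \<le> (1 + \<eta>) ^ M"
  obtains r where "\<rho> \<le> r" "r < 2 * \<rho>"
    "approx_inv \<eta> (bohr \<Gamma> r) (bohr \<Gamma> (\<rho> / M))"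
proof -
  define N where "N = (\<lambda>j. real (card (bohr \<Gamma> (\<rho> * (1 + j / M)))))"
  have "\<exists>j<M. N (Suc j) \<le> (1 + \<eta>) * N j"
  proof (rule ccontr)
    assume "\<not> ?thesis"
    then have *: "N (Suc j) > (1 + \<eta>) * N j" if "j < M" for j using that by force
    have N0: "N 0 > 0" using card_bohr_pos[OF assms(2), of \<rho>] assms(3) by (simp add: N_def)
    have "j \<le> M \<Longrightarrow> j > 0 \<Longrightarrow> (1 + \<eta>) ^ j * N 0 < N j" for j :: nat
    proof (induction j)
      case (Suc j)
      show ?case
      proof (cases "j = 0")
        case True then show ?thesis using *[of 0] Suc.prems by simp
      next
        case False
        then have "(1 + \<eta>) ^ j * N 0 < N j" using Suc by simp
        then have "(1 + \<eta>) * ((1 + \<eta>) ^ j * N 0) < (1 + \<eta>) * N j" using assms(6) by simp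
        also have "\<dots> < N (Suc j)" using * Suc.prems by simp
        finally show ?thesis by (simp add: algebra_simps)
      qed
    qed simp
    from this[of M] have 1: "(1 + \<eta>) ^ M * N 0 < N M" using assms(4) by simp
    have "N M = real (card (bohr \<Gamma> (2 * \<rho>)))" using assms(4) by (simp add: N_def mult.commute)
    also have "\<dots> \<le> real (81 ^ card \<Gamma> * card (bohr \<Gamma> \<rho>))"
      using bohr_doubling[OF assms(1-3)] of_nat_le_iff by blast
    also have "\<dots> = 81 ^ card \<Gamma> * N 0" by (simp add: N_def)
    also have "\<dots> \<le> 81 ^ D * N 0" using assms(5) N0 by (intro mult_right_mono power_increasing) auto
    also have "\<dots> \<le> (1 + \<eta>) ^ M * N 0" using assms(7) N0 by (intro mult_right_mono) auto
    finally show False using 1 by simp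
  qed
  then obtain j where j: "j < M" "N (Suc j) \<le> (1 + \<eta>) * N j" by blast
  define r where "r = \<rho> * (1 + j / M)"
  have N1: "N (Suc j) = real (card (bohr \<Gamma> (r + \<rho> / M)))"
    by (simp add: N_def r_def algebra_simps add_divide_distrib)
  show ?thesis
  proof
    show "\<rho> \<le> r" using assms(3) by (simp add: r_def)
    have "j / real M < 1" using j(1) by simp
    then have "\<rho> * (1 + j / M) < \<rho> * 2" using assms(3) by (intro mult_strict_left_mono) auto
    then show "r < 2 * \<rho>" by (simp add: r_def)
    show "approx_inv \<eta> (bohr \<Gamma> r) (bohr \<Gamma> (\<rho> / M))"
      unfolding approx_inv_def
    proof
      fix t assume t: "t \<in> bohr \<Gamma> (\<rho> / M)"
      have "(\<lambda>x. x + t) ` {x \<in> bohr \<Gamma> r. x + t \<notin> bohr \<Gamma> r} \<subseteq> bohr \<Gamma> (r + \<rho> / M) - bohr \<Gamma> r"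
        using add_bohr[OF assms(2) _ t] by auto
      then have "card {x \<in> bohr \<Gamma> r. x + t \<notin> bohr \<Gamma> r} \<le> card (bohr \<Gamma> (r + \<rho> / M) - bohr \<Gamma> r)"
        using card_mono[OF finite_Diff[OF finite_bohr]]
        by (metis (mono_tags, lifting) add_right_imp_eq card_image inj_onI)
      also have "\<dots> = card (bohr \<Gamma> (r + \<rho> / M)) - card (bohr \<Gamma> r)"
        using assms(3) by (intro card_Diff_subset finite_bohr bohr_mono) auto
      finally have "real (card {x \<in> bohr \<Gamma> r. x + t \<notin> bohr \<Gamma> r})
          \<le> real (card (bohr \<Gamma> (r + \<rho> / M)) - card (bohr \<Gamma> r))" by simp
      also have "\<dots> = N (Suc j) - N j"
        unfolding N1 using assms(3) card_mono[OF finite_bohr bohr_mono[of \<Gamma> \<Gamma> r "r + \<rho> / M"]]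
        by (simp add: N_def r_def of_nat_diff)
      also have "\<dots> \<le> \<eta> * N j" using j(2) by (simp add: algebra_simps)
      finally show "real (card {x \<in> bohr \<Gamma> r. x + t \<notin> bohr \<Gamma> r}) \<le> \<eta> * real (card (bohr \<Gamma> r))"
        by (simp add: N_def r_def)
    qed
  qed
qed

section \<open>Parseval and the Fourier bound for midpoint counts\<close>

lemma parseval:
  fixes f :: "'a \<Rightarrow> real"
  shows "(\<Sum>\<xi>\<in>X. (norm (\<Sum>x\<in>G. of_real (f x) * \<xi> x))\<^sup>2) = card X * (\<Sum>x\<in>G. (f x)\<^sup>2)"
proof -
  have orth: "(\<Sum>\<xi>\<in>X. \<xi> (x - y)) = (if x = y then of_nat (card X) else 0)" if "x \<in> G" "y \<in> G" for x y
    using orthogonality[OF diff_G[OF that]] X_char by (auto simp: unit_char_zero)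
  have "of_real (\<Sum>\<xi>\<in>X. (norm (\<Sum>x\<in>G. of_real (f x) * \<xi> x))\<^sup>2)
      = (\<Sum>\<xi>\<in>X. (\<Sum>x\<in>G. of_real (f x) * \<xi> x) * cnj (\<Sum>y\<in>G. of_real (f y) * \<xi> y))"
    by (simp add: complex_norm_square del: of_real_power cnj_sum)
  also have "\<dots> = (\<Sum>\<xi>\<in>X. \<Sum>x\<in>G. \<Sum>y\<in>G. of_real (f x * f y) * \<xi> (x - y))"
    by (intro sum.cong refl) (simp add: sum_product unit_char_diff[OF X_char] algebra_simps)
  also have "\<dots> = (\<Sum>x\<in>G. \<Sum>y\<in>G. \<Sum>\<xi>\<in>X. of_real (f x * f y) * \<xi> (x - y))"
    by (subst sum.swap, intro sum.cong refl, rule sum.swap)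
  also have "\<dots> = (\<Sum>x\<in>G. \<Sum>y\<in>G. of_real (f x * f y) * (if x = y then of_nat (card X) else 0))"
    by (intro sum.cong refl) (simp add: sum_distrib_left[symmetric] orth del: of_real_mult)
  also have "\<dots> = of_real (card X * (\<Sum>x\<in>G. (f x)\<^sup>2))"
    using finite_G by (simp add: sum_distrib_left power2_eq_square if_distrib mult.commute cong: if_cong)
  finally show ?thesis by (simp only: of_real_eq_iff)
qed

text \<open>By orthogonality, the sum over the characters of
  \<open>F \<xi> * F \<xi> * cnj (H \<xi>)\<close> keeps exactly the triples with x + z = 2 y. The
  weight of the midpoints is then estimated by its largest coefficient \<tau>, and the two factors
  \<open>F \<xi>\<close> by Parseval. The coefficient of \<open>g\<close> is taken at
  \<open>y + y\<close>, which is what spares an inversion of doubling.\<close>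

lemma fourier_midpoint_bound:
  fixes f g :: "'a \<Rightarrow> real"
  assumes "B \<subseteq> G" "\<And>\<xi>. \<xi> \<in> X \<Longrightarrow> norm (\<Sum>y\<in>B. of_real (g y) * \<xi> (y + y)) \<le> \<tau>"
  shows "\<bar>\<Sum>y\<in>B. g y * (\<Sum>x\<in>G. f x * f (y + y - x))\<bar> \<le> \<tau> * (\<Sum>x\<in>G. (f x)\<^sup>2)"
proof -
  define F where "F = (\<lambda>\<xi>::'a \<Rightarrow> complex. \<Sum>x\<in>G. of_real (f x) * \<xi> x)"
  define H where "H = (\<lambda>\<xi>::'a \<Rightarrow> complex. \<Sum>y\<in>B. of_real (g y) * \<xi> (y + y))"
  define Z where "Z = (\<Sum>y\<in>B. g y * (\<Sum>x\<in>G. f x * f (y + y - x)))"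
  have cX: "card X > 0" using finite_X X_nonempty by (simp add: card_gt_0_iff)
  have orth: "(\<Sum>\<xi>\<in>X. \<xi> (z - w)) = (if z = w then of_nat (card X) else 0)" if "z \<in> G" "w \<in> G" for z w
    using orthogonality[OF diff_G[OF that]] X_char by (auto simp: unit_char_zero)
  have "(\<Sum>\<xi>\<in>X. F \<xi> * F \<xi> * cnj (H \<xi>))
      = (\<Sum>\<xi>\<in>X. \<Sum>y\<in>B. \<Sum>x\<in>G. \<Sum>z\<in>G. of_real (g y * f x * f z) * \<xi> (z - (y + y - x)))"
  proof (intro sum.cong refl)
    fix \<xi> assume c: "\<xi> \<in> X"
    have e: "\<xi> (z - (y + y - x)) = \<xi> x * \<xi> z * cnj (\<xi> (y + y))" for x y z
    proof -
      have "z - (y + y - x) = (x + z) - (y + y)" by (simp add: algebra_simps)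
      then show ?thesis by (simp only: unit_char_diff[OF X_char[OF c]] unit_char_add[OF X_char[OF c], of x z])
    qed
    have "F \<xi> * F \<xi> * cnj (H \<xi>) = cnj (H \<xi>) * (F \<xi> * F \<xi>)" by simp
    also have "\<dots> = (\<Sum>y\<in>B. of_real (g y) * cnj (\<xi> (y + y))) *
        (\<Sum>x\<in>G. \<Sum>z\<in>G. of_real (f x) * \<xi> x * (of_real (f z) * \<xi> z))"
      by (simp add: F_def H_def sum_product)
    also have "\<dots> = (\<Sum>y\<in>B. \<Sum>x\<in>G. \<Sum>z\<in>G. of_real (g y) * cnj (\<xi> (y + y)) *
         (of_real (f x) * \<xi> x * (of_real (f z) * \<xi> z)))"
      by (subst sum_distrib_right) (simp only: sum_distrib_left)
    also have "\<dots> = (\<Sum>y\<in>B. \<Sum>x\<in>G. \<Sum>z\<in>G. of_real (g y * f x * f z) * \<xi> (z - (y + y - x)))"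
      by (intro sum.cong refl) (simp add: e mult_ac)
    finally show "F \<xi> * F \<xi> * cnj (H \<xi>) = \<dots>" .
  qed
  also have "\<dots> = (\<Sum>y\<in>B. \<Sum>x\<in>G. \<Sum>z\<in>G. \<Sum>\<xi>\<in>X. of_real (g y * f x * f z) * \<xi> (z - (y + y - x)))"
    by (subst sum.swap, intro sum.cong refl, subst sum.swap, intro sum.cong refl, rule sum.swap)
  also have "\<dots> = (\<Sum>y\<in>B. \<Sum>x\<in>G. \<Sum>z\<in>G. of_real (g y * f x * f z) *
      (if z = y + y - x then of_nat (card X) else 0))"
    using assms(1)
    by (intro sum.cong refl) (simp only: sum_distrib_left[symmetric], subst orth, auto intro: add_G diff_G)
  also have "\<dots> = (\<Sum>y\<in>B. \<Sum>x\<in>G. of_real (g y * f x * f (y + y - x)) * of_nat (card X))"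
  proof (intro sum.cong refl)
    fix y x assume "y \<in> B" "x \<in> G"
    then have "y + y - x \<in> G" using assms(1) by (auto intro: add_G diff_G)
    then show "(\<Sum>z\<in>G. of_real (g y * f x * f z) * (if z = y + y - x then of_nat (card X) else 0))
      = of_real (g y * f x * f (y + y - x)) * (of_nat (card X) :: complex)"
      using finite_G by (simp add: if_distrib cong: if_cong)
  qed
  also have "\<dots> = of_real (card X * Z)"
    by (simp add: Z_def sum_distrib_left algebra_simps)
  finally have id: "of_real (card X * Z) = (\<Sum>\<xi>\<in>X. F \<xi> * F \<xi> * cnj (H \<xi>))" by simp
  have "card X * \<bar>Z\<bar> = norm (of_real (card X * Z) :: complex)"
    by (simp add: abs_mult norm_mult)
  also have "\<dots> \<le> (\<Sum>\<xi>\<in>X. norm (F \<xi> * F \<xi> * cnj (H \<xi>)))"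
    unfolding id by (rule norm_sum)
  also have "\<dots> \<le> (\<Sum>\<xi>\<in>X. (norm (F \<xi>))\<^sup>2 * \<tau>)"
  proof (intro sum_mono)
    fix \<xi> assume "\<xi> \<in> X"
    then have "norm (H \<xi>) \<le> \<tau>" using assms(2) by (simp add: H_def)
    then show "norm (F \<xi> * F \<xi> * cnj (H \<xi>)) \<le> (norm (F \<xi>))\<^sup>2 * \<tau>"
      by (simp add: norm_mult power2_eq_square mult_left_mono)
  qed
  also have "\<dots> = card X * (\<tau> * (\<Sum>x\<in>G. (f x)\<^sup>2))"
    by (simp add: F_def parseval sum_distrib_right[symmetric])
  finally show ?thesis using cX by (simp add: Z_def)
qed

end

subsection \<open>Local estimates\<close>

lemma dens_bounds: "0 \<le> dens A S t" "dens A S t \<le> 1"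
proof -
  show "0 \<le> dens A S t" by (simp add: dens_def sum_nonneg)
  have "(\<Sum>w\<in>S. indicat_real A (t + w)) \<le> (\<Sum>w\<in>S. 1)" by (intro sum_mono) (simp add: indicator_def)
  then have "(\<Sum>w\<in>S. indicat_real A (t + w)) \<le> card S" by simp
  then show "dens A S t \<le> 1" unfolding dens_def by (cases "card S = 0") (auto simp: divide_le_eq)
qed

text \<open>\<open>H\<close> smooths the balanced function \<open>h\<close> along \<open>W\<close>.
  As \<psi> is nearly constant on \<open>W\<close> and \<open>B\<close> nearly invariant, the
  correlation with \<psi> survives and makes the sum of \<bar>H\<bar> large, while the sum of
  \<open>H\<close> is nearly nonnegative. Hence half of the absolute mass, up to errors, is
  positive, and somewhere the local density is larger than on \<open>B\<close>.\<close>

lemma density_increment_of_character: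
  fixes \<tau> \<eta> \<theta> :: real
  assumes inv: "approx_inv \<eta> B S" and B: "finite B" "B \<noteq> {}" and W: "finite W" "W \<noteq> {}"
    and WS: "\<And>w. w \<in> W \<Longrightarrow> w \<in> S" "\<And>w. w \<in> W \<Longrightarrow> - w \<in> S"
    and psi: "unit_char \<psi>" and psiW: "\<And>w. w \<in> W \<Longrightarrow> norm (\<psi> w - 1) \<le> \<theta>"
    and large: "\<tau> * card B \<le> norm (\<Sum>y\<in>B. of_real (indicat_real A y - dens A B 0) * \<psi> y)"
    and pos: "\<tau> - 4 * \<eta> - \<theta> > 0"
  shows "\<exists>y\<in>B. dens A W y \<ge> dens A B 0 + (\<tau> - 4 * \<eta> - \<theta>) / 2"
proof (rule ccontr)
  assume neg: "\<not> ?thesis"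
  define \<delta> where "\<delta> = (\<tau> - 4 * \<eta> - \<theta>) / 2"
  define h where "h = (\<lambda>y. indicat_real A y - dens A B 0)"
  define H where "H = (\<lambda>y. \<Sum>w\<in>W. h (y + w))"
  have cB: "real (card B) > 0" and cW: "real (card W) > 0" using B W by (auto simp: card_gt_0_iff)
  have h1: "\<bar>h y\<bar> \<le> 1" for y
    using dens_bounds[of A B 0] by (auto simp: h_def indicator_def)
  have sumh: "(\<Sum>y\<in>B. h y) = 0" using cB by (simp add: h_def sum_subtractf dens_def)
  have Hd: "H y < card W * \<delta>" if "y \<in> B" for y
  proof -
    have "H y = card W * (dens A W y - dens A B 0)"
      using cW by (simp add: H_def h_def sum_subtractf dens_def right_diff_distrib)
    moreover
    have "\<not> dens A B 0 + \<delta> \<le> dens A W y" using neg that unfolding \<delta>_def by blast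
    then have "dens A W y - dens A B 0 < \<delta>" by linarith
    ultimately show ?thesis using cW by simp
  qed
  have shift: "norm ((\<Sum>y\<in>B. of_real (h (y + w)) * \<psi> y) - (\<Sum>y\<in>B. of_real (h y) * \<psi> y))
      \<le> (2 * \<eta> + \<theta>) * card B" if w: "w \<in> W" for w
  proof -
    have 1: "norm ((\<Sum>y\<in>B. of_real (h (y + w)) * \<psi> (y + w)) - (\<Sum>y\<in>B. of_real (h y) * \<psi> y))
        \<le> 2 * \<eta> * 1 * card B"
      using WS w h1 by (intro approx_inv_sum[OF inv B(1)]) (auto simp: norm_mult unit_char_norm[OF psi])
    have "norm ((\<Sum>y\<in>B. of_real (h (y + w)) * \<psi> y) - (\<Sum>y\<in>B. of_real (h (y + w)) * \<psi> (y + w)))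
        = norm (\<Sum>y\<in>B. of_real (h (y + w)) * \<psi> y * (1 - \<psi> w))"
      by (simp add: sum_subtractf[symmetric] unit_char_add[OF psi] algebra_simps)
    also have "\<dots> \<le> card B * \<theta>"
    proof (rule sum_norm_bound)
      fix y
      have "norm (1 - \<psi> w) \<le> \<theta>" using psiW[OF w] by (simp add: norm_minus_commute)
      moreover have "norm (of_real (h (y + w)) * \<psi> y * (1 - \<psi> w)) = \<bar>h (y + w)\<bar> * norm (1 - \<psi> w)"
        by (simp add: norm_mult unit_char_norm[OF psi])
      moreover have "\<bar>h (y + w)\<bar> * norm (1 - \<psi> w) \<le> 1 * norm (1 - \<psi> w)"
        by (intro mult_right_mono h1) auto
      ultimately show "norm (of_real (h (y + w)) * \<psi> y * (1 - \<psi> w)) \<le> \<theta>" by linarith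
    qed
    finally have 2: "norm ((\<Sum>y\<in>B. of_real (h (y + w)) * \<psi> y) -
        (\<Sum>y\<in>B. of_real (h (y + w)) * \<psi> (y + w))) \<le> card B * \<theta>" .
    show ?thesis using norm_diff_triangle_le[OF 2 1] by (simp add: algebra_simps)
  qed
  have lower: "(\<Sum>y\<in>B. \<bar>H y\<bar>) \<ge> card W * ((\<tau> - 2 * \<eta> - \<theta>) * card B)"
  proof -
    define s where "s = (\<Sum>y\<in>B. of_real (h y) * \<psi> y)"
    have "(\<Sum>y\<in>B. of_real (H y) * \<psi> y) = (\<Sum>w\<in>W. \<Sum>y\<in>B. of_real (h (y + w)) * \<psi> y)"
      unfolding H_def of_real_sum sum_distrib_right by (rule sum.swap)
    also have "\<dots> = of_nat (card W) * s + (\<Sum>w\<in>W. (\<Sum>y\<in>B. of_real (h (y + w)) * \<psi> y) - s)"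
      by (simp add: sum_subtractf)
    finally have e: "(\<Sum>y\<in>B. of_real (H y) * \<psi> y) - (\<Sum>w\<in>W. (\<Sum>y\<in>B. of_real (h (y + w)) * \<psi> y) - s)
        = of_nat (card W) * s" by simp
    have "card W * norm s = norm (of_nat (card W) * s)" by (simp add: norm_mult)
    also have "\<dots> \<le> norm (\<Sum>y\<in>B. of_real (H y) * \<psi> y)
        + norm (\<Sum>w\<in>W. (\<Sum>y\<in>B. of_real (h (y + w)) * \<psi> y) - s)"
      unfolding e[symmetric] by (rule norm_triangle_ineq4)
    also have "norm (\<Sum>y\<in>B. of_real (H y) * \<psi> y) \<le> (\<Sum>y\<in>B. \<bar>H y\<bar>)"
      by (rule sum_norm_le) (simp add: norm_mult unit_char_norm[OF psi])
    also have "norm (\<Sum>w\<in>W. (\<Sum>y\<in>B. of_real (h (y + w)) * \<psi> y) - s) \<le> card W * ((2 * \<eta> + \<theta>) * card B)"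
      using shift unfolding s_def by (intro sum_norm_bound)
    finally have "card W * norm s \<le> (\<Sum>y\<in>B. \<bar>H y\<bar>) + card W * ((2 * \<eta> + \<theta>) * card B)" by simp
    moreover have "card W * (\<tau> * card B) \<le> card W * norm s"
      using large by (intro mult_left_mono) (auto simp: s_def h_def)
    ultimately show ?thesis by (simp add: algebra_simps)
  qed
  have sumH: "(\<Sum>y\<in>B. H y) \<ge> - (2 * \<eta> * card B * card W)"
  proof -
    have "(\<Sum>y\<in>B. H y) = (\<Sum>w\<in>W. \<Sum>y\<in>B. h (y + w))" unfolding H_def by (rule sum.swap)
    also have "\<dots> \<ge> (\<Sum>w\<in>W. - (2 * \<eta> * card B))"
    proof (intro sum_mono)
      fix w assume "w \<in> W"
      then show "- (2 * \<eta> * card B) \<le> (\<Sum>y\<in>B. h (y + w))"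
        using approx_inv_sum[OF inv B(1) WS(1) WS(2), of w h 1] h1 sumh by auto
    qed
    finally show ?thesis by (simp add: algebra_simps)
  qed
  have d0: "\<delta> > 0" using pos by (simp add: \<delta>_def)
  \<comment> \<open>\<bar>H\<bar> is twice the positive part minus \<open>H\<close>, and the
    positive part is below \<open>card W * \<delta>\<close> everywhere.\<close>
  have "(\<Sum>y\<in>B. \<bar>H y\<bar>) < (\<Sum>y\<in>B. 2 * card W * \<delta> - H y)"
  proof (rule sum_strict_mono[OF B])
    fix y assume "y \<in> B"
    then have "H y < card W * \<delta>" by (rule Hd)
    moreover have "card W * \<delta> > 0" using d0 cW by simp
    moreover have "\<bar>H y\<bar> = H y \<or> \<bar>H y\<bar> = - H y" by arith
    ultimately show "\<bar>H y\<bar> < 2 * card W * \<delta> - H y" by linarith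
  qed
  also have "\<dots> \<le> 2 * card W * \<delta> * card B + 2 * \<eta> * card B * card W"
    using sumH by (simp add: sum_subtractf algebra_simps)
  also have "\<dots> = card W * ((\<tau> - 2 * \<eta> - \<theta>) * card B)"
    by (simp add: \<delta>_def field_simps)
  finally show False using lower by simp
qed

context fourier_group begin

text \<open>With \<open>P\<close> and \<open>Q\<close> the local averages of \<open>f\<close> along \<open>2 W\<close> and \<open>2 B2\<close>, the count is about the sum of
  \<open>P x * Q (- x)\<close>. The bound follows from \<open>(\<Lambda> - P x) * (\<Lambda> - Q (- x)) \<ge> 0\<close>: an upper bound by
  \<open>\<Lambda> < 2 a1\<close> already prevents \<open>P\<close> and \<open>Q \<circ> uminus\<close> from having disjoint supports. Smoothing \<open>f\<close> to \<open>P\<close> is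
  what makes a constant factor increment available in the other case.\<close>

lemma midpoint_count_lower:
  fixes f :: "'a \<Rightarrow> real" and \<eta> \<Lambda> a1 :: real
  assumes f: "\<And>x. 0 \<le> f x" "\<And>x. f x \<le> 1" and supp: "\<And>x. x \<notin> B1 \<Longrightarrow> f x = 0"
    and B1: "B1 \<subseteq> G" "\<And>x. x \<in> B1 \<Longrightarrow> - x \<in> B1" and B2: "B2 \<subseteq> G" "B2 \<noteq> {}"
    and W: "W \<subseteq> G" "W \<noteq> {}" "\<And>x. x \<in> W \<Longrightarrow> - x \<in> W"
    and inv1: "approx_inv \<eta> B1 S" and S: "\<And>t. t \<in> S \<Longrightarrow> - t \<in> S"
    and WS: "\<And>w. w \<in> W \<Longrightarrow> w + w \<in> S" and B2S: "\<And>w. w \<in> B2 \<Longrightarrow> w + w \<in> S"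
    and inv2: "approx_inv \<eta> B2 W" and eta: "\<eta> \<ge> 0"
    and up: "\<And>x. x \<in> G \<Longrightarrow> (\<Sum>w\<in>W. f (x + (w + w))) \<le> \<Lambda> * card W"
      "\<And>x. x \<in> G \<Longrightarrow> (\<Sum>w\<in>B2. f (x + (w + w))) \<le> \<Lambda> * card B2"
    and Lam: "\<Lambda> \<ge> 0" and a1: "a1 * card B1 \<le> (\<Sum>x\<in>B1. f x)"
  shows "card B1 * card B2 * (2 * \<Lambda> * (a1 - 2 * \<eta>) - \<Lambda>\<^sup>2 - 2 * \<eta>)
    \<le> (\<Sum>y\<in>B2. \<Sum>x\<in>G. f x * f (y + y - x))"
proof -
  define P where "P = (\<lambda>x. \<Sum>w\<in>W. f (x + (w + w)))"
  define Q where "Q = (\<lambda>x. \<Sum>w\<in>B2. f (x + (w + w)))"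
  define L where "L = (\<Sum>y\<in>B2. \<Sum>x\<in>G. f x * f (y + y - x))"
  note fin = finite_subset[OF B1(1) finite_G] finite_subset[OF B2(1) finite_G] finite_subset[OF W(1) finite_G]
  have cW: "real (card W) > 0" using W(2) fin by (simp add: card_gt_0_iff)
  have f_abs: "norm (f x) \<le> 1" for x using f[of x] by simp
  have PQ0: "P x \<ge> 0" "Q x \<ge> 0" for x by (auto simp: P_def Q_def intro: sum_nonneg f)
  have L: "L = (\<Sum>x\<in>G. f x * Q (- x))"
    unfolding L_def Q_def by (subst sum.swap) (simp add: sum_distrib_left algebra_simps)
  have sumf: "(\<Sum>x\<in>G. f x) = (\<Sum>x\<in>B1. f x)"
    using supp by (intro sum.mono_neutral_right finite_G B1) auto
  have sumf_le: "(\<Sum>x\<in>G. f x) \<le> card B1"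
    unfolding sumf using sum_mono[of B1 f "\<lambda>_. 1"] f by simp
  \<comment> \<open>Shifting x by 2 w changes the argument of \<open>Q\<close> by - 2 w, which
    amounts to replacing y by y - w in its sum over \<open>B2\<close>. Almost invariance of
    \<open>B2\<close> under \<open>W\<close> therefore allows \<open>f\<close> to be replaced by its
    average along 2 W.\<close>
  have Lw: "L \<ge> (\<Sum>x\<in>G. f (x + (w + w)) * (Q (- x) - 2 * \<eta> * card B2))" if w: "w \<in> W" for w
  proof -
    have wG: "w + w \<in> G" using w W(1) add_G by auto
    have "L = (\<Sum>x\<in>G. f (x + (w + w)) * Q (- (x + (w + w))))"
      unfolding L by (rule sum_G_shift[OF wG, of "\<lambda>x. f x * Q (- x)", symmetric])
    also have "\<dots> \<ge> (\<Sum>x\<in>G. f (x + (w + w)) * (Q (- x) - 2 * \<eta> * card B2))"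
    proof (intro sum_mono mult_left_mono f)
      fix x
      have "Q (- (x + (w + w))) = (\<Sum>y\<in>B2. f (- x + ((y + - w) + (y + - w))))"
        unfolding Q_def by (intro sum.cong refl arg_cong[of _ _ f]) (simp add: algebra_simps)
      moreover have "norm ((\<Sum>y\<in>B2. f (- x + ((y + - w) + (y + - w)))) - (\<Sum>y\<in>B2. f (- x + (y + y))))
          \<le> 2 * \<eta> * 1 * card B2"
        by (rule approx_inv_sum[OF inv2 fin(2), where h = "\<lambda>y. f (- x + (y + y))"])
          (use w W(3) f_abs in auto)
      ultimately show "Q (- x) - 2 * \<eta> * card B2 \<le> Q (- (x + (w + w)))"
        unfolding Q_def by (auto simp: abs_le_iff)
    qed
    finally show ?thesis .
  qed
  have "card W * L = (\<Sum>w\<in>W. L)" by simp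
  also have "\<dots> \<ge> (\<Sum>w\<in>W. \<Sum>x\<in>G. f (x + (w + w)) * (Q (- x) - 2 * \<eta> * card B2))"
    by (intro sum_mono Lw)
  also have "(\<Sum>w\<in>W. \<Sum>x\<in>G. f (x + (w + w)) * (Q (- x) - 2 * \<eta> * card B2))
      = (\<Sum>x\<in>G. P x * Q (- x)) - 2 * \<eta> * card B2 * (\<Sum>w\<in>W. \<Sum>x\<in>G. f (x + (w + w)))"
  proof -
    have "(\<Sum>w\<in>W. \<Sum>x\<in>G. f (x + (w + w)) * Q (- x)) = (\<Sum>x\<in>G. P x * Q (- x))"
      unfolding P_def sum_distrib_right by (rule sum.swap)
    then show ?thesis by (simp add: right_diff_distrib sum_subtractf sum_distrib_left mult_ac)
  qed
  also have "(\<Sum>w\<in>W. \<Sum>x\<in>G. f (x + (w + w))) = (\<Sum>w\<in>W. \<Sum>x\<in>G. f x)"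
    using W(1) add_G by (intro sum.cong refl sum_G_shift) auto
  finally have 1: "card W * L \<ge> (\<Sum>x\<in>G. P x * Q (- x)) - 2 * \<eta> * card B2 * (card W * (\<Sum>x\<in>G. f x))"
    by simp
  have 2: "2 * \<eta> * card B2 * (card W * (\<Sum>x\<in>G. f x)) \<le> 2 * \<eta> * card B2 * (real (card W) * card B1)"
    using eta by (intro mult_left_mono[OF mult_left_mono[OF sumf_le]]) auto
  have sumB1: "(\<Sum>x\<in>B1. \<Sum>w\<in>V. f (x + (w + w))) \<ge> card V * ((a1 - 2 * \<eta>) * card B1)"
    if V: "\<And>w. w \<in> V \<Longrightarrow> w + w \<in> S" for V
  proof -
    have "(\<Sum>x\<in>B1. \<Sum>w\<in>V. f (x + (w + w))) = (\<Sum>w\<in>V. \<Sum>x\<in>B1. f (x + (w + w)))" by (rule sum.swap)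
    also have "\<dots> \<ge> (\<Sum>w\<in>V. (a1 - 2 * \<eta>) * card B1)"
    proof (intro sum_mono)
      fix w assume "w \<in> V"
      then have "norm ((\<Sum>x\<in>B1. f (x + (w + w))) - (\<Sum>x\<in>B1. f x)) \<le> 2 * \<eta> * 1 * card B1"
        by (intro approx_inv_sum[OF inv1 fin(1)] V S f_abs)
      then show "(a1 - 2 * \<eta>) * card B1 \<le> (\<Sum>x\<in>B1. f (x + (w + w)))"
        using a1 by (auto simp: abs_le_iff algebra_simps)
    qed
    finally show ?thesis by simp
  qed
  have P1: "(\<Sum>x\<in>B1. P x) \<ge> card W * ((a1 - 2 * \<eta>) * card B1)"
    unfolding P_def by (rule sumB1[OF WS])
  have "(\<Sum>x\<in>B1. Q (- x)) = (\<Sum>x\<in>B1. Q x)"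
    by (rule sum.reindex_bij_witness[of _ "\<lambda>x. - x" "\<lambda>x. - x"]) (auto intro: B1)
  then have Q1: "(\<Sum>x\<in>B1. Q (- x)) \<ge> card B2 * ((a1 - 2 * \<eta>) * card B1)"
    using sumB1[OF B2S] by (simp add: Q_def)
  have "(\<Sum>x\<in>G. P x * Q (- x)) \<ge> (\<Sum>x\<in>B1. P x * Q (- x))"
    using PQ0 by (intro sum_mono2 finite_G B1) auto
  moreover have "(\<Sum>x\<in>B1. P x * Q (- x)) \<ge>
      (\<Sum>x\<in>B1. \<Lambda> * card B2 * P x + \<Lambda> * card W * Q (- x) - \<Lambda> * card B2 * (\<Lambda> * card W))"
  proof (rule sum_mono)
    fix x assume "x \<in> B1"
    then have "x \<in> G" "- x \<in> G" using B1 uminus_G by auto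
    then have "P x \<le> \<Lambda> * card W" "Q (- x) \<le> \<Lambda> * card B2"
      unfolding P_def Q_def using up by blast+
    then have "0 \<le> (\<Lambda> * card W - P x) * (\<Lambda> * card B2 - Q (- x))" by (intro mult_nonneg_nonneg) auto
    then show "\<Lambda> * card B2 * P x + \<Lambda> * card W * Q (- x) - \<Lambda> * card B2 * (\<Lambda> * card W) \<le> P x * Q (- x)"
      by (simp add: algebra_simps)
  qed
  moreover have "(\<Sum>x\<in>B1. \<Lambda> * card B2 * P x + \<Lambda> * card W * Q (- x) - \<Lambda> * card B2 * (\<Lambda> * card W))
    = \<Lambda> * card B2 * (\<Sum>x\<in>B1. P x) + \<Lambda> * card W * (\<Sum>x\<in>B1. Q (- x)) - card B1 * (\<Lambda> * card B2 * (\<Lambda> * card W))"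
    by (simp add: sum.distrib sum_subtractf sum_distrib_left)
  moreover have "\<Lambda> * card B2 * (card W * ((a1 - 2 * \<eta>) * card B1)) \<le> \<Lambda> * card B2 * (\<Sum>x\<in>B1. P x)"
    using P1 Lam by (intro mult_left_mono) auto
  moreover have "\<Lambda> * card W * (card B2 * ((a1 - 2 * \<eta>) * card B1)) \<le> \<Lambda> * card W * (\<Sum>x\<in>B1. Q (- x))"
    using Q1 Lam by (intro mult_left_mono) auto
  ultimately have "card W * L \<ge> card W * (card B1 * card B2 * (2 * \<Lambda> * (a1 - 2 * \<eta>) - \<Lambda>\<^sup>2 - 2 * \<eta>))"
    using 1 2 by (simp add: algebra_simps power2_eq_square)
  then show ?thesis using cW by (simp add: L_def)
qed

end

subsection \<open>The density increment\<close>

lemma sum_indicator_real: "finite S \<Longrightarrow> (\<Sum>x\<in>S. indicat_real T x) = card (S \<inter> T)"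
  using sum_indicator_mult[of S T "\<lambda>_. 1::real"] by simp

lemma dens_translate: "dens {x. t + x \<in> A} S y = dens A S (t + y)"
  by (simp add: dens_def indicator_def add.assoc)

lemma dens_double_translate:
  "dens {x. t + (x + x) \<in> A} S 0 = (\<Sum>w\<in>S. indicat_real A (t + (w + w))) / card S"
  by (simp add: dens_def indicator_def)

text \<open>Both local densities have average at least a - 2 \<eta> over \<open>B\<close>, so at
  some point their sum is at least 2 a - 4 \<eta>. The upper bound \<open>u\<close> for either then
  bounds the other from below; the loss is small when \<open>u\<close> is close to
  \<open>a\<close>.\<close>

lemma common_translate:
  fixes \<eta> a u :: real
  assumes inv: "approx_inv \<eta> B S" and B: "finite B" "B \<noteq> {}" and S: "\<And>t. t \<in> S \<Longrightarrow> - t \<in> S"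
    and V: "V1 \<subseteq> S" "V2 \<subseteq> S" "finite V1" "finite V2" "V1 \<noteq> {}" "V2 \<noteq> {}"
    and a: "a \<le> dens A B 0" and u: "\<And>t. t \<in> B \<Longrightarrow> dens A V1 t \<le> u" "\<And>t. t \<in> B \<Longrightarrow> dens A V2 t \<le> u"
  shows "\<exists>t\<in>B. 2 * a - 4 * \<eta> - u \<le> dens A V1 t \<and> 2 * a - 4 * \<eta> - u \<le> dens A V2 t"
proof -
  have cB: "real (card B) > 0" using B by (simp add: card_gt_0_iff)
  have avg: "(\<Sum>t\<in>B. dens A V t) \<ge> card B * (a - 2 * \<eta>)" if V: "V \<subseteq> S" "finite V" "V \<noteq> {}" for V
  proof -
    have cV: "real (card V) > 0" using V by (simp add: card_gt_0_iff)
    have "card V * (\<Sum>t\<in>B. dens A V t) = (\<Sum>t\<in>B. \<Sum>w\<in>V. indicat_real A (t + w))"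
      using cV by (simp add: dens_def sum_divide_distrib[symmetric])
    also have "\<dots> = (\<Sum>w\<in>V. \<Sum>t\<in>B. indicat_real A (t + w))" by (rule sum.swap)
    also have "\<dots> \<ge> (\<Sum>w\<in>V. card B * (a - 2 * \<eta>))"
    proof (intro sum_mono)
      fix w assume "w \<in> V"
      then have w: "w \<in> S" using V by blast
      have "norm ((\<Sum>t\<in>B. indicat_real A (t + w)) - (\<Sum>t\<in>B. indicat_real A t)) \<le> 2 * \<eta> * 1 * card B"
        by (rule approx_inv_sum[OF inv B(1) w S[OF w]]) (simp add: indicator_def)
      moreover have "a * card B \<le> (\<Sum>t\<in>B. indicat_real A t)"
        using a cB by (simp add: dens_def field_simps)
      ultimately show "card B * (a - 2 * \<eta>) \<le> (\<Sum>t\<in>B. indicat_real A (t + w))"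
        by (auto simp: abs_le_iff algebra_simps)
    qed
    finally have "card V * (card B * (a - 2 * \<eta>)) \<le> card V * (\<Sum>t\<in>B. dens A V t)" by simp
    then show ?thesis using cV by simp
  qed
  have "(\<Sum>t\<in>B. 2 * a - 4 * \<eta>) \<le> (\<Sum>t\<in>B. dens A V1 t + dens A V2 t)"
    using avg[of V1] avg[of V2] V by (simp add: sum.distrib algebra_simps)
  then have "\<exists>t\<in>B. 2 * a - 4 * \<eta> \<le> dens A V1 t + dens A V2 t"
    using sum_strict_mono[OF B, of "\<lambda>t. dens A V1 t + dens A V2 t" "\<lambda>_. 2 * a - 4 * \<eta>"]
    by (meson not_le)
  then show ?thesis using u by force
qed

locale increment_setup = fourier_group +
  fixes \<alpha> :: real and M D :: nat
  assumes alpha: "0 < \<alpha>" "\<alpha> \<le> 1" and M_pos: "M > 0"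
    and M_large: "81 ^ D \<le> (1 + \<alpha>\<^sup>2 / 512) ^ M"
begin

text \<open>Three successive regularisations bring the scale s down to s / (32 M^3); the last Bohr
  set, with the new character, is regularised at a scale smaller by a further factor \<alpha>^2 /
  128.\<close>

definition shrink :: real where "shrink = \<alpha>\<^sup>2 / (4096 * M ^ 3)"

text \<open>\<open>K\<close> contains the common differences that progressions of \<open>A\<close> may have. The radius \<open>s\<close> is the scale on
  which the Bohr set of radius \<open>r\<close> is almost translation invariant; only \<open>s\<close> enters the size estimates.\<close>

definition state :: "'a set \<Rightarrow> 'a set \<Rightarrow> ('a \<Rightarrow> complex) set \<Rightarrow> real \<Rightarrow> real \<Rightarrow> real \<Rightarrow> bool" where
  "state A K \<Gamma> r s a \<longleftrightarrow> finite \<Gamma> \<and> (\<forall>\<gamma>\<in>\<Gamma>. unit_char \<gamma>) \<and> 0 < s \<and> s \<le> 1 \<and> s \<le> r \<and>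
     approx_inv (\<alpha>\<^sup>2 / 512) (bohr \<Gamma> r) (bohr \<Gamma> s) \<and> \<alpha> \<le> a \<and> a \<le> dens A (bohr \<Gamma> r) 0 \<and> K \<subseteq> G \<and>
     (\<forall>x\<in>G. \<forall>d\<in>G. x \<in> A \<and> x + d \<in> A \<and> x + d + d \<in> A \<longrightarrow> d \<in> K)"

lemma shrink_pos: "0 < shrink" and shrink_le: "shrink \<le> \<alpha>\<^sup>2 / 4096"
proof -
  show "0 < shrink" using alpha M_pos by (simp add: shrink_def)
  have "1 \<le> real M ^ 3" using M_pos by simp
  then have "\<alpha>\<^sup>2 / (4096 * real M ^ 3) \<le> \<alpha>\<^sup>2 / (4096 * 1)"
    using M_pos by (intro divide_left_mono mult_left_mono) auto
  then show "shrink \<le> \<alpha>\<^sup>2 / 4096" by (simp add: shrink_def)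
qed

lemma state_translate:
  assumes st: "state A K \<Gamma> r s a" and new: "finite \<Gamma>'" "\<forall>\<gamma>\<in>\<Gamma>'. unit_char \<gamma>" "0 < s''" "s'' \<le> s'" "s'' \<le> 1" "s' \<le> r'"
      "approx_inv (\<alpha>\<^sup>2 / 512) (bohr \<Gamma>' r') (bohr \<Gamma>' s')" "t \<in> G" "\<alpha> \<le> a'" "a' \<le> dens A (bohr \<Gamma>' r') t"
  shows "state {x. t + x \<in> A} K \<Gamma>' r' s'' a'"
  unfolding state_def
proof (intro conjI ballI impI)
  show "approx_inv (\<alpha>\<^sup>2 / 512) (bohr \<Gamma>' r') (bohr \<Gamma>' s'')"
    using new(7) by (rule approx_inv_mono) (intro bohr_mono new order_refl)
  show "a' \<le> dens {x. t + x \<in> A} (bohr \<Gamma>' r') 0" using new(10) by (simp add: dens_translate)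
  fix x d assume "x \<in> G" "d \<in> G" "x \<in> {x. t + x \<in> A} \<and> x + d \<in> {x. t + x \<in> A} \<and> x + d + d \<in> {x. t + x \<in> A}"
  then have "t + x \<in> G" "t + x \<in> A" "t + x + d \<in> A" "t + x + d + d \<in> A" using add_G new(8) by (auto simp: add.assoc)
  then show "d \<in> K" using st \<open>d \<in> G\<close> unfolding state_def by blast
qed (use new st in \<open>auto simp: state_def\<close>)

text \<open>A progression of difference d in the pull-back is one of difference 2 d in
  \<open>A\<close>, so \<open>K\<close> is pulled back under doubling. The set of characters, and
  with it the rank, is unchanged.\<close>

lemma state_double:
  assumes st: "state A K \<Gamma> r s a" and new: "0 < s''" "s'' \<le> s'" "s'' \<le> 1" "s' \<le> r'"
      "approx_inv (\<alpha>\<^sup>2 / 512) (bohr \<Gamma> r') (bohr \<Gamma> s')" "t \<in> G" "\<alpha> \<le> a'"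
      "a' \<le> (\<Sum>w\<in>bohr \<Gamma> r'. indicat_real A (t + (w + w))) / card (bohr \<Gamma> r')"
  shows "state {x. t + (x + x) \<in> A} {d \<in> G. d + d \<in> K} \<Gamma> r' s'' a'"
  unfolding state_def
proof (intro conjI ballI impI)
  show "approx_inv (\<alpha>\<^sup>2 / 512) (bohr \<Gamma> r') (bohr \<Gamma> s'')"
    using new(5) by (rule approx_inv_mono) (intro bohr_mono new order_refl)
  show "a' \<le> dens {x. t + (x + x) \<in> A} (bohr \<Gamma> r') 0" using new(8) by (simp add: dens_double_translate)
  fix x d assume *: "x \<in> G" "d \<in> G" "x \<in> {x. t + (x + x) \<in> A} \<and> x + d \<in> {x. t + (x + x) \<in> A} \<and>
     x + d + d \<in> {x. t + (x + x) \<in> A}"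
  define y where "y = t + (x + x)"
  have "y \<in> G" "d + d \<in> G" using * new(6) by (auto simp: y_def add_G)
  moreover have "y \<in> A" "y + (d + d) \<in> A" "y + (d + d) + (d + d) \<in> A"
    using *(3) by (auto simp: y_def algebra_simps)
  ultimately have "d + d \<in> K" using st unfolding state_def by blast
  then show "d \<in> {d \<in> G. d + d \<in> K}" using * by simp
qed (use new st in \<open>auto simp: state_def\<close>)

text \<open>The Bohr sets \<open>B1\<close>, \<open>B2\<close>, \<open>W\<close>, \<open>B3\<close> below are nested scales, each almost invariant under the next.
  Progressions are counted with midpoint in \<open>B2\<close> and end points in \<open>B1\<close>, around a common
  centre \<open>t\<close> at which neither density drops.\<close>

lemma state_step:
  assumes st: "state A K \<Gamma> r s a" and D: "card \<Gamma> < D"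
  shows "a ^ 3 / 8 * card (bohr \<Gamma> (s / 2)) \<le> card K \<or>
    (\<exists>A' \<Gamma>' r'. state A' K \<Gamma>' r' (shrink * s) (a * (1 + \<alpha> / 128)) \<and> card \<Gamma>' \<le> card \<Gamma> + 1) \<or>
    (\<exists>A' r'. state A' {d \<in> G. d + d \<in> K} \<Gamma> r' (shrink * s) (7 / 4 * a))"
proof (rule ccontr)
  assume neg: "\<not> ?thesis"
  \<comment> \<open>These constants balance exactly: 4 \<eta> + \<theta> = \<alpha>^2 / 64, so a
    coefficient a^2 / 16 yields a gain of at least 3 a^2 / 128. Passing to the common centre loses
    at most 2 \<alpha> a / 128, which leaves the increment \<alpha> a / 128 in
    \<open>u\<close>.\<close>
  define \<eta> where "\<eta> = \<alpha>\<^sup>2 / 512"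
  define \<theta> where "\<theta> = \<alpha>\<^sup>2 / 128"
  define u where "u = a * (1 + \<alpha> / 128)"
  have S: "finite \<Gamma>" "\<forall>\<gamma>\<in>\<Gamma>. unit_char \<gamma>" "0 < s" "s \<le> 1" "s \<le> r" "approx_inv \<eta> (bohr \<Gamma> r) (bohr \<Gamma> s)"
    "\<alpha> \<le> a" "a \<le> dens A (bohr \<Gamma> r) 0" "K \<subseteq> G"
    and ap: "\<And>x d. x \<in> G \<Longrightarrow> d \<in> G \<Longrightarrow> x \<in> A \<Longrightarrow> x + d \<in> A \<Longrightarrow> x + d + d \<in> A \<Longrightarrow> d \<in> K"
    using st unfolding state_def \<eta>_def by blast+
  have a0: "a > 0" using S(7) alpha by linarith
  have a1': "a \<le> 1" using S(8) dens_bounds(2)[of A "bohr \<Gamma> r" 0] by linarith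
  have eta0: "\<eta> > 0" using alpha by (simp add: \<eta>_def)
  have th0: "\<theta> > 0" using alpha by (simp add: \<theta>_def)
  have al2: "\<alpha>\<^sup>2 \<le> a\<^sup>2" using S(7) alpha by (intro power_mono) auto
  have ala: "\<alpha> * a \<le> a\<^sup>2" using S(7) a0 by (simp add: power2_eq_square)
  have al3: "\<alpha>\<^sup>2 \<le> \<alpha> * a" using S(7) alpha by (simp add: power2_eq_square)
  have al1: "\<alpha>\<^sup>2 \<le> 1" using alpha by (simp add: power_le_one)
  have ala1: "\<alpha> * a \<le> a" using alpha a0 by simp
  have u_gt: "\<alpha> \<le> u" using a0 alpha S(7) by (simp add: u_def algebra_simps add_increasing2)
  have M0: "real M \<ge> 1" using M_pos by simp
  have sh: "shrink * s > 0" "shrink * s \<le> 1"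
    using shrink_pos shrink_le S(3,4) al1 mult_mono[of shrink 1 s 1] by auto
  \<comment> \<open>The failure of the two increment alternatives is used as a pair of upper bounds,
    valid at all translates and at every regular scale not below \<open>shrink * s\<close>.\<close>
  have no1: "dens A (bohr \<Gamma>' r') t < u"
    if "finite \<Gamma>'" "\<forall>\<gamma>\<in>\<Gamma>'. unit_char \<gamma>" "card \<Gamma>' \<le> card \<Gamma> + 1" "shrink * s \<le> s'" "s' \<le> r'"
      "approx_inv \<eta> (bohr \<Gamma>' r') (bohr \<Gamma>' s')" "t \<in> G" for \<Gamma>' r' s' t
  proof (rule ccontr)
    assume "\<not> ?thesis"
    then have "state {x. t + x \<in> A} K \<Gamma>' r' (shrink * s) u"
      using that sh u_gt by (intro state_translate[OF st, where s' = s']) (auto simp: \<eta>_def)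
    then show False using neg that(3) unfolding u_def by blast
  qed
  have no2: "(\<Sum>w\<in>bohr \<Gamma> r'. indicat_real A (t + (w + w))) \<le> 7 / 4 * a * card (bohr \<Gamma> r')"
    if "shrink * s \<le> s'" "s' \<le> r'" "approx_inv \<eta> (bohr \<Gamma> r') (bohr \<Gamma> s')" "t \<in> G" for r' s' t
  proof (rule ccontr)
    assume n: "\<not> ?thesis"
    have "r' \<ge> 0" using that sh by linarith
    then have "real (card (bohr \<Gamma> r')) > 0" using card_bohr_pos[OF S(2)] by simp
    then have "7 / 4 * a \<le> (\<Sum>w\<in>bohr \<Gamma> r'. indicat_real A (t + (w + w))) / card (bohr \<Gamma> r')"
      using n by (simp add: field_simps)
    then have "state {x. t + (x + x) \<in> A} {d \<in> G. d + d \<in> K} \<Gamma> r' (shrink * s) (7 / 4 * a)"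
      using that sh a0 S(7) by (intro state_double[OF st, where s' = s']) (auto simp: \<eta>_def)
    then show False using neg by blast
  qed
  \<comment> \<open>\<open>s1\<close>, \<open>s2\<close>, \<open>s3\<close> are the scales under
    which \<open>B1\<close>, \<open>B2\<close>, \<open>W\<close> are almost invariant.
    \<open>B2\<close> starts at s1 / 4 so that its regular radius stays below s1 / 2 and the doubles
    of its elements still lie in the Bohr set of radius \<open>s1\<close>.\<close>
  define s1 where "s1 = s / 2 / M"
  define s2 where "s2 = s1 / 4 / M"
  define s3 where "s3 = s2 / 4 / M"
  have div: "x / M \<le> x" "x / M > 0" if "x > 0" for x :: real
    using that M0 by (auto simp: divide_le_eq)
  have spos: "s1 > 0" "s2 > 0" "s3 > 0" using S(3) M0 by (auto simp: s1_def s2_def s3_def)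
  have sle: "s1 \<le> s / 2" "s2 \<le> s1 / 4" "s3 \<le> s2 / 4"
    using div[of "s / 2"] div[of "s1 / 4"] div[of "s2 / 4"] spos S(3) by (auto simp: s1_def s2_def s3_def)
  have s3_eq: "s3 = s / (32 * M ^ 3)" by (simp add: s1_def s2_def s3_def power3_eq_cube)
  have shr_eq: "shrink * s = \<theta> * s3"
    by (simp add: s3_eq shrink_def \<theta>_def)
  have th1: "\<theta> \<le> 1 / 128" using al1 by (simp add: \<theta>_def)
  have shs3: "shrink * s \<le> s3" unfolding shr_eq using th1 spos by simp
  have reg: thesis if "finite \<Gamma>'" "\<forall>\<gamma>\<in>\<Gamma>'. unit_char \<gamma>" "\<rho> > 0" "card \<Gamma>' \<le> D"
      "\<And>r. \<rho> \<le> r \<Longrightarrow> r < 2 * \<rho> \<Longrightarrow> approx_inv \<eta> (bohr \<Gamma>' r) (bohr \<Gamma>' (\<rho> / M)) \<Longrightarrow> thesis" for \<Gamma>' \<rho> thesis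
    using bohr_regular[OF that(1,2,3) M_pos that(4) eta0] M_large that(5) unfolding \<eta>_def by blast
  obtain r1 where r1: "s / 2 \<le> r1" "r1 < s" "approx_inv \<eta> (bohr \<Gamma> r1) (bohr \<Gamma> s1)"
    using reg[of \<Gamma> "s / 2"] S D unfolding s1_def by force
  obtain r2 where r2: "s1 / 4 \<le> r2" "r2 < s1 / 2" "approx_inv \<eta> (bohr \<Gamma> r2) (bohr \<Gamma> s2)"
    using reg[of \<Gamma> "s1 / 4"] S D spos unfolding s2_def by force
  obtain r3 where r3: "s2 / 4 \<le> r3" "r3 < s2 / 2" "approx_inv \<eta> (bohr \<Gamma> r3) (bohr \<Gamma> s3)"
    using reg[of \<Gamma> "s2 / 4"] S D spos unfolding s3_def by force
  define B1 where "B1 = bohr \<Gamma> r1"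
  define B2 where "B2 = bohr \<Gamma> r2"
  define W where "W = bohr \<Gamma> r3"
  have fin: "finite B1" "finite B2" "finite W" by (simp_all add: B1_def B2_def W_def finite_bohr)
  have cpos: "real (card B1) > 0" "real (card B2) > 0" "real (card W) > 0"
    unfolding B1_def B2_def W_def of_nat_0_less_iff
    by (intro card_bohr_pos[OF S(2)], use r1 r2 r3 S(3) spos in linarith)+
  then have ne: "B1 \<noteq> {}" "B2 \<noteq> {}" "W \<noteq> {}" by auto
  have subG: "B1 \<subseteq> G" "B2 \<subseteq> G" "W \<subseteq> G" by (simp_all add: B1_def B2_def W_def bohr_subset_G)
  have B0ne: "bohr \<Gamma> r \<noteq> {}" using card_bohr_pos[OF S(2), of r] S(3,5) by auto
  have d1: "dens A B1 t \<le> u" "dens A B2 t \<le> u" if "t \<in> G" for t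
  proof -
    show "dens A B1 t \<le> u" unfolding B1_def
      by (rule less_imp_le[OF no1[OF S(1,2) _ _ _ r1(3) that]]) (use shs3 sle spos r1 S(3) in linarith)+
    show "dens A B2 t \<le> u" unfolding B2_def
      by (rule less_imp_le[OF no1[OF S(1,2) _ _ _ r2(3) that]]) (use shs3 sle spos r2 S(3) in linarith)+
  qed
  have "\<exists>t\<in>bohr \<Gamma> r. 2 * a - 4 * \<eta> - u \<le> dens A B1 t \<and> 2 * a - 4 * \<eta> - u \<le> dens A B2 t"
  proof (rule common_translate[OF S(6) finite_bohr B0ne uminus_bohr[OF S(2)] _ _ fin(1,2) ne(1,2) S(8)])
    show "B1 \<subseteq> bohr \<Gamma> s" unfolding B1_def using r1 by (intro bohr_mono) auto
    show "B2 \<subseteq> bohr \<Gamma> s" unfolding B2_def using r2 sle spos S(3) by (intro bohr_mono) auto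
  qed (use d1 bohr_subset_G in blast)+
  then obtain t where t: "t \<in> G" "2 * a - 4 * \<eta> - u \<le> dens A B1 t" "2 * a - 4 * \<eta> - u \<le> dens A B2 t"
    using bohr_subset_G by blast
  define a1 where "a1 = dens A B1 t"
  define a2 where "a2 = dens A B2 t"
  have lo: "a - \<alpha> * a / 64 \<le> 2 * a - 4 * \<eta> - u"
    using al3 by (simp add: \<eta>_def u_def algebra_simps)
  have a12: "a - \<alpha> * a / 64 \<le> a1" "a - \<alpha> * a / 64 \<le> a2" "a1 \<le> u" "a2 \<le> u"
    using t lo d1[OF t(1)] unfolding a1_def a2_def by linarith+
  define f where "f = (\<lambda>x. indicat_real B1 x * indicat_real A (t + x))"
  have f01: "0 \<le> f x" "f x \<le> 1" for x by (auto simp: f_def indicator_def)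
  have sumf: "(\<Sum>x\<in>B1. f x) = a1 * card B1"
    using cpos by (simp add: f_def a1_def dens_def)
  define S1 where "S1 = (\<Sum>y\<in>B2. \<Sum>x\<in>G. f x * f (y + y - x))"
  have dbl: "w + w \<in> bohr \<Gamma> s1" if "w \<in> bohr \<Gamma> \<rho>" "\<rho> \<le> s1 / 2" for w \<rho>
    using add_bohr[OF S(2) that(1) that(1)] bohr_mono[of \<Gamma> \<Gamma> "\<rho> + \<rho>" s1] that(2) by auto
  have up: "(\<Sum>w\<in>V. f (x + (w + w))) \<le> 7 / 4 * a * card V"
    if "x \<in> G" "V = B2 \<or> V = W" for x V
  proof -
    have "(\<Sum>w\<in>V. f (x + (w + w))) \<le> (\<Sum>w\<in>V. indicat_real A ((t + x) + (w + w)))"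
      by (intro sum_mono) (simp add: f_def indicator_def add.assoc)
    also have "\<dots> \<le> 7 / 4 * a * card V"
      using that(2)
    proof
      assume V: "V = B2"
      show ?thesis unfolding V B2_def
        by (intro no2[OF _ _ r2(3)] add_G t that) (use shs3 sle spos r2 S(3) in linarith)+
    next
      assume V: "V = W"
      show ?thesis unfolding V W_def
        by (intro no2[OF _ _ r3(3)] add_G t that) (use shs3 sle spos r3 S(3) in linarith)+
    qed
    finally show ?thesis .
  qed
  have S1: "card B1 * card B2 * (2 * (7 / 4 * a) * (a1 - 2 * \<eta>) - (7 / 4 * a)\<^sup>2 - 2 * \<eta>) \<le> S1"
    unfolding S1_def
  proof (rule midpoint_count_lower[where W = W and S = "bohr \<Gamma> s1"])
    show "approx_inv \<eta> B2 W"
      unfolding B2_def W_def using r3 spos by (intro approx_inv_mono[OF r2(3)] bohr_mono) auto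
    show "approx_inv \<eta> B1 (bohr \<Gamma> s1)" using r1 by (simp add: B1_def)
    show "\<And>w. w \<in> W \<Longrightarrow> w + w \<in> bohr \<Gamma> s1" "\<And>w. w \<in> B2 \<Longrightarrow> w + w \<in> bohr \<Gamma> s1"
      using dbl r2 r3 sle spos unfolding W_def B2_def by force+
    show "a1 * card B1 \<le> (\<Sum>x\<in>B1. f x)" by (simp add: sumf)
    show "\<And>x. x \<notin> B1 \<Longrightarrow> f x = 0" by (simp add: f_def)
    show "\<And>x. x \<in> B1 \<Longrightarrow> - x \<in> B1" "\<And>x. x \<in> W \<Longrightarrow> - x \<in> W"
      "\<And>x. x \<in> bohr \<Gamma> s1 \<Longrightarrow> - x \<in> bohr \<Gamma> s1"
      unfolding B1_def W_def using uminus_bohr[OF S(2)] by blast+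
  qed (use f01 subG ne up a0 eta0 in auto)
  \<comment> \<open>For \<Lambda> = 7 a / 4 the quantity 2 \<Lambda> a - \<Lambda>^2 is 7 a^2 / 16,
    positive as \<Lambda> < 2 a; the errors from \<open>a1\<close> and \<eta> still leave a^2 /
    4.\<close>
  have S1_lower: "a\<^sup>2 / 4 * (card B1 * card B2) \<le> S1"
  proof -
    have "\<eta> \<le> a\<^sup>2 / 512" using al2 by (simp add: \<eta>_def)
    moreover have "a * (a - a / 64 - a / 256) \<le> a * (a1 - 2 * \<eta>)"
    proof (intro mult_left_mono)
      have "\<eta> \<le> a / 512" using al3 ala1 by (simp add: \<eta>_def)
      then show "a - a / 64 - a / 256 \<le> a1 - 2 * \<eta>" using a12(1) ala1 by linarith
    qed (use a0 in auto)
    moreover have "a * (a - a / 64 - a / 256) = 251 / 256 * a\<^sup>2"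
      "2 * (7 / 4 * a) * (a1 - 2 * \<eta>) - (7 / 4 * a)\<^sup>2 - 2 * \<eta>
        = 7 / 2 * (a * (a1 - 2 * \<eta>)) - 49 / 16 * a\<^sup>2 - 2 * \<eta>"
      by (simp_all add: power2_eq_square field_simps)
    moreover have "0 \<le> a\<^sup>2" by (rule zero_le_power2)
    ultimately have "a\<^sup>2 / 4 \<le> 2 * (7 / 4 * a) * (a1 - 2 * \<eta>) - (7 / 4 * a)\<^sup>2 - 2 * \<eta>"
      by linarith
    then have "(card B1 * card B2) * (a\<^sup>2 / 4) \<le> (card B1 * card B2) *
      (2 * (7 / 4 * a) * (a1 - 2 * \<eta>) - (7 / 4 * a)\<^sup>2 - 2 * \<eta>)"
      by (intro mult_left_mono) auto
    then show ?thesis using S1 by (simp add: mult.commute)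
  qed
  \<comment> \<open>\<open>T\<close> counts progressions around \<open>t\<close> with midpoint in
    \<open>B2\<close> and end points in \<open>B1\<close>. For a fixed midpoint, the difference
    determines the progression and lies in \<open>K\<close>, so \<open>T\<close> is at most
    \<open>card B2 * card K\<close>.\<close>
  define T where "T = (\<Sum>y\<in>B2. indicat_real A (t + y) * (\<Sum>x\<in>G. f x * f (y + y - x)))"
  have T_upper: "T \<le> card B2 * card K"
  proof -
    have finK: "finite K" using S(9) finite_G finite_subset by blast
    have "indicat_real A (t + y) * (\<Sum>x\<in>G. f x * f (y + y - x)) \<le> card K" if y: "y \<in> B2" for y
    proof (cases "t + y \<in> A")
      case True
      have "(\<Sum>x\<in>G. f x * f (y + y - x)) \<le> (\<Sum>x\<in>G. indicat_real ((\<lambda>d. y - d) ` K) x)"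
      proof (rule sum_mono)
        fix x assume x: "x \<in> G"
        show "f x * f (y + y - x) \<le> indicat_real ((\<lambda>d. y - d) ` K) x"
        proof (cases "t + x \<in> A \<and> t + (y + y - x) \<in> A")
          case True
          have yG: "y \<in> G" using y subG by blast
          have "y - x \<in> K"
          proof (rule ap)
            show "t + x \<in> G" "y - x \<in> G" using x t yG by (auto intro: add_G diff_G)
            show "t + x \<in> A" using True by simp
            show "t + x + (y - x) \<in> A" using \<open>t + y \<in> A\<close> by simp
            have e: "t + x + (y - x) + (y - x) = t + (y + y - x)" by (simp add: algebra_simps)
            show "t + x + (y - x) + (y - x) \<in> A" unfolding e using True by blast
          qed
          then have "x \<in> (\<lambda>d. y - d) ` K" by (intro image_eqI[of _ _ "y - x"]) auto
          then have "indicat_real ((\<lambda>d. y - d) ` K) x = 1" by simp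
          moreover have "f x * f (y + y - x) \<le> 1 * 1" by (intro mult_mono f01) auto
          ultimately show ?thesis by simp
        qed (auto simp: f_def)
      qed
      also have "\<dots> = card (G \<inter> (\<lambda>d. y - d) ` K)" by (rule sum_indicator_real[OF finite_G])
      also have "\<dots> \<le> card ((\<lambda>d. y - d) ` K)" using finK by (intro of_nat_mono card_mono) auto
      also have "\<dots> \<le> card K" using finK by (intro of_nat_mono card_image_le)
      finally show ?thesis using True by simp
    qed simp
    then have "T \<le> (\<Sum>y\<in>B2. card K)" unfolding T_def of_nat_sum by (intro sum_mono)
    then show ?thesis by simp
  qed
  define A' where "A' = {x. t + x \<in> A}"
  have densA': "dens A' V y = dens A V (t + y)" for V y unfolding A'_def by (rule dens_translate)
  have a2_eq: "dens A' B2 0 = a2" by (simp add: densA' a2_def)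
  have indA': "indicat_real A' y = indicat_real A (t + y)" for y by (simp add: A'_def indicator_def)
  define Z where "Z = (\<Sum>y\<in>B2. (indicat_real A' y - a2) * (\<Sum>x\<in>G. f x * f (y + y - x)))"
  have TZ: "T = Z + a2 * S1"
    by (simp add: T_def Z_def S1_def indA' left_diff_distrib sum_subtractf sum_distrib_left)
  \<comment> \<open>\<open>Z\<close> is the deviation of \<open>T\<close> from its expected value
    \<open>a2 * S1\<close>, which is nearly a^3 / 4 times \<open>card B1 * card B2\<close>. If all
    coefficients were at most a^2 / 16, the deviation would be only about a quarter of this, so more
    than a^3 / 8 would remain and \<open>K\<close> would be large.\<close>
  have "\<exists>\<xi>\<in>X. a\<^sup>2 / 16 * card B2 < norm (\<Sum>y\<in>B2. of_real (indicat_real A' y - a2) * \<xi> (y + y))"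
  proof (rule ccontr)
    assume "\<not> ?thesis"
    then have "\<bar>Z\<bar> \<le> a\<^sup>2 / 16 * card B2 * (\<Sum>x\<in>G. (f x)\<^sup>2)"
      unfolding Z_def by (intro fourier_midpoint_bound subG) (simp add: not_less)
    also have "(\<Sum>x\<in>G. (f x)\<^sup>2) = (\<Sum>x\<in>B1. f x)"
      by (rule sum.mono_neutral_cong_right) (auto simp: finite_G subG(1)[THEN subsetD] f_def indicator_def)
    also have "\<dots> \<le> u * card B1" using a12 cpos by (simp add: sumf)
    finally have Z: "\<bar>Z\<bar> \<le> a\<^sup>2 / 16 * card B2 * (u * card B1)" using cpos by (simp add: mult_left_mono)
    define N where "N = a\<^sup>2 * (card B1 * card B2)"
    have N0: "N \<ge> 0" by (simp add: N_def)
    have "u \<le> a * (129 / 128)" using a0 alpha by (simp add: u_def)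
    then have "u * N \<le> a * (129 / 128) * N" using N0 by (intro mult_right_mono) auto
    moreover have "\<bar>Z\<bar> \<le> u * N / 16" using Z by (simp add: N_def mult_ac)
    moreover have "a * (63 / 64) * (N / 4) \<le> a2 * S1"
    proof (rule mult_mono)
      show a2lo: "a * (63 / 64) \<le> a2" using a12(2) ala1 by linarith
      then show "0 \<le> a2" using a0 by linarith
      show "N / 4 \<le> S1" using S1_lower by (simp add: N_def)
    qed (use N0 in simp)
    ultimately have "T \<ge> a * N / 8" unfolding TZ using mult_nonneg_nonneg[of a N] a0 N0 by linarith
    then have "a * N / 8 \<le> card B2 * card K" using T_upper by linarith
    then have "card B2 * (a ^ 3 / 8 * card B1) \<le> card B2 * card K"
      by (simp add: N_def power3_eq_cube power2_eq_square mult_ac)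
    then have "a ^ 3 / 8 * card B1 \<le> card K" using cpos by simp
    moreover have "a ^ 3 / 8 * card (bohr \<Gamma> (s / 2)) \<le> a ^ 3 / 8 * card B1"
      unfolding B1_def using r1 a0 by (intro mult_left_mono of_nat_mono card_mono finite_bohr bohr_mono) auto
    ultimately show False using neg by linarith
  qed
  then obtain \<xi> where chi: "\<xi> \<in> X"
    "a\<^sup>2 / 16 * card B2 \<le> norm (\<Sum>y\<in>B2. of_real (indicat_real A' y - a2) * \<xi> (y + y))"
    by (auto intro: less_imp_le)
  \<comment> \<open>The large coefficient pairs the midpoint y with \<xi> at 2 y, so the character
    to be added is the composition of \<xi> with doubling.\<close>
  define \<psi> where "\<psi> = (\<lambda>y. \<xi> (y + y))"
  have psi: "unit_char \<psi>" unfolding \<psi>_def by (rule unit_char_double[OF X_char[OF chi(1)]])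
  define \<Gamma>' where "\<Gamma>' = insert \<psi> \<Gamma>"
  have G': "finite \<Gamma>'" "\<forall>\<gamma>\<in>\<Gamma>'. unit_char \<gamma>" "card \<Gamma>' \<le> card \<Gamma> + 1"
    using S(1,2) psi by (auto simp: \<Gamma>'_def card_insert_if)
  \<comment> \<open>Radius about \<theta> * s2 serves both requirements on \<open>B3\<close>: it is
    at most \<theta>, so \<psi> is within \<theta> of 1, and at most \<open>s2\<close>, so
    \<open>B2\<close> is almost invariant under \<open>B3\<close>.\<close>
  have s2th: "\<theta> * s2 / 4 > 0" using th0 spos by simp
  have "card \<Gamma>' \<le> D" using G'(3) D by linarith
  from reg[OF G'(1,2) s2th this] obtain r4
    where r4: "\<theta> * s2 / 4 \<le> r4" "r4 < 2 * (\<theta> * s2 / 4)" "approx_inv \<eta> (bohr \<Gamma>' r4) (bohr \<Gamma>' (\<theta> * s2 / 4 / M))" by blast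
  have s2_1: "s2 \<le> 1" using sle S(4) spos by linarith
  have r4_th: "r4 \<le> \<theta>" using r4(2) th0 s2_1 mult_left_mono[OF s2_1, of \<theta>] by linarith
  have r4_s2: "r4 \<le> s2" using r4(2) th1 spos mult_right_mono[OF th1, of s2] by linarith
  have r4_0: "r4 \<ge> 0" using r4(1) s2th by linarith
  define B3 where "B3 = bohr \<Gamma>' r4"
  have B3sub: "B3 \<subseteq> bohr \<Gamma> s2" unfolding B3_def \<Gamma>'_def using r4_s2 by (intro bohr_mono) auto
  have "\<exists>y\<in>B2. dens A' B3 y \<ge> dens A' B2 0 + (a\<^sup>2 / 16 - 4 * \<eta> - \<theta>) / 2"
  proof (rule density_increment_of_character[where S = "bohr \<Gamma> s2" and \<psi> = \<psi>])
    show "approx_inv \<eta> B2 (bohr \<Gamma> s2)" using r2 by (simp add: B2_def)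
    show "finite B3" by (simp add: B3_def finite_bohr)
    show "B3 \<noteq> {}" using zero_bohr[OF G'(2) r4_0] by (auto simp: B3_def)
    show "\<And>w. w \<in> B3 \<Longrightarrow> w \<in> bohr \<Gamma> s2" using B3sub by blast
    then show "\<And>w. w \<in> B3 \<Longrightarrow> - w \<in> bohr \<Gamma> s2" using uminus_bohr[OF S(2)] by blast
    show "\<And>w. w \<in> B3 \<Longrightarrow> norm (\<psi> w - 1) \<le> \<theta>"
      using r4_th by (force simp: B3_def bohr_def \<Gamma>'_def)
    show "a\<^sup>2 / 16 * card B2 \<le> norm (\<Sum>y\<in>B2. of_real (indicat_real A' y - dens A' B2 0) * \<psi> y)"
      using chi(2) by (simp add: a2_eq \<psi>_def)
    show "0 < a\<^sup>2 / 16 - 4 * \<eta> - \<theta>"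
    proof -
      have "a\<^sup>2 > 0" using a0 by simp
      then show ?thesis using al2 unfolding \<eta>_def \<theta>_def by linarith
    qed
  qed (use fin ne psi in auto)
  then obtain y where y: "y \<in> B2" "dens A B3 (t + y) \<ge> a2 + (a\<^sup>2 / 16 - 4 * \<eta> - \<theta>) / 2"
    by (auto simp: densA' a2_def)
  have "a2 + (a\<^sup>2 / 16 - 4 * \<eta> - \<theta>) / 2 \<ge> u"
  proof -
    have "a2 \<ge> a - \<alpha> * a / 64" by (rule a12)
    moreover have "u = a + \<alpha> * a / 128" by (simp add: u_def algebra_simps)
    moreover have "v \<le> a2 + (Q / 16 - 4 * (P / 512) - P / 128) / 2"
      if "a - p / 64 \<le> a2" "v = a + p / 128" "P \<le> Q" "p \<le> Q" for p P Q v :: real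
      using that by (simp add: field_simps)
    ultimately show ?thesis using al2 ala unfolding \<eta>_def \<theta>_def by blast
  qed
  moreover have "dens A B3 (t + y) < u"
    unfolding B3_def
  proof (rule no1[OF G' _ _ r4(3)])
    show "shrink * s \<le> \<theta> * s2 / 4 / M" by (simp add: shr_eq s3_def)
    show "\<theta> * s2 / 4 / M \<le> r4" using div(1)[OF s2th] r4(1) by linarith
    show "t + y \<in> G" using t y subG add_G by blast
  qed
  ultimately show False using y(2) by linarith
qed

end

section \<open>Powers of 2 in the torsion and iteration of the increment\<close>

context fourier_group begin

definition two_torsion :: "nat \<Rightarrow> 'a set" where
  "two_torsion k = {x \<in> G. ((\<lambda>x. x + x) ^^ k) x = 0}"

lemma two_torsion_Suc: "{d \<in> G. d + d \<in> two_torsion k} = two_torsion (Suc k)"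
  by (auto simp: two_torsion_def add_G funpow_Suc_right simp del: funpow.simps)

text \<open>Doubling maps the elements killed by 2^(k+1) into those killed by 2^k, and two elements
  with equal doubles differ by an element of \<open>two_torsion 1\<close>.\<close>

lemma card_two_torsion: "card (two_torsion k) \<le> card (two_torsion 1) ^ k"
proof (induction k)
  case 0
  have "two_torsion 0 \<subseteq> {0}" by (auto simp: two_torsion_def)
  then have "card (two_torsion 0) \<le> card {0::'a}" by (intro card_mono) auto
  then show ?case by simp
next
  case (Suc k)
  have fin: "finite (two_torsion k)" for k using finite_G by (simp add: two_torsion_def)
  have "card (two_torsion (Suc k)) \<le> card (two_torsion k) * card (two_torsion 1)"
  proof (rule card_le_fibres[OF fin fin])
    show "(\<lambda>x. x + x) ` two_torsion (Suc k) \<subseteq> two_torsion k"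
      by (auto simp: two_torsion_Suc[symmetric])
    fix x assume x: "x \<in> two_torsion (Suc k)"
    have "card {y \<in> two_torsion (Suc k). y + y = x + x}
        = card ((\<lambda>y. y - x) ` {y \<in> two_torsion (Suc k). y + y = x + x})"
      by (rule card_image[symmetric]) (auto simp: inj_on_def)
    also have "\<dots> \<le> card (two_torsion 1)"
      using x by (intro card_mono fin) (auto simp: two_torsion_def diff_G algebra_simps)
    finally show "card {y \<in> two_torsion (Suc k). y + y = x + x} \<le> card (two_torsion 1)" .
  qed
  also have "\<dots> \<le> card (two_torsion 1) ^ k * card (two_torsion 1)" using Suc by simp
  finally show ?case by (simp add: mult.commute)
qed

end

context increment_setup begin

text \<open>Two potentials run along the induction. Each step of either kind multiplies the density
  by at least 1 + \<alpha> / 128, so \<open>j\<close> steps would push it above 1 and the iteration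
  must end with the first alternative. Each doubling raises \<open>k\<close> by one and pays for it
  with a factor 7/4 of density, which bounds the final \<open>k'\<close>.\<close>

lemma state_iterate:
  assumes "state A (two_torsion k) \<Gamma> r s a" "j + card \<Gamma> \<le> D" "a * (1 + \<alpha> / 128) ^ j > 1"
  shows "\<exists>k' \<Gamma>' s'. finite \<Gamma>' \<and> (\<forall>\<gamma>\<in>\<Gamma>'. unit_char \<gamma>) \<and> card \<Gamma>' \<le> D \<and> s * shrink ^ j \<le> s' \<and>
     a * (7 / 4) ^ k' \<le> (7 / 4) ^ k \<and> \<alpha> ^ 3 / 8 * card (bohr \<Gamma>' (s' / 2)) \<le> card (two_torsion k')"
  using assms
proof (induction j arbitrary: A k \<Gamma> r s a)
  case 0
  then have "a \<le> dens A (bohr \<Gamma> r) 0" "a > 1" by (auto simp: state_def)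
  then show ?case using dens_bounds(2)[of A "bohr \<Gamma> r" 0] by linarith
next
  case (Suc j)
  have D: "card \<Gamma> < D" using Suc.prems by simp
  have st: "finite \<Gamma>" "\<forall>\<gamma>\<in>\<Gamma>. unit_char \<gamma>" "\<alpha> \<le> a" "s > 0" "a \<le> 1"
    using Suc.prems(1) dens_bounds(2)[of A "bohr \<Gamma> r" 0] by (auto simp: state_def)
  have a0: "a > 0" using st alpha by linarith
  have sh1: "shrink \<le> 1" using shrink_le alpha by (smt (verit) power_le_one divide_le_eq_1)
  have e: "shrink * s * shrink ^ j = s * shrink ^ Suc j" by simp
  consider "a ^ 3 / 8 * card (bohr \<Gamma> (s / 2)) \<le> card (two_torsion k)"
    | A' \<Gamma>' r' where "state A' (two_torsion k) \<Gamma>' r' (shrink * s) (a * (1 + \<alpha> / 128))" "card \<Gamma>' \<le> card \<Gamma> + 1"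
    | A' r' where "state A' {d \<in> G. d + d \<in> two_torsion k} \<Gamma> r' (shrink * s) (7 / 4 * a)"
    using state_step[OF Suc.prems(1) D] by blast
  then show ?case
  proof cases
    case 1
    have "\<alpha> ^ 3 / 8 * card (bohr \<Gamma> (s / 2)) \<le> a ^ 3 / 8 * card (bohr \<Gamma> (s / 2))"
      using st alpha by (intro mult_right_mono divide_right_mono power_mono) auto
    then have "\<alpha> ^ 3 / 8 * card (bohr \<Gamma> (s / 2)) \<le> card (two_torsion k)" using 1 by linarith
    moreover have "s * shrink ^ Suc j \<le> s"
      using st(4) power_le_one[of shrink "Suc j"] shrink_pos sh1 mult_left_mono[of "shrink ^ Suc j" 1 s] by simp
    moreover have "a * (7 / 4) ^ k \<le> (7 / 4) ^ k" using st(5) by (simp add: mult_left_le_one_le a0 less_imp_le)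
    ultimately show ?thesis using st(1,2) D by (intro exI[of _ k] exI[of _ \<Gamma>] exI[of _ s]) auto
  next
    case 2
    have "j + card \<Gamma>' \<le> D" using 2(2) Suc.prems(2) by linarith
    moreover have "a * (1 + \<alpha> / 128) * (1 + \<alpha> / 128) ^ j > 1" using Suc.prems(3) by (simp add: mult.assoc)
    ultimately obtain k' \<Gamma>'' s' where *: "finite \<Gamma>''" "\<forall>\<gamma>\<in>\<Gamma>''. unit_char \<gamma>" "card \<Gamma>'' \<le> D"
      "shrink * s * shrink ^ j \<le> s'" "a * (1 + \<alpha> / 128) * (7 / 4) ^ k' \<le> (7 / 4) ^ k"
      "\<alpha> ^ 3 / 8 * card (bohr \<Gamma>'' (s' / 2)) \<le> card (two_torsion k')"
      using Suc.IH[OF 2(1)] by blast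
    have "a * (7 / 4) ^ k' \<le> a * (1 + \<alpha> / 128) * (7 / 4) ^ k'"
      using a0 alpha by (intro mult_right_mono) auto
    then have "a * (7 / 4) ^ k' \<le> (7 / 4) ^ k" using *(5) by linarith
    then show ?thesis using * unfolding e by blast
  next
    case 3
    have "a * (1 + \<alpha> / 128) * (1 + \<alpha> / 128) ^ j \<le> 7 / 4 * a * (1 + \<alpha> / 128) ^ j"
      using a0 alpha by (intro mult_right_mono) auto
    moreover have "a * (1 + \<alpha> / 128) ^ Suc j = a * (1 + \<alpha> / 128) * (1 + \<alpha> / 128) ^ j" by simp
    ultimately have "7 / 4 * a * (1 + \<alpha> / 128) ^ j > 1" using Suc.prems(3) by linarith
    moreover have "j + card \<Gamma> \<le> D" using Suc.prems(2) by linarith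
    ultimately obtain k' \<Gamma>'' s' where *: "finite \<Gamma>''" "\<forall>\<gamma>\<in>\<Gamma>''. unit_char \<gamma>" "card \<Gamma>'' \<le> D"
      "shrink * s * shrink ^ j \<le> s'" "7 / 4 * a * (7 / 4) ^ k' \<le> (7 / 4) ^ Suc k"
      "\<alpha> ^ 3 / 8 * card (bohr \<Gamma>'' (s' / 2)) \<le> card (two_torsion k')"
      using Suc.IH[OF 3[unfolded two_torsion_Suc]] by blast
    have "a * (7 / 4) ^ k' \<le> (7 / 4) ^ k" using *(5) by simp
    then show ?thesis using * unfolding e by blast
  qed
qed

theorem roth_quantitative:
  assumes A: "\<alpha> * card G \<le> card (A \<inter> G)"
    and free: "\<And>x d. x \<in> G \<Longrightarrow> d \<in> G \<Longrightarrow> x \<in> A \<Longrightarrow> x + d \<in> A \<Longrightarrow> x + d + d \<in> A \<Longrightarrow> d + d = 0"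
    and D: "\<alpha> * (1 + \<alpha> / 128) ^ D > 1" and J: "4 / 2 ^ J \<le> shrink ^ D"
  obtains k where "\<alpha> * (7 / 4) ^ k \<le> 7 / 4"
    "\<alpha> ^ 3 / 8 * card G \<le> 81 ^ (J * D) * real (card (two_torsion 1)) ^ k"
proof -
  have cG: "real (card G) > 0" using finite_G zero_G by (auto simp: card_gt_0_iff)
  have G: "bohr {} \<rho> = G" for \<rho> by (auto simp: bohr_def)
  \<comment> \<open>The whole group is the Bohr set of rank 0, invariant under itself. The
    admissible differences are initially those with d + d = 0, hence k = 1 and the 7/4 on the right
    of the bound for \<open>k\<close>.\<close>
  have "state A (two_torsion 1) {} 1 1 \<alpha>"
    unfolding state_def
  proof (intro conjI ballI impI)
    show "approx_inv (\<alpha>\<^sup>2 / 512) (bohr {} 1) (bohr {} 1)"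
      unfolding G approx_inv_def
    proof
      fix t assume "t \<in> G"
      then have "{x \<in> G. x + t \<notin> G} = {}" using add_G by auto
      then show "real (card {x \<in> G. x + t \<notin> G}) \<le> \<alpha>\<^sup>2 / 512 * card G" by (metis card.empty divide_nonneg_nonneg mult_nonneg_nonneg of_nat_0 of_nat_0_le_iff zero_le_numeral zero_le_power2)
    qed
    have "(\<Sum>w\<in>G. indicat_real A w) = card (A \<inter> G)"
      using sum_indicator_real[OF finite_G] by (simp only: Int_commute)
    then show "\<alpha> \<le> dens A (bohr {} 1) 0" using A cG by (simp add: G dens_def field_simps)
  qed (use alpha free in \<open>auto simp: two_torsion_def add_G\<close>)
  then obtain k \<Gamma> s where *: "finite \<Gamma>" "\<forall>\<gamma>\<in>\<Gamma>. unit_char \<gamma>" "card \<Gamma> \<le> D" "shrink ^ D \<le> s"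
     "\<alpha> * (7 / 4) ^ k \<le> 7 / 4" "\<alpha> ^ 3 / 8 * card (bohr \<Gamma> (s / 2)) \<le> card (two_torsion k)"
    using state_iterate[of A 1 "{}" 1 1 \<alpha> D] D by auto
  have "card G \<le> 81 ^ (J * card \<Gamma>) * card (bohr \<Gamma> (2 / 2 ^ J))" by (rule card_bohr_ge[OF *(1,2)])
  also have "\<dots> \<le> 81 ^ (J * D) * card (bohr \<Gamma> (s / 2))"
    using *(3,4) J by (intro mult_mono power_increasing card_mono finite_bohr bohr_mono mult_left_mono) auto
  finally have "real (card G) \<le> 81 ^ (J * D) * real (card (bohr \<Gamma> (s / 2)))"
    using of_nat_mono by fastforce
  then have "\<alpha> ^ 3 / 8 * card G \<le> \<alpha> ^ 3 / 8 * (81 ^ (J * D) * real (card (bohr \<Gamma> (s / 2))))"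
    using alpha by (intro mult_left_mono) auto
  also have "\<dots> = 81 ^ (J * D) * (\<alpha> ^ 3 / 8 * card (bohr \<Gamma> (s / 2)))" by simp
  also have "\<dots> \<le> 81 ^ (J * D) * real (card (two_torsion k))" using *(6) by (intro mult_left_mono) auto
  also have "\<dots> \<le> 81 ^ (J * D) * real (card (two_torsion 1)) ^ k"
    using card_two_torsion[of k] of_nat_mono by (intro mult_left_mono) fastforce+
  finally show ?thesis using *(5) that by blast
qed

end

subsection \<open>Characters of the group of units modulo m\<close>

lemma euler_theorem_int:
  assumes "coprime (x::int) (int m)" "m > 0"
  shows "[x ^ totient m = 1] (mod int m)"
proof -
  define y where "y = nat (x mod int m)"
  have y: "int y = x mod int m" using assms(2) by (simp add: y_def)
  have "coprime (int y) (int m)" using assms by (simp add: y)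
  then have "coprime y m" by simp
  then have "[y ^ totient m = 1] (mod m)" by (rule euler_theorem)
  then have "[int y ^ totient m = 1] (mod int m)" by (metis cong_int_iff of_nat_1 of_nat_power)
  moreover have "[x = int y] (mod int m)" by (simp add: y Cong.cong_def)
  ultimately show ?thesis by (metis cong_pow cong_trans)
qed

lemma unit_root_exists:
  assumes "norm (z::complex) = 1" "r > 0"
  shows "\<exists>\<zeta>. norm \<zeta> = 1 \<and> \<zeta> ^ r = z"
proof -
  have "z \<noteq> 0" using assms(1) by auto
  then have "cis (Arg z) = z" using assms(1) by (simp add: cis_Arg sgn_div_norm)
  then have "cis (Arg z / r) ^ r = z" using assms(2) by (simp add: Complex.DeMoivre)
  then show ?thesis by (intro exI[of _ "cis (Arg z / r)"]) simp
qed

locale unit_residues =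
  fixes m :: nat
  assumes m_pos: "m > 0"
begin

abbreviation eqm :: "int \<Rightarrow> int \<Rightarrow> bool" where "eqm x y \<equiv> [x = y] (mod int m)"

text \<open>Subgroups of the units modulo \<open>m\<close>, given by all their integer
  representatives. Inverses are available as powers, by Euler's theorem.\<close>

definition unit_submonoid :: "int set \<Rightarrow> bool" where
  "unit_submonoid H \<longleftrightarrow> 1 \<in> H \<and> (\<forall>x\<in>H. coprime x (int m)) \<and> (\<forall>x\<in>H. \<forall>y\<in>H. x * y \<in> H) \<and>
     (\<forall>x\<in>H. \<forall>y. eqm x y \<longrightarrow> y \<in> H)"

definition char_on :: "int set \<Rightarrow> (int \<Rightarrow> complex) \<Rightarrow> bool" where
  "char_on H \<xi> \<longleftrightarrow> (\<forall>x\<in>H. norm (\<xi> x) = 1) \<and> (\<forall>x\<in>H. \<forall>y\<in>H. \<xi> (x * y) = \<xi> x * \<xi> y) \<and>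
     (\<forall>x\<in>H. \<forall>y. eqm x y \<longrightarrow> \<xi> y = \<xi> x)"

definition U :: "int set" where "U = {x. coprime x (int m)}"

lemma eqm_coprime: "eqm x y \<Longrightarrow> coprime x (int m) \<longleftrightarrow> coprime y (int m)"
  by (metis cong_imp_coprime cong_sym)

lemma unit_submonoid_U: "unit_submonoid U"
  using eqm_coprime by (auto simp: unit_submonoid_def U_def)

lemma unit_submonoid_cong: "unit_submonoid H \<Longrightarrow> x \<in> H \<Longrightarrow> eqm x y \<Longrightarrow> y \<in> H"
  and unit_submonoid_mult: "unit_submonoid H \<Longrightarrow> x \<in> H \<Longrightarrow> y \<in> H \<Longrightarrow> x * y \<in> H"
  and char_on_cong: "char_on H \<xi> \<Longrightarrow> x \<in> H \<Longrightarrow> eqm x y \<Longrightarrow> \<xi> y = \<xi> x"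
  and char_on_mult: "char_on H \<xi> \<Longrightarrow> x \<in> H \<Longrightarrow> y \<in> H \<Longrightarrow> \<xi> (x * y) = \<xi> x * \<xi> y"
  and char_on_norm: "char_on H \<xi> \<Longrightarrow> x \<in> H \<Longrightarrow> norm (\<xi> x) = 1"
  unfolding unit_submonoid_def char_on_def by blast+

lemma unit_submonoid_power: "unit_submonoid H \<Longrightarrow> x \<in> H \<Longrightarrow> x ^ k \<in> H"
  by (induction k) (auto simp: unit_submonoid_def)

lemma unit_inverse: "coprime x (int m) \<Longrightarrow> eqm (x ^ (totient m - 1) * x) 1"
proof -
  assume x: "coprime x (int m)"
  have "x ^ (totient m - 1) * x = x ^ totient m"
    using m_pos by (metis Suc_diff_1 power_Suc2 totient_gt_0_iff)
  then show ?thesis using euler_theorem_int[OF x m_pos] by simp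
qed

lemma unit_submonoid_cancel:
  assumes H: "unit_submonoid H" and x: "x \<in> H" and xz: "x * z \<in> H"
  shows "z \<in> H"
proof -
  have "x ^ (totient m - 1) * (x * z) \<in> H"
    by (intro unit_submonoid_mult H unit_submonoid_power x xz)
  moreover have "eqm (x ^ (totient m - 1) * x * z) (1 * z)"
    using unit_inverse[of x] H x by (intro cong_mult cong_refl) (auto simp: unit_submonoid_def)
  ultimately show ?thesis using unit_submonoid_cong[OF H] by (simp add: mult.assoc)
qed

lemma char_on_one: assumes H: "unit_submonoid H" and c: "char_on H \<xi>" shows "\<xi> 1 = 1"
proof -
  have "1 \<in> H" using H by (simp add: unit_submonoid_def)
  then have "\<xi> (1 * 1) = \<xi> 1 * \<xi> 1" "norm (\<xi> 1) = 1" using c unfolding char_on_def by blast+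
  then show ?thesis by auto
qed

lemma char_on_power:
  assumes H: "unit_submonoid H" and c: "char_on H \<xi>" and x: "x \<in> H"
  shows "\<xi> (x ^ k) = \<xi> x ^ k"
proof (induction k)
  case (Suc k)
  then show ?case by (simp add: char_on_mult[OF c x unit_submonoid_power[OF H x]])
qed (simp add: char_on_one[OF H c])

text \<open>Modulo \<open>H\<close> the powers of \<open>y\<close> form a cyclic group of order
  \<open>r\<close>, so the only constraint on the new value \<zeta> is that its r-th power be \<xi>
  (y^r). This freedom gives both the extension to all units and, with a nontrivial root of unity,
  the separation of points.\<close>

lemma char_on_extend_step:
  assumes H: "unit_submonoid H" and c: "char_on H \<xi>" and y: "coprime y (int m)"
    and r: "r > 0" "y ^ r \<in> H" "\<And>j. 0 < j \<Longrightarrow> j < r \<Longrightarrow> y ^ j \<notin> H"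
    and z: "norm \<zeta> = 1" "\<zeta> ^ r = \<xi> (y ^ r)"
  shows "\<exists>H' \<xi>'. unit_submonoid H' \<and> char_on H' \<xi>' \<and> H \<subseteq> H' \<and> y \<in> H' \<and> (\<forall>x\<in>H. \<xi>' x = \<xi> x) \<and> \<xi>' y = \<zeta>"
proof -
  have pow: "r dvd k \<and> \<xi> (y ^ k) = \<zeta> ^ k" if k: "y ^ k \<in> H" for k
  proof -
    have e: "y ^ k = (y ^ r) ^ (k div r) * y ^ (k mod r)"
      by (simp add: power_mult[symmetric] power_add[symmetric])
    have "y ^ (k mod r) \<in> H"
      using unit_submonoid_cancel[OF H unit_submonoid_power[OF H r(2)]] k e by metis
    then have d: "k mod r = 0" using r(3)[of "k mod r"] r(1) by auto
    then have "\<xi> (y ^ k) = (\<zeta> ^ r) ^ (k div r)"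
      using char_on_power[OF H c r(2)] z(2) e by simp
    also have "\<dots> = \<zeta> ^ k" using d by (simp add: power_mult[symmetric] mod_0_imp_dvd)
    finally show ?thesis using d by auto
  qed
  \<comment> \<open>Cancelling y^l puts y^(k - l) into \<open>H\<close>, where \<open>pow\<close>
    already determines the value of \<xi>; this is why the extension is well defined.\<close>
  have wd0: "\<xi> h * \<zeta> ^ k = \<xi> h' * \<zeta> ^ l"
    if h: "h \<in> H" "h' \<in> H" and eq: "eqm (h * y ^ k) (h' * y ^ l)" and kl: "l \<le> k" for h h' k l
  proof -
    have "eqm (y ^ l * (h * y ^ (k - l))) (y ^ l * h')"
      using eq kl by (simp add: mult_ac power_add[symmetric])
    then have e: "eqm (h * y ^ (k - l)) h'"
      using y by (subst (asm) cong_mult_lcancel) (auto simp: coprime_commute)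
    have hk: "h * y ^ (k - l) \<in> H" by (rule unit_submonoid_cong[OF H h(2) cong_sym[OF e]])
    have yk: "y ^ (k - l) \<in> H" by (rule unit_submonoid_cancel[OF H h(1) hk])
    have "\<xi> h' = \<xi> (h * y ^ (k - l))" by (rule char_on_cong[OF c hk e])
    also have "\<dots> = \<xi> h * \<zeta> ^ (k - l)" using pow[OF yk] by (simp add: char_on_mult[OF c h(1) yk])
    finally show ?thesis using kl by (simp add: power_add[symmetric] mult.assoc)
  qed
  have wd: "\<xi> h * \<zeta> ^ k = \<xi> h' * \<zeta> ^ l"
    if h: "h \<in> H" "h' \<in> H" and eq: "eqm (h * y ^ k) (h' * y ^ l)" for h h' k l
    using wd0[OF h eq] wd0[OF h(2,1) cong_sym[OF eq]] by (cases "l \<le> k") auto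
  define H' where "H' = {x. \<exists>h\<in>H. \<exists>k. eqm x (h * y ^ k)}"
  define \<xi>' where "\<xi>' = (\<lambda>x. THE v. \<exists>h\<in>H. \<exists>k. eqm x (h * y ^ k) \<and> v = \<xi> h * \<zeta> ^ k)"
  have ev: "\<xi>' x = \<xi> h * \<zeta> ^ k" if "h \<in> H" "eqm x (h * y ^ k)" for x h k
    unfolding \<xi>'_def
  proof (rule the_equality)
    show "\<exists>h'\<in>H. \<exists>k'. eqm x (h' * y ^ k') \<and> \<xi> h * \<zeta> ^ k = \<xi> h' * \<zeta> ^ k'" using that by blast
    fix v assume "\<exists>h'\<in>H. \<exists>k'. eqm x (h' * y ^ k') \<and> v = \<xi> h' * \<zeta> ^ k'"
    then obtain h' k' where "h' \<in> H" "eqm x (h' * y ^ k')" "v = \<xi> h' * \<zeta> ^ k'" by blast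
    then show "v = \<xi> h * \<zeta> ^ k" using wd[of h' h k' k] that by (metis cong_sym cong_trans)
  qed
  have 1: "1 \<in> H" using H by (simp add: unit_submonoid_def)
  have mem: "h * y ^ k \<in> H'" if "h \<in> H" for h k unfolding H'_def using that by (auto intro: cong_refl)
  have HH': "H \<subseteq> H'" using mem[of _ 0] by auto
  have mult: "eqm (x * x') ((h * h') * y ^ (k + k'))" if "eqm x (h * y ^ k)" "eqm x' (h' * y ^ k')" for x x' h h' k k'
    using cong_mult[OF that] by (simp add: power_add mult_ac)
  have "unit_submonoid H'"
    unfolding unit_submonoid_def
  proof (intro conjI ballI allI impI)
    show "1 \<in> H'" using 1 HH' by blast
    fix x assume "x \<in> H'"
    then obtain h k where hk: "h \<in> H" "eqm x (h * y ^ k)" by (auto simp: H'_def)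
    show "coprime x (int m)" using eqm_coprime[OF hk(2)] y H hk(1) by (simp add: unit_submonoid_def)
    show "x' \<in> H'" if "eqm x x'" for x' using that hk unfolding H'_def by (blast intro: cong_trans cong_sym)
    fix x' assume "x' \<in> H'"
    then obtain h' k' where hk': "h' \<in> H" "eqm x' (h' * y ^ k')" by (auto simp: H'_def)
    have "h * h' \<in> H" by (rule unit_submonoid_mult[OF H hk(1) hk'(1)])
    then show "x * x' \<in> H'" using mult[OF hk(2) hk'(2)] unfolding H'_def by blast
  qed
  moreover have "char_on H' \<xi>'"
    unfolding char_on_def
  proof (intro conjI ballI allI impI)
    fix x assume "x \<in> H'"
    then obtain h k where hk: "h \<in> H" "eqm x (h * y ^ k)" by (auto simp: H'_def)
    show "norm (\<xi>' x) = 1" using ev[OF hk] z char_on_norm[OF c hk(1)] by (simp add: norm_mult norm_power)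
    show "\<xi>' x' = \<xi>' x" if "eqm x x'" for x'
      using ev[OF hk] ev[OF hk(1), of x' k] that hk(2) by (metis cong_sym cong_trans)
    fix x' assume "x' \<in> H'"
    then obtain h' k' where hk': "h' \<in> H" "eqm x' (h' * y ^ k')" by (auto simp: H'_def)
    have "h * h' \<in> H" by (rule unit_submonoid_mult[OF H hk(1) hk'(1)])
    then have "\<xi>' (x * x') = \<xi> (h * h') * \<zeta> ^ (k + k')" using ev mult[OF hk(2) hk'(2)] by blast
    then show "\<xi>' (x * x') = \<xi>' x * \<xi>' x'"
      using ev[OF hk] ev[OF hk'] char_on_mult[OF c hk(1) hk'(1)] by (simp add: power_add)
  qed
  moreover have "y \<in> H'" "\<xi>' y = \<zeta>"
    using mem[OF 1, of 1] ev[OF 1, of y 1] char_on_one[OF H c] by auto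
  moreover have "\<forall>x\<in>H. \<xi>' x = \<xi> x" using ev[of _ _ 0] by (auto intro: cong_refl)
  ultimately show ?thesis using HH' by blast
qed

lemma least_power_in:
  assumes H: "unit_submonoid H" and y: "coprime y (int m)"
  obtains r where "r > 0" "y ^ r \<in> H" "\<And>j. 0 < j \<Longrightarrow> j < r \<Longrightarrow> y ^ j \<notin> H"
proof -
  define P where "P = (\<lambda>r. r > 0 \<and> y ^ r \<in> H)"
  have "1 \<in> H" using H by (simp add: unit_submonoid_def)
  then have "y ^ totient m \<in> H"
    using cong_sym[OF euler_theorem_int[OF y m_pos]] unit_submonoid_cong[OF H] by blast
  then have "P (totient m)" using m_pos by (simp add: P_def)
  then have "P (LEAST r. P r)" by (rule LeastI)
  moreover have "\<not> P j" if "j < (LEAST r. P r)" for j using not_less_Least that by blast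
  ultimately show ?thesis using that unfolding P_def by blast
qed

text \<open>One unit outside \<open>H\<close> is adjoined at a time; the number of unit residues
  outside \<open>H\<close> decreases.\<close>

lemma char_on_extend:
  assumes "unit_submonoid H" "char_on H \<xi>"
  shows "\<exists>\<xi>'. char_on U \<xi>' \<and> (\<forall>x\<in>H. \<xi>' x = \<xi> x)"
  using assms
proof (induction "card ({0..<int m} \<inter> U) - card ({0..<int m} \<inter> H)" arbitrary: H \<xi> rule: less_induct)
  case less
  have HU: "H \<subseteq> U" using less.prems(1) by (auto simp: unit_submonoid_def U_def)
  show ?case
  proof (cases "H = U")
    case True then show ?thesis using less.prems by blast
  next
    case False
    then obtain y where y: "coprime y (int m)" "y \<notin> H" using HU by (auto simp: U_def)
    obtain r where r: "r > 0" "y ^ r \<in> H" "\<And>j. 0 < j \<Longrightarrow> j < r \<Longrightarrow> y ^ j \<notin> H"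
      using least_power_in[OF less.prems(1) y(1)] by blast
    have "norm (\<xi> (y ^ r)) = 1" using char_on_norm[OF less.prems(2) r(2)] .
    then obtain \<zeta> where "norm \<zeta> = 1" "\<zeta> ^ r = \<xi> (y ^ r)" using unit_root_exists r(1) by blast
    from char_on_extend_step[OF less.prems y(1) r this] obtain H' \<xi>' where
      H': "unit_submonoid H'" "char_on H' \<xi>'" "H \<subseteq> H'" "y \<in> H'" "\<forall>x\<in>H. \<xi>' x = \<xi> x" by blast
    have ym: "eqm y (y mod int m)" by (simp add: Cong.cong_def)
    have "y mod int m \<in> {0..<int m} \<inter> H'"
      using m_pos unit_submonoid_cong[OF H'(1,4) ym] by simp
    moreover have "y mod int m \<notin> H"
      using y(2) unit_submonoid_cong[OF less.prems(1) _ cong_sym[OF ym]] by blast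
    ultimately have "{0..<int m} \<inter> H \<subset> {0..<int m} \<inter> H'" using H'(3) by blast
    then have "card ({0..<int m} \<inter> H) < card ({0..<int m} \<inter> H')" by (intro psubset_card_mono) auto
    moreover have "card ({0..<int m} \<inter> H') \<le> card ({0..<int m} \<inter> U)"
      using H'(1) by (intro card_mono) (auto simp: unit_submonoid_def U_def)
    ultimately have "card ({0..<int m} \<inter> U) - card ({0..<int m} \<inter> H') < card ({0..<int m} \<inter> U) - card ({0..<int m} \<inter> H)"
      by linarith
    from less.hyps[OF this H'(1,2)] show ?thesis using H'(3,5) by (metis subsetD)
  qed
qed

lemma char_separates:
  assumes x: "coprime x (int m)" "\<not> eqm x 1"
  shows "\<exists>\<xi>. char_on U \<xi> \<and> \<xi> x \<noteq> 1"
proof -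
  define H where "H = {y. eqm y 1}"
  have H: "unit_submonoid H"
    unfolding unit_submonoid_def H_def
  proof (intro conjI ballI allI impI; clarify?)
    fix a assume a: "eqm a 1"
    then show "coprime a (int m)" using eqm_coprime[OF a] by simp
    show "eqm (a * b) 1" if "eqm b 1" for b using cong_mult[OF a that] by simp
    show "eqm b 1" if "eqm a b" for b using that a by (metis cong_sym cong_trans)
  qed simp
  have c: "char_on H (\<lambda>_. 1)" by (simp add: char_on_def)
  obtain r where r: "r > 0" "x ^ r \<in> H" "\<And>j. 0 < j \<Longrightarrow> j < r \<Longrightarrow> x ^ j \<notin> H"
    using least_power_in[OF H x(1)] by blast
  have r2: "r \<ge> 2" using r(1,2) x(2) by (cases "r = 1") (auto simp: H_def)
  \<comment> \<open>As \<open>H\<close> is the trivial subgroup, \<open>r\<close> is the order of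
    \<open>x\<close>, at least 2; so a primitive r-th root of unity is a legitimate value at
    \<open>x\<close> and differs from 1.\<close>
  define \<zeta> where "\<zeta> = cis (2 * pi / r)"
  have "\<zeta> ^ r = 1" using r(1) by (simp add: \<zeta>_def Complex.DeMoivre)
  moreover have "\<zeta> \<noteq> 1"
  proof
    assume "\<zeta> = 1"
    then have "cos (2 * pi / r) = 1" by (auto simp: \<zeta>_def complex_eq_iff)
    moreover have "cos (2 * pi / r) < cos 0"
      using r2 by (intro cos_monotone_0_pi) (auto simp: field_simps)
    ultimately show False by simp
  qed
  moreover have "norm \<zeta> = 1" by (simp add: \<zeta>_def)
  ultimately obtain H' \<xi>' where *: "unit_submonoid H'" "char_on H' \<xi>'" "x \<in> H'" "\<xi>' x \<noteq> 1"
    using char_on_extend_step[OF H c x(1) r, of \<zeta>] by auto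
  then show ?thesis using char_on_extend[OF *(1,2)] by metis
qed

text \<open>The Dirichlet characters modulo \<open>m\<close>. Fixing the value 0 off the units makes
  each character a single function, so that they can be counted and summed.\<close>

definition dchars :: "(int \<Rightarrow> complex) set" where
  "dchars = {\<xi>. char_on U \<xi> \<and> (\<forall>x. x \<notin> U \<longrightarrow> \<xi> x = 0)}"

lemma finite_dchars: "finite dchars"
proof -
  define Z where "Z = insert 0 {z::complex. z ^ totient m = 1}"
  have tp: "totient m > 0" using m_pos by simp
  have finZ: "finite Z" using finite_roots_unity[of "totient m"] tp by (simp add: Z_def)
  have val: "\<xi> x \<in> Z" if "\<xi> \<in> dchars" for \<xi> x
  proof (cases "x \<in> U")
    case True
    have c: "char_on U \<xi>" using that by (simp add: dchars_def)
    have "\<xi> x ^ totient m = \<xi> (x ^ totient m)" by (rule char_on_power[OF unit_submonoid_U c True, symmetric])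
    also have "\<dots> = \<xi> 1"
    proof (rule char_on_cong[OF c])
      show "1 \<in> U" by (simp add: U_def)
      show "eqm 1 (x ^ totient m)"
        using cong_sym[OF euler_theorem_int[of x m]] m_pos True by (simp add: U_def)
    qed
    finally show ?thesis using char_on_one[OF unit_submonoid_U c] by (simp add: Z_def)
  next
    case False then show ?thesis using that by (simp add: dchars_def Z_def)
  qed
  have per: "\<xi> x = \<xi> (x mod int m)" if "\<xi> \<in> dchars" for \<xi> x
  proof (cases "x \<in> U")
    case True
    then show ?thesis using that char_on_cong[of U \<xi> x "x mod int m"] by (simp add: dchars_def Cong.cong_def)
  next
    case False
    then have "x mod int m \<notin> U" using m_pos by (simp add: U_def)
    then show ?thesis using that False by (simp add: dchars_def)
  qed
  define f where "f = (\<lambda>\<xi>::int \<Rightarrow> complex. restrict \<xi> {0..<int m})"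
  have "inj_on f dchars"
  proof (rule inj_onI)
    fix \<xi> \<xi>' assume h: "\<xi> \<in> dchars" "\<xi>' \<in> dchars" "f \<xi> = f \<xi>'"
    show "\<xi> = \<xi>'"
    proof
      fix x
      have "x mod int m \<in> {0..<int m}" using m_pos by simp
      then have "\<xi> (x mod int m) = \<xi>' (x mod int m)" using fun_cong[OF h(3), of "x mod int m"] by (simp add: f_def)
      then show "\<xi> x = \<xi>' x" using per h by metis
    qed
  qed
  moreover have "f ` dchars \<subseteq> PiE {0..<int m} (\<lambda>_. Z)" using val by (auto simp: f_def)
  moreover have "finite (PiE {0..<int m} (\<lambda>_. Z))" using finZ by (intro finite_PiE) auto
  ultimately show ?thesis by (meson finite_imageD finite_subset)
qed

lemma trivial_dchar: "(\<lambda>x. if x \<in> U then 1 else 0) \<in> dchars"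
proof -
  have "x * y \<in> U" if "x \<in> U" "y \<in> U" for x y by (rule unit_submonoid_mult[OF unit_submonoid_U that])
  moreover have "y \<in> U" if "x \<in> U" "eqm x y" for x y by (rule unit_submonoid_cong[OF unit_submonoid_U that])
  ultimately have "char_on U (\<lambda>x. if x \<in> U then 1 else 0)" unfolding char_on_def by simp
  then show ?thesis by (simp add: dchars_def)
qed

text \<open>Multiplication by a character that is not 1 at \<open>x\<close> permutes
  \<open>dchars\<close>, so the sum equals itself times a number other than 1.\<close>

lemma dchars_orthogonality:
  assumes x: "coprime x (int m)" "\<not> eqm x 1"
  shows "(\<Sum>\<xi>\<in>dchars. \<xi> x) = 0"
proof -
  obtain \<xi>0 where c0: "char_on U \<xi>0" "\<xi>0 x \<noteq> 1" using char_separates[OF x] by blast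
  have xU: "x \<in> U" using x by (simp add: U_def)
  have nz: "\<xi>0 y \<noteq> 0" if "y \<in> U" for y using char_on_norm[OF c0(1) that] by auto
  define p where "p = (\<lambda>\<xi> y::int. \<xi>0 y * \<xi> y)"
  have cl: "p \<xi> \<in> dchars" if "\<xi> \<in> dchars" for \<xi>
  proof -
    have c: "char_on U \<xi>" using that by (simp add: dchars_def)
    have "char_on U (p \<xi>)"
      unfolding char_on_def
    proof (intro conjI ballI allI impI)
      fix a assume a: "a \<in> U"
      show "norm (p \<xi> a) = 1" using char_on_norm[OF c0(1) a] char_on_norm[OF c a] by (simp add: p_def norm_mult)
      show "p \<xi> b = p \<xi> a" if "eqm a b" for b
        using char_on_cong[OF c0(1) a that] char_on_cong[OF c a that] by (simp add: p_def)
      show "p \<xi> (a * b) = p \<xi> a * p \<xi> b" if b: "b \<in> U" for b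
        using char_on_mult[OF c0(1) a b] char_on_mult[OF c a b] by (simp add: p_def)
    qed
    then show ?thesis using that by (simp add: dchars_def p_def)
  qed
  have inj: "inj_on p dchars"
  proof (rule inj_onI)
    fix \<xi> \<xi>' assume h: "\<xi> \<in> dchars" "\<xi>' \<in> dchars" "p \<xi> = p \<xi>'"
    show "\<xi> = \<xi>'"
    proof
      fix y
      have "\<xi>0 y * \<xi> y = \<xi>0 y * \<xi>' y" using fun_cong[OF h(3), of y] by (simp add: p_def)
      then show "\<xi> y = \<xi>' y" using h(1,2) nz[of y] by (cases "y \<in> U") (simp_all add: dchars_def)
    qed
  qed
  have im: "p ` dchars = dchars" using cl by (intro endo_inj_surj[OF finite_dchars _ inj]) auto
  have "(\<Sum>\<xi>\<in>dchars. \<xi> x) = (\<Sum>\<xi>\<in>dchars. p \<xi> x)"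
    using sum.reindex[OF inj, of "\<lambda>\<xi>. \<xi> x"] im by (simp add: o_def)
  also have "\<dots> = \<xi>0 x * (\<Sum>\<xi>\<in>dchars. \<xi> x)" by (simp add: p_def sum_distrib_left)
  finally show ?thesis using c0(2) by simp
qed

end

text \<open>The unit circle written additively: functions into it then form an
  \<open>ab_group_add\<close> under pointwise addition.\<close>

typedef circle = "{z::complex. norm z = 1}"
  morphisms circle_val to_circle by (rule exI[of _ 1]) simp

setup_lifting type_definition_circle

instantiation circle :: ab_group_add
begin

lift_definition zero_circle :: circle is 1 by simp
lift_definition plus_circle :: "circle \<Rightarrow> circle \<Rightarrow> circle" is "(*)" by (simp add: norm_mult)
lift_definition uminus_circle :: "circle \<Rightarrow> circle" is inverse by (simp add: norm_inverse)
lift_definition minus_circle :: "circle \<Rightarrow> circle \<Rightarrow> circle" is "(/)" by (simp add: norm_divide)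

instance
proof
  fix a b c :: circle
  show "a + b + c = a + (b + c)" by transfer simp
  show "a + b = b + a" by transfer simp
  show "0 + a = a" by transfer simp
  show "- a + a = 0" by transfer (metis left_inverse norm_zero zero_neq_one)
  show "a - b = a + - b" by transfer (simp add: divide_inverse)
qed

end

lemma circle_val_plus: "circle_val (a + b) = circle_val a * circle_val b" by transfer simp
lemma norm_circle_val: "norm (circle_val a) = 1" by transfer simp

context unit_residues begin

text \<open>The units modulo \<open>m\<close> are written additively, through the values of all their characters, in order
  to work in a type of class \<open>ab_group_add\<close>.\<close>

definition emb :: "int \<Rightarrow> (int \<Rightarrow> complex) \<Rightarrow> circle" where
  "emb x = (\<lambda>\<xi>. if \<xi> \<in> dchars then to_circle (\<xi> x) else 0)"

definition emb_chars :: "(((int \<Rightarrow> complex) \<Rightarrow> circle) \<Rightarrow> complex) set" where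
  "emb_chars = (\<lambda>\<xi> v. circle_val (v \<xi>)) ` dchars"

text \<open>For m = 1 this set is {0}, while the totatives of 1 are {1}; the two agree for all other
  m.\<close>

definition residues :: "int set" where "residues = {x \<in> {0..<int m}. coprime x (int m)}"

lemma finite_residues: "finite residues"
  by (rule finite_subset[of _ "{0..<int m}"]) (auto simp: residues_def)

lemma residues_U: "x \<in> residues \<Longrightarrow> x \<in> U" by (simp add: residues_def U_def)

lemma mod_residues: "x \<in> U \<Longrightarrow> x mod int m \<in> residues"
  using m_pos by (simp add: residues_def U_def)

lemma card_residues: "card residues = totient m"
proof (cases "m = 1")
  case True
  have "residues = {0}" unfolding residues_def using True by auto
  then show ?thesis using True by simp
next
  case False
  have "residues = int ` totatives m"
  proof (intro equalityI subsetI)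
    fix x assume x: "x \<in> residues"
    then have "x \<noteq> 0" using False by (auto simp: residues_def)
    then have "nat x \<in> totatives m" "x = int (nat x)"
      using x by (auto simp: residues_def totatives_def coprime_int_iff[symmetric] simp del: coprime_int_iff)
    then show "x \<in> int ` totatives m" by blast
  next
    fix x assume "x \<in> int ` totatives m"
    then obtain y where y: "y \<in> totatives m" "x = int y" by blast
    then have "y \<noteq> m" using False by (auto simp: totatives_def)
    then show "x \<in> residues" using y by (auto simp: residues_def totatives_def)
  qed
  then show ?thesis by (simp add: card_image totient_def)
qed

lemma circle_val_emb: "\<xi> \<in> dchars \<Longrightarrow> x \<in> U \<Longrightarrow> circle_val (emb x \<xi>) = \<xi> x"
  using char_on_norm[of U \<xi> x] by (simp add: emb_def dchars_def to_circle_inverse)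

lemma circle_eqI: "circle_val a = circle_val b \<Longrightarrow> a = b"
  by (simp add: circle_val_inject)

lemma U_mult: "x \<in> U \<Longrightarrow> y \<in> U \<Longrightarrow> x * y \<in> U"
  using unit_submonoid_U by (simp add: unit_submonoid_def)

lemma emb_mult: assumes "x \<in> U" "y \<in> U" shows "emb (x * y) = emb x + emb y"
proof
  fix \<xi>
  show "emb (x * y) \<xi> = (emb x + emb y) \<xi>"
  proof (cases "\<xi> \<in> dchars")
    case True
    then have "\<xi> (x * y) = \<xi> x * \<xi> y" using assms char_on_mult[of U] by (simp add: dchars_def)
    then show ?thesis using True assms U_mult
      by (intro circle_eqI) (simp add: circle_val_plus circle_val_emb)
  qed (simp add: emb_def)
qed

text \<open>If all characters agree at \<open>x\<close> and \<open>y\<close>, they are all 1 at the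
  quotient z, and their sum there is the positive number of characters; orthogonality forces z to be
  1 modulo \<open>m\<close>.\<close>

lemma emb_eq_iff: assumes "x \<in> U" "y \<in> U" shows "emb x = emb y \<longleftrightarrow> eqm x y"
proof
  assume "eqm x y"
  then have eq: "\<xi> y = \<xi> x" if "\<xi> \<in> dchars" for \<xi> using that char_on_cong[of U \<xi> x y] assms(1) by (simp add: dchars_def)
  show "emb x = emb y"
  proof
    fix \<xi>
    show "emb x \<xi> = emb y \<xi>"
    proof (cases "\<xi> \<in> dchars")
      case True
      then show ?thesis using eq[OF True] by (simp only: emb_def)
    qed (simp add: emb_def)
  qed
next
  assume e: "emb x = emb y"
  have eqc: "\<xi> x = \<xi> y" if "\<xi> \<in> dchars" for \<xi> using circle_val_emb[OF that] assms e by metis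
  define z where "z = x ^ (totient m - 1) * y"
  have zU: "z \<in> U" using unit_submonoid_power[OF unit_submonoid_U assms(1)] assms(2) U_mult by (simp add: z_def)
  have xz: "eqm (x * z) y"
    using cong_mult[OF unit_inverse[of x] cong_refl[of y]] assms(1) by (simp add: z_def U_def mult_ac)
  have "eqm z 1"
  proof (rule ccontr)
    assume "\<not> eqm z 1"
    then have s: "(\<Sum>\<xi>\<in>dchars. \<xi> z) = 0" using dchars_orthogonality zU by (simp add: U_def)
    have "\<xi> z = 1" if d: "\<xi> \<in> dchars" for \<xi>
    proof -
      have c: "char_on U \<xi>" using d by (simp add: dchars_def)
      have "\<xi> y = \<xi> (x * z)" by (rule char_on_cong[OF c U_mult[OF assms(1) zU] xz])
      then have "\<xi> x * \<xi> z = \<xi> x * 1" using char_on_mult[OF c assms(1) zU] eqc[OF d] by simp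
      moreover have "\<xi> x \<noteq> 0" using char_on_norm[OF c assms(1)] by auto
      ultimately show ?thesis by simp
    qed
    then have "(\<Sum>\<xi>\<in>dchars. \<xi> z) = (\<Sum>\<xi>\<in>dchars. 1)" by (rule sum.cong[OF refl])
    then have "(\<Sum>\<xi>\<in>dchars. \<xi> z) = of_nat (card dchars)" by simp
    moreover have "card dchars > 0" using finite_dchars trivial_dchar by (auto simp: card_gt_0_iff)
    ultimately show False using s by simp
  qed
  then have "eqm (x * z) (x * 1)" by (intro cong_mult cong_refl)
  then show "eqm x y" using xz by (metis cong_sym cong_trans mult_1_right)
qed

lemma residues_eqI: "x \<in> residues \<Longrightarrow> y \<in> residues \<Longrightarrow> eqm x y \<Longrightarrow> x = y"
  by (auto simp: residues_def Cong.cong_def)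

lemma inj_emb: "inj_on emb residues"
  by (rule inj_onI) (use emb_eq_iff residues_U residues_eqI in blast)

lemma emb_U_residue: "x \<in> U \<Longrightarrow> emb x \<in> emb ` residues"
  by (rule image_eqI[of _ _ "x mod int m"]) (auto simp: emb_eq_iff mod_residues residues_U Cong.cong_def)

lemma emb_zero_iff: assumes "x \<in> U" shows "emb x = 0 \<longleftrightarrow> eqm x 1"
proof -
  have 1: "1 \<in> U" by (simp add: U_def)
  have "emb 1 = emb 1 + emb 1" using emb_mult[OF 1 1] by simp
  then have "emb 1 = 0" by simp
  then show ?thesis using emb_eq_iff[OF assms 1] by simp
qed

text \<open>The characters are evaluations at a coordinate, which are homomorphisms on the whole
  function type; orthogonality is inherited from \<open>dchars\<close>.\<close>

sublocale fourier_group "emb ` residues" emb_chars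
proof
  show "finite (emb ` residues)" by (simp add: finite_residues)
  have "1 \<in> U" by (simp add: U_def)
  then show "0 \<in> emb ` residues" using emb_U_residue[of 1] emb_zero_iff[of 1] by simp
  show "v - w \<in> emb ` residues" if vw: "v \<in> emb ` residues" "w \<in> emb ` residues" for v w
  proof -
    obtain x y where xy: "x \<in> U" "y \<in> U" "v = emb x" "w = emb y" using vw residues_U by auto
    define y' where "y' = y ^ (totient m - 1)"
    have y': "y' \<in> U" using unit_submonoid_power[OF unit_submonoid_U xy(2)] by (simp add: y'_def)
    have "emb (y' * y) = 0"
      using unit_inverse[of y] xy(2) emb_zero_iff[OF U_mult[OF y' xy(2)]] by (simp add: U_def y'_def)
    then have "v - w = emb (x * y')"
      using emb_mult[OF y' xy(2)] emb_mult[OF xy(1) y'] xy(3,4) by (simp add: algebra_simps)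
    then show ?thesis using emb_U_residue[OF U_mult[OF xy(1) y']] by simp
  qed
  show "finite emb_chars" by (simp add: emb_chars_def finite_dchars)
  show "emb_chars \<noteq> {}" using trivial_dchar by (auto simp: emb_chars_def)
  show "unit_char \<xi>" if "\<xi> \<in> emb_chars" for \<xi>
    using that by (auto simp: emb_chars_def unit_char_def circle_val_plus norm_circle_val)
  show "(\<Sum>\<xi>\<in>emb_chars. \<xi> v) = 0" if v: "v \<in> emb ` residues" "v \<noteq> 0" for v
  proof -
    obtain x where x: "x \<in> U" "v = emb x" using v residues_U by auto
    have "inj_on (\<lambda>\<xi> v. circle_val (v \<xi>)) dchars"
    proof (rule inj_onI)
      fix \<xi> \<xi>' assume h: "\<xi> \<in> dchars" "\<xi>' \<in> dchars" "(\<lambda>v. circle_val (v \<xi>)) = (\<lambda>v. circle_val (v \<xi>'))"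
      show "\<xi> = \<xi>'"
      proof
        fix y show "\<xi> y = \<xi>' y"
          using h(1,2) fun_cong[OF h(3), of "emb y"] circle_val_emb
          by (cases "y \<in> U") (auto simp: dchars_def)
      qed
    qed
    then have "(\<Sum>\<xi>\<in>emb_chars. \<xi> v) = (\<Sum>\<xi>\<in>dchars. circle_val (v \<xi>))"
      unfolding emb_chars_def by (subst sum.reindex) (simp_all add: o_def)
    also have "\<dots> = (\<Sum>\<xi>\<in>dchars. \<xi> x)" using x circle_val_emb by (intro sum.cong) auto
    also have "\<dots> = 0" using dchars_orthogonality[of x] x v(2) emb_zero_iff by (simp add: U_def)
    finally show ?thesis .
  qed
qed

theorem progression_free_units:
  assumes alpha: "0 < \<alpha>" "\<alpha> \<le> 1" and M: "M > 0" "81 ^ D \<le> (1 + \<alpha>\<^sup>2 / 512) ^ M"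
    and D: "\<alpha> * (1 + \<alpha> / 128) ^ D > 1" and J: "4 / 2 ^ J \<le> (\<alpha>\<^sup>2 / (4096 * real M ^ 3)) ^ D"
    and A: "A \<subseteq> residues" "\<alpha> * totient m \<le> card A"
    and free: "\<And>a b c. a \<in> A \<Longrightarrow> b \<in> A \<Longrightarrow> c \<in> A \<Longrightarrow> eqm (a * c) (b * b) \<Longrightarrow> \<not> distinct [a, b, c]"
  obtains k where "\<alpha> * (7 / 4) ^ k \<le> 7 / 4"
    "\<alpha> ^ 3 / 8 * totient m \<le> 81 ^ (J * D) * real (card {x \<in> residues. eqm (x * x) 1}) ^ k"
proof -
  interpret increment_setup "emb ` residues" emb_chars \<alpha> M D
    by unfold_locales (use alpha M in auto)
  have AU: "x \<in> U" if "x \<in> A" for x using A(1) residues_U that by blast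
  have cG: "card (emb ` residues) = totient m" using card_image[OF inj_emb] by (simp add: card_residues)
  have "emb ` A \<inter> emb ` residues = emb ` A" using A(1) by blast
  then have "card (emb ` A \<inter> emb ` residues) = card A"
    using card_image[OF inj_on_subset[OF inj_emb A(1)]] by simp
  then have 1: "\<alpha> * card (emb ` residues) \<le> card (emb ` A \<inter> emb ` residues)"
    using A(2) cG by simp
  have 2: "d + d = 0" if xd: "x \<in> emb ` A" "x + d \<in> emb ` A" "x + d + d \<in> emb ` A" for x d
  proof -
    obtain a where a: "a \<in> A" "x = emb a" using xd(1) by blast
    obtain b where b: "b \<in> A" "x + d = emb b" using xd(2) by blast
    obtain c where c: "c \<in> A" "x + d + d = emb c" using xd(3) by blast
    note abc = a(1) b(1) c(1) a(2) b(2) c(2)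
    have "emb a + emb c = (x + d) + (x + d)" unfolding abc(4,6)[symmetric] by (simp only: add_ac)
    also have "\<dots> = emb b + emb b" by (simp only: abc(5))
    finally have "emb (a * c) = emb (b * b)" using emb_mult AU abc by simp
    then have "eqm (a * c) (b * b)" using emb_eq_iff U_mult AU abc by simp
    \<comment> \<open>The first two coincidences give d = 0, but a = c gives only 2 d = 0: this is
      the source of the 2-torsion.\<close>
    then have "a = b \<or> b = c \<or> a = c" using free abc by auto
    then show ?thesis
    proof (elim disjE)
      assume "a = b" then have "x + d = x" using abc by simp
      then show ?thesis by simp
    next
      assume "b = c" then have "x + d + d = x + d" using abc by simp
      then show ?thesis by simp
    next
      assume "a = c" then have "x + d + d = x" using abc(4,6) by metis
      then have "x + (d + d) = x" by (simp only: add.assoc)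
      then show ?thesis by simp
    qed
  qed
  have "emb x + emb x = 0 \<longleftrightarrow> eqm (x * x) 1" if "x \<in> residues" for x
    using emb_mult[of x x] emb_zero_iff[OF U_mult[of x x]] residues_U[OF that] by simp
  then have "two_torsion 1 = emb ` {x \<in> residues. eqm (x * x) 1}"
    by (auto simp: two_torsion_def)
  then have t: "card (two_torsion 1) = card {x \<in> residues. eqm (x * x) 1}"
    using card_image[OF inj_on_subset[OF inj_emb]] by simp
  have J': "4 / 2 ^ J \<le> shrink ^ D" using J by (simp add: shrink_def)
  obtain k where "\<alpha> * (7 / 4) ^ k \<le> 7 / 4"
    "\<alpha> ^ 3 / 8 * card (emb ` residues) \<le> 81 ^ (J * D) * real (card (two_torsion 1)) ^ k"
    using roth_quantitative[OF 1 _ D J'] 2 by metis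
  then show ?thesis using that unfolding t cG by blast
qed

end

subsection \<open>Prime factors and square roots of one\<close>

lemma fact_card_le_prod:
  fixes S :: "nat set"
  assumes "finite S" "\<And>x. x \<in> S \<Longrightarrow> x > 0"
  shows "fact (card S) \<le> \<Prod>S"
  using assms
proof (induction rule: finite_linorder_max_induct)
  case (insert b S)
  have "insert b S \<subseteq> {1..b}" using insert by (auto simp: Suc_le_eq intro: less_imp_le)
  then have "card (insert b S) \<le> b" using card_mono[of "{1..b}" "insert b S"] by simp
  moreover have "fact (card S) \<le> \<Prod>S" using insert by simp
  moreover have "b \<notin> S" using insert by auto
  ultimately have "Suc (card S) * fact (card S) \<le> b * \<Prod>S" using insert(1) by (intro mult_le_mono) auto
  then show ?case using insert(1) \<open>b \<notin> S\<close> by simp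
qed simp

text \<open>A product of k distinct positive integers is at least k!. With n! \<ge> (n/e)^n this
  already has the strength \<omega>(m) \<le> (1 + o(1)) ln m / ln (ln m), without information on the
  distribution of primes.\<close>

lemma fact_card_prime_factors_le:
  assumes "(m::nat) > 0" shows "fact (card (prime_factors m)) \<le> m"
proof -
  have "fact (card (prime_factors m)) \<le> \<Prod>(prime_factors m)"
    by (rule fact_card_le_prod) (auto intro: prime_gt_0_nat)
  also have "\<dots> \<le> (\<Prod>p\<in>prime_factors m. p ^ multiplicity p m)"
  proof (rule prod_mono)
    fix p assume p: "p \<in> prime_factors m"
    then have "multiplicity p m \<ge> 1" using assms by (simp add: prime_factors_multiplicity Suc_le_eq)
    then show "0 \<le> p \<and> p \<le> p ^ multiplicity p m"
      using self_le_power[of p "multiplicity p m"] p prime_gt_0_nat by (auto simp: Suc_le_eq)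
  qed
  also have "\<dots> = m" using assms prime_factorization_nat[of m] by simp
  finally show ?thesis .
qed

lemma totient_lower: "real m \<le> 2 ^ card (prime_factors m) * real (totient m)"
proof -
  have "(1 / 2 :: real) ^ card (prime_factors m) = (\<Prod>p\<in>prime_factors m. 1 / 2)" by simp
  also have "\<dots> \<le> (\<Prod>p\<in>prime_factors m. 1 - 1 / real p)"
  proof (rule prod_mono)
    fix p assume "p \<in> prime_factors m"
    then have "real p \<ge> 2" using prime_ge_2_nat[of p] by auto
    then show "(0::real) \<le> 1 / 2 \<and> 1 / 2 \<le> 1 - 1 / real p" by (simp add: field_simps)
  qed
  finally have "real m * (1 / 2) ^ card (prime_factors m) \<le> real m * (\<Prod>p\<in>prime_factors m. 1 - 1 / real p)"
    by (intro mult_left_mono) auto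
  also have "\<dots> = real (totient m)" by (rule totient_formula2[symmetric])
  finally show ?thesis by (simp add: power_divide field_simps)
qed

lemma coprime_if_no_common_prime:
  fixes x m :: int
  assumes "m \<noteq> 0" "\<And>p. prime p \<Longrightarrow> p dvd x \<Longrightarrow> p dvd m \<Longrightarrow> False"
  shows "coprime x m"
proof (rule ccontr)
  assume "\<not> coprime x m"
  then have "\<not> is_unit (gcd x m)" by (simp add: coprime_iff_gcd_eq_1)
  moreover have "gcd x m \<noteq> 0" using assms(1) by simp
  ultimately obtain p where "p dvd gcd x m" "prime p" using prime_divisor_exists by blast
  then show False using assms(2)[of p] by simp
qed

text \<open>A prime p dividing m divides x - 1 or x + 1, and the same one for y, so x + y is 2 or -2
  modulo p. Hence only p = 2 can divide both m and x + y. For even m the condition modulo 4 makes (x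
  + y) / 2 odd, so one factor 2 is all that is lost when m dvd (x - y) * (x + y) is
  cancelled.\<close>

lemma square_roots_of_one_differ:
  fixes x y m :: int
  assumes m: "m > 0" and x: "coprime x m" "m dvd x * x - 1" and y: "coprime y m" "m dvd y * y - 1"
    and four: "x mod 4 = y mod 4"
    and pat: "\<And>p. prime p \<Longrightarrow> p dvd m \<Longrightarrow> p dvd x - 1 \<longleftrightarrow> p dvd y - 1"
  shows "m dvd 2 * (x - y)"
proof -
  have two: "p dvd 2" if p: "prime p" "p dvd m" "p dvd x + y" for p
  proof (cases "p dvd x - 1")
    case True
    then have "p dvd (x + y) - (x - 1) - (y - 1)" using p pat by (meson dvd_diff)
    then show ?thesis by simp
  next
    case False
    have "p dvd (x - 1) * (x + 1)" "p dvd (y - 1) * (y + 1)"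
      using dvd_trans[OF p(2) x(2)] dvd_trans[OF p(2) y(2)] by (simp_all add: algebra_simps)
    then have "p dvd x + 1" "p dvd y + 1" using False pat p by (auto simp: prime_dvd_mult_iff)
    then have "p dvd (x + 1) + (y + 1) - (x + y)" using p(3) by (meson dvd_diff dvd_add)
    then show ?thesis by simp
  qed
  have "m dvd (x * x - 1) - (y * y - 1)" using x y by (meson dvd_diff)
  then have md: "m dvd (x - y) * (x + y)" by (simp add: algebra_simps)
  show ?thesis
  proof (cases "even m")
    case True
    then have odd: "odd x" "odd y" using x(1) y(1) by (meson coprime_common_divisor odd_one)+
    define s where "s = (x + y) div 2"
    have s: "x + y = 2 * s" "odd s" using odd four unfolding s_def by presburger+
    have "coprime s m"
    proof (rule coprime_if_no_common_prime)
      show "m \<noteq> 0" using m by simp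
      fix p :: int assume p: "prime p" "p dvd s" "p dvd m"
      then have "p dvd 2" using two[of p] s(1) by simp
      then have "p = 2" using p(1) primes_dvd_imp_eq[of p 2] by simp
      then show False using p(2) s(2) by simp
    qed
    moreover have "m dvd s * (2 * (x - y))" using md s(1) by (simp add: mult_ac)
    ultimately show ?thesis by (simp add: coprime_dvd_mult_right_iff coprime_commute)
  next
    case False
    have "coprime (x + y) m"
    proof (rule coprime_if_no_common_prime)
      show "m \<noteq> 0" using m by simp
      fix p :: int assume p: "prime p" "p dvd x + y" "p dvd m"
      then have "p = 2" using two[of p] primes_dvd_imp_eq[of p 2] by simp
      then show False using p(3) False by simp
    qed
    then have "m dvd x - y" using md by (simp add: coprime_dvd_mult_left_iff coprime_commute)
    then show ?thesis by (rule dvd_mult)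
  qed
qed

lemma card_square_roots_of_one:
  assumes m: "m > 0"
  shows "card {x \<in> {0..<int m}. coprime x (int m) \<and> [x * x = 1] (mod int m)} \<le> 2 ^ (card (prime_factors m) + 4)"
proof -
  define S where "S = {x \<in> {0..<int m}. coprime x (int m) \<and> [x * x = 1] (mod int m)}"
  \<comment> \<open>The residue modulo 4 excludes, for even \<open>m\<close>, that \<open>x + y\<close> absorbs a large power of 2.\<close>
  define c where "c = (\<lambda>x::int. ({p \<in> prime_factors m. int p dvd x - 1}, x mod 4))"
  have "card S \<le> card (Pow (prime_factors m) \<times> {0..<4::int}) * 3"
  proof (rule card_le_fibres)
    show "finite S" by (rule finite_subset[of _ "{0..<int m}"]) (auto simp: S_def)
    show "c ` S \<subseteq> Pow (prime_factors m) \<times> {0..<4}" by (auto simp: c_def)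
    fix x assume x: "x \<in> S"
    \<comment> \<open>Both points lie in [0, m), so 2 (y - x) is a multiple of m of absolute value
      below 2 m, leaving three possibilities. With four residues modulo 4 this gives the factor 12
      \<le> 2^4.\<close>
    have "{y \<in> S. c y = c x} \<subseteq> (\<lambda>t. x + t * int m div 2) ` {-1, 0, 1}"
    proof
      fix y assume "y \<in> {y \<in> S. c y = c x}"
      then have y: "y \<in> S" and e: "c y = c x" by auto
      have pat: "p dvd y - 1 \<longleftrightarrow> p dvd x - 1" if p: "prime p" "p dvd int m" for p :: int
      proof -
        have "int (nat p) = p" using prime_gt_0_int[OF p(1)] by simp
        then have "prime (nat p)" "nat p dvd m" using p by (metis prime_nat_int_transfer) (metis \<open>int (nat p) = p\<close> p(2) int_dvd_int_iff)
        then have "nat p \<in> prime_factors m" using m by (simp add: prime_factors_dvd)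
        moreover have "{p \<in> prime_factors m. int p dvd y - 1} = {p \<in> prime_factors m. int p dvd x - 1}"
          using e by (simp add: c_def)
        ultimately show ?thesis using \<open>int (nat p) = p\<close> by (metis (mono_tags, lifting) mem_Collect_eq)
      qed
      have "int m dvd 2 * (y - x)"
        using x y e m pat
        by (intro square_roots_of_one_differ) (auto simp: S_def c_def cong_iff_dvd_diff)
      then obtain t where t: "2 * (y - x) = int m * t" by blast
      have "\<bar>2 * (y - x)\<bar> < 2 * int m" using x y by (auto simp: S_def)
      then have "int m * \<bar>t\<bar> < int m * 2" using t by (simp add: abs_mult)
      then have "\<bar>t\<bar> < 2" using m by simp
      then have "t \<in> {-1, 0, 1}" by auto
      moreover have "y = x + t * int m div 2"
      proof -
        have "t * int m = 2 * (y - x)" using t by (simp add: mult.commute)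
        then show ?thesis by simp
      qed
      ultimately show "y \<in> (\<lambda>t. x + t * int m div 2) ` {-1, 0, 1}" by blast
    qed
    then have "card {y \<in> S. c y = c x} \<le> card ((\<lambda>t. x + t * int m div 2) ` {-1, 0, 1})"
      by (intro card_mono) auto
    also have "\<dots> \<le> card {-1, 0, 1::int}" by (rule card_image_le) simp
    finally show "card {y \<in> S. c y = c x} \<le> 3" by simp
  qed simp
  also have "\<dots> = 12 * 2 ^ card (prime_factors m)" by (simp add: card_cartesian_product card_Pow)
  also have "\<dots> \<le> 2 ^ (card (prime_factors m) + 4)" by (simp add: power_add)
  finally show ?thesis by (simp add: S_def)
qed

lemma power_le_exp_fact: "real n ^ n \<le> exp (real n) * fact n"
proof -
  have s: "(\<lambda>k. real n ^ k /\<^sub>R fact k) sums exp (real n)" by (rule exp_converges)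
  have "sum (\<lambda>k. real n ^ k /\<^sub>R fact k) {n} \<le> suminf (\<lambda>k. real n ^ k /\<^sub>R fact k)"
    using s by (intro sum_le_suminf) (auto simp: sums_iff)
  then show ?thesis using s by (simp add: sums_iff field_simps)
qed

subsection \<open>The bound for the group of units\<close>

text \<open>Here l stands for ln m, and 1.2 * l / ln l bounds the number of prime factors; the
  factor must exceed 1 for that bound to hold. In the last inequality the leading term is 0.7 * 1.2
  * l = 0.84 * l, from the 2-torsion, and all other terms are o(l).\<close>

lemma eventually_parameters:
  "eventually (\<lambda>l::real. l \<ge> 32768 \<and> ln l \<ge> 7 \<and> ln l ^ 5 / sqrt l \<le> 1 \<and> 1 \<le> sqrt l / ln l ^ 4 \<and>
     5120 * (129 * (sqrt l / ln l ^ 4)) * (l / ln l ^ 10) \<le> l\<^sup>2 \<and>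
     1 \<le> 1.2 * l / ln l \<and> 1 \<le> ln (1.2 * l / ln l) \<and> l < 1.2 * l / ln l * (ln (1.2 * l / ln l) - 1) \<and>
     3 + 1.5 * ln l + 0.7 * (1.2 * l / ln l) + 70 * (129 * (sqrt l / ln l ^ 4))\<^sup>2 * ln l
       + 0.7 * ((1.2 * l / ln l + 4) * (1 + ln l)) < l) at_top"
  by (intro eventually_conj; real_asymp)

lemma ln_one_plus_ge_half: "0 \<le> x \<Longrightarrow> x \<le> 1 / 2 \<Longrightarrow> x / 2 \<le> ln (1 + x)" for x :: real
proof -
  assume x: "0 \<le> x" "x \<le> 1 / 2"
  have "x - x\<^sup>2 \<le> ln (1 + x)" using x by (intro ln_one_plus_pos_lower_bound) auto
  moreover have "x\<^sup>2 \<le> x * (1 / 2)" unfolding power2_eq_square using x by (intro mult_left_mono) auto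
  ultimately show ?thesis by linarith
qed

lemma ln_81_le: "ln (81::real) \<le> 5"
proof -
  have "(5 / 2) ^ 5 \<le> exp (1::real) ^ 5"
    using exp_lower_Taylor_quadratic[of 1] by (intro power_mono) auto
  then have "81 \<le> exp (5::real)" by (simp add: exp_of_nat_mult[symmetric] power_divide)
  then have "ln 81 \<le> ln (exp (5::real))" by (subst ln_le_cancel_iff) auto
  then show ?thesis by simp
qed

lemma ln_seven_quarters_ge: "1 / 2 \<le> ln (7 / 4 :: real)"
proof -
  have "7 / 8 \<le> exp (- (1 / 8) :: real)" using exp_ge_add_one_self[of "- (1 / 8)"] by simp
  then have "exp (1 / 8 :: real) \<le> 8 / 7" by (simp add: exp_minus field_simps)
  then have "exp (1 / 8 :: real) ^ 4 \<le> (8 / 7) ^ 4" by (intro power_mono) auto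
  then have "exp (1 / 2 :: real) \<le> 7 / 4" by (simp add: exp_of_nat_mult[symmetric] power_divide)
  then have "ln (exp (1 / 2 :: real)) \<le> ln (7 / 4)" by (subst ln_le_cancel_iff) auto
  then show ?thesis by simp
qed

lemma card_prime_factors_le:
  fixes m :: nat and w :: real
  assumes m: "m > 0" and w: "1 \<le> w" "1 \<le> ln w" "ln m < w * (ln w - 1)"
  shows "card (prime_factors m) \<le> w"
proof (rule ccontr)
  define n where "n = card (prime_factors m)"
  assume "\<not> ?thesis"
  then have nw: "real n > w" by (simp add: n_def)
  have n0: "real n > 0" using nw w by linarith
  have "real n ^ n \<le> exp (real n) * fact n" by (rule power_le_exp_fact)
  also have "\<dots> \<le> exp (real n) * real m"
    using fact_card_prime_factors_le[OF m] unfolding n_def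
    by (intro mult_left_mono) (metis of_nat_fact of_nat_le_iff, simp)
  finally have "ln (real n ^ n) \<le> ln (exp (real n) * real m)"
    using n0 m by (subst ln_le_cancel_iff) auto
  then have "real n * ln n \<le> real n + ln m" using n0 m by (simp add: ln_realpow ln_mult)
  then have "real n * (ln n - 1) \<le> ln m" by (simp add: algebra_simps)
  moreover have "w * (ln w - 1) \<le> real n * (ln n - 1)"
    using w nw n0 by (intro mult_mono) auto
  ultimately show False using w by linarith
qed

lemma large_progression_free_units:
  "\<exists>l0. \<forall>m A. l0 \<le> ln (real m) \<longrightarrow> A \<subseteq> unit_residues.residues m \<longrightarrow>
     (\<forall>a\<in>A. \<forall>b\<in>A. \<forall>c\<in>A. [a * c = b * b] (mod int m) \<longrightarrow> \<not> distinct [a, b, c]) \<longrightarrow>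
     card A \<le> ln (ln m) ^ 5 / sqrt (ln m) * totient m"
proof -
  obtain l0 where l0: "\<And>l::real. l \<ge> l0 \<Longrightarrow> l \<ge> 32768 \<and> ln l \<ge> 7 \<and> ln l ^ 5 / sqrt l \<le> 1 \<and> 1 \<le> sqrt l / ln l ^ 4 \<and>
     5120 * (129 * (sqrt l / ln l ^ 4)) * (l / ln l ^ 10) \<le> l\<^sup>2 \<and>
     1 \<le> 1.2 * l / ln l \<and> 1 \<le> ln (1.2 * l / ln l) \<and> l < 1.2 * l / ln l * (ln (1.2 * l / ln l) - 1) \<and>
     3 + 1.5 * ln l + 0.7 * (1.2 * l / ln l) + 70 * (129 * (sqrt l / ln l ^ 4))\<^sup>2 * ln l
       + 0.7 * ((1.2 * l / ln l + 4) * (1 + ln l)) < l"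
    using eventually_parameters unfolding eventually_at_top_linorder by blast
  show ?thesis
  proof (intro exI[of _ l0] allI impI, rule ccontr)
    fix m :: nat and A :: "int set"
    define l where "l = ln (real m)"
    define L where "L = ln l"
    define \<alpha> where "\<alpha> = L ^ 5 / sqrt l"
    define q where "q = sqrt l / L ^ 4"
    define w where "w = 1.2 * l / L"
    assume lm: "l0 \<le> ln (real m)" and A: "A \<subseteq> unit_residues.residues m"
      and free: "\<forall>a\<in>A. \<forall>b\<in>A. \<forall>c\<in>A. [a * c = b * b] (mod int m) \<longrightarrow> \<not> distinct [a, b, c]"
      and "\<not> card A \<le> ln (ln m) ^ 5 / sqrt (ln m) * totient m"
    then have dense: "\<alpha> * totient m \<le> card A" by (simp add: \<alpha>_def L_def l_def)
    have l: "l \<ge> 32768" "L \<ge> 7" "\<alpha> \<le> 1" "1 \<le> q" "5120 * (129 * q) * (l / L ^ 10) \<le> l\<^sup>2"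
      "1 \<le> w" "1 \<le> ln w" "l < w * (ln w - 1)"
      "3 + 1.5 * L + 0.7 * w + 70 * (129 * q)\<^sup>2 * L + 0.7 * ((w + 4) * (1 + L)) < l"
      using l0[of l] lm unfolding l_def[symmetric] L_def \<alpha>_def q_def w_def by simp_all
    have m: "m > 0" using l(1) by (cases "m = 0") (auto simp: l_def)
    interpret unit_residues m by unfold_locales (rule m)
    have sl: "sqrt l > 0" "sqrt l * sqrt l = l" using l(1) by auto
    have expL: "exp L = l" using l(1) by (simp add: L_def)
    have expL2: "exp (L / 2) = sqrt l"
      using l(1) expL by (metis exp_gt_zero less_eq_real_def ln_exp ln_sqrt exp_ln L_def real_sqrt_gt_zero)
    have alpha0: "\<alpha> > 0" using l sl by (simp add: \<alpha>_def)
    have aq: "\<alpha> * q = L" using l(2) sl by (simp add: \<alpha>_def q_def field_simps power_add[symmetric] eval_nat_numeral)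
    have "(1::real) \<le> L ^ 5" using l(2) by simp
    then have alpha_ge: "1 / sqrt l \<le> \<alpha>" using sl by (simp add: \<alpha>_def divide_right_mono)
    have alpha2: "\<alpha>\<^sup>2 = L ^ 10 / l" using sl l(1) by (simp add: \<alpha>_def power_divide power_mult[symmetric])
    have L10: "L ^ 10 > 0" using l(2) by simp
    \<comment> \<open>Since \<alpha> * q = L, more than 128 q increments give (1 + \<alpha> / 128)^D
      > exp (L / 2) = sqrt l, which is at least 1 / \<alpha>.\<close>
    define D where "D = nat \<lfloor>128 * q\<rfloor> + 1"
    have D: "128 * q < real D" "real D \<le> 129 * q" "D \<ge> 1" using l(4) by (auto simp: D_def; linarith)+
    define M where "M = nat \<lceil>l\<^sup>2\<rceil>"
    have l2: "l\<^sup>2 \<ge> 1" using l(1) by simp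
    have M: "l\<^sup>2 \<le> real M" "real M \<le> 2 * l\<^sup>2" "M > 0" using l2 by (auto simp: M_def; linarith)+
    \<comment> \<open>2^12 per unit of L dominates exp (8 L) = l^8, because ln 2 \<ge> 2/3; the
      shrinking factor of a step is at least l^(-8). The summand 2 absorbs the 4 in the condition on
      \<open>J\<close>.\<close>
    define J where "J = 2 + 12 * (D * nat \<lceil>L\<rceil>)"
    have D_cond: "\<alpha> * (1 + \<alpha> / 128) ^ D > 1"
    proof -
      have "L / 2 = 128 * q * (\<alpha> / 256)" using aq by (simp add: mult.commute)
      also have "\<dots> < real D * (\<alpha> / 256)" using D alpha0 by (intro mult_strict_right_mono) auto
      also have "\<dots> \<le> real D * ln (1 + \<alpha> / 128)"
        using ln_one_plus_ge_half[of "\<alpha> / 128"] alpha0 l(3) by (intro mult_left_mono) auto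
      also have "\<dots> = ln ((1 + \<alpha> / 128) ^ D)" using alpha0 by (simp add: ln_realpow)
      finally have "exp (L / 2) < (1 + \<alpha> / 128) ^ D"
        using alpha0 by (metis exp_less_cancel_iff exp_ln zero_less_power add_pos_pos zero_less_one zero_less_divide_iff zero_less_numeral)
      then have "sqrt l < (1 + \<alpha> / 128) ^ D" by (simp add: expL2)
      then have "1 / sqrt l * sqrt l < \<alpha> * (1 + \<alpha> / 128) ^ D"
        using alpha_ge sl alpha0 by (intro mult_le_less_imp_less) auto
      then show ?thesis using sl by simp
    qed
    have M_cond: "81 ^ D \<le> (1 + \<alpha>\<^sup>2 / 512) ^ M"
    proof -
      have "5120 * real D \<le> 5120 * (129 * q)" using D by simp
      also have "\<dots> = 5120 * (129 * q) * (l / L ^ 10) * \<alpha>\<^sup>2" using L10 l(1) by (simp add: alpha2)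
      also have "\<dots> \<le> l\<^sup>2 * \<alpha>\<^sup>2" using l(5) by (intro mult_right_mono) auto
      also have "\<dots> \<le> real M * \<alpha>\<^sup>2" using M by (intro mult_right_mono) auto
      finally have 1: "5 * real D \<le> real M * (\<alpha>\<^sup>2 / 512 / 2)" by simp
      have al1: "\<alpha>\<^sup>2 \<le> 1" using alpha0 l(3) by (simp add: power_le_one)
      have "ln ((81::real) ^ D) = real D * ln 81" by (simp add: ln_realpow)
      also have "\<dots> \<le> real D * 5" using ln_81_le by (intro mult_left_mono) auto
      also have "\<dots> \<le> real M * (\<alpha>\<^sup>2 / 512 / 2)" using 1 by simp
      also have "\<dots> \<le> real M * ln (1 + \<alpha>\<^sup>2 / 512)"
        using al1 by (intro mult_left_mono ln_one_plus_ge_half) auto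
      also have "\<dots> = ln ((1 + \<alpha>\<^sup>2 / 512) ^ M)" by (simp add: ln_realpow add_pos_nonneg)
      finally show ?thesis by (subst (asm) ln_le_cancel_iff) (auto simp: add_pos_nonneg)
    qed
    have J_cond: "4 / 2 ^ J \<le> (\<alpha>\<^sup>2 / (4096 * real M ^ 3)) ^ D"
    proof -
      \<comment> \<open>4096 * (2 l^2)^3 = 32768 l^6, which explains the lower bound 32768 required
        of l.\<close>
      have "4096 * real M ^ 3 \<le> 4096 * (2 * l\<^sup>2) ^ 3" using M by (intro mult_left_mono power_mono) auto
      also have "\<dots> = 32768 * l ^ 6" by (simp add: power_mult_distrib power_mult[symmetric])
      also have "\<dots> \<le> l * l ^ 6" using l(1) by (intro mult_right_mono) auto
      finally have 1: "4096 * real M ^ 3 \<le> l ^ 7" by (simp add: eval_nat_numeral)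
      have al: "1 / l \<le> \<alpha>\<^sup>2" using l(1,2) by (simp add: alpha2 divide_right_mono)
      have "1 / l ^ 8 = (1 / l) / l ^ 7" by (simp add: eval_nat_numeral)
      also have "\<dots> \<le> \<alpha>\<^sup>2 / (4096 * real M ^ 3)" using al 1 M l(1) by (intro frac_le) auto
      finally have 2: "1 / l ^ 8 \<le> \<alpha>\<^sup>2 / (4096 * real M ^ 3)" .
      have "8 * L \<le> 12 * real_of_int \<lceil>L\<rceil> * (2 / 3)" by linarith
      also have "\<dots> \<le> 12 * real_of_int \<lceil>L\<rceil> * ln 2"
        using ln2_ge_two_thirds l(2) by (intro mult_left_mono) auto
      also have "\<dots> = ln (2 ^ (12 * nat \<lceil>L\<rceil>))" using l(2) by (simp add: ln_realpow)
      finally have "exp (8 * L) \<le> 2 ^ (12 * nat \<lceil>L\<rceil>)" by (metis exp_le_cancel_iff exp_ln zero_less_numeral zero_less_power)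
      moreover have "exp (8 * L) = l ^ 8" using exp_of_nat_mult[of 8 L] by (simp add: expL)
      ultimately have "1 / 2 ^ (12 * nat \<lceil>L\<rceil>) \<le> 1 / l ^ 8" using l(1) by (intro divide_left_mono) auto
      then have "(1 / 2 ^ (12 * nat \<lceil>L\<rceil>)) ^ D \<le> (\<alpha>\<^sup>2 / (4096 * real M ^ 3)) ^ D"
        using 2 by (intro power_mono) auto
      moreover have "4 / 2 ^ J = (1 / 2 ^ (12 * nat \<lceil>L\<rceil>) :: real) ^ D"
        by (simp add: J_def power_add power_divide power_mult[symmetric] mult_ac)
      ultimately show ?thesis by simp
    qed
    obtain k where k: "\<alpha> * (7 / 4) ^ k \<le> 7 / 4"
      "\<alpha> ^ 3 / 8 * totient m \<le> 81 ^ (J * D) * real (card {x \<in> residues. eqm (x * x) 1}) ^ k"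
      using progression_free_units[OF alpha0 l(3) M(3) M_cond D_cond J_cond A dense] free by blast
    define n where "n = card (prime_factors m)"
    have n: "real n \<le> w" unfolding n_def using l m by (intro card_prime_factors_le) (auto simp: l_def)
    have ln_alpha: "- ln \<alpha> \<le> L / 2"
    proof -
      have "ln (1 / sqrt l) \<le> ln \<alpha>" using alpha_ge alpha0 sl by (subst ln_le_cancel_iff) auto
      then show ?thesis using l(1) by (simp add: ln_div ln_sqrt L_def)
    qed
    \<comment> \<open>The density starts at \<alpha>, with - ln \<alpha> at most L / 2, and each
      doubling uses up ln (7/4) \<ge> 1/2 of it.\<close>
    have k_le: "real k \<le> 1 + L"
    proof -
      have "ln (\<alpha> * (7 / 4) ^ k) \<le> ln (7 / 4)" using k(1) alpha0 by (subst ln_le_cancel_iff) auto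
      then have "real k * ln (7 / 4) \<le> ln (7 / 4) + L / 2"
        using alpha0 ln_alpha by (simp add: ln_mult ln_realpow)
      then have "(real k - 1) * ln (7 / 4) \<le> L / 2" by (simp add: algebra_simps)
      moreover have "(real k - 1) * (1 / 2) \<le> (real k - 1) * ln (7 / 4)" if "k \<ge> 1"
        using ln_seven_quarters_ge that by (intro mult_left_mono) auto
      ultimately show ?thesis using l(2) by (cases "k \<ge> 1") auto
    qed
    have J_le: "real J \<le> 14 * real D * L"
    proof -
      have "real (nat \<lceil>L\<rceil>) \<le> L + 1" using l(2) by linarith
      then have "real D * real (nat \<lceil>L\<rceil>) \<le> real D * (L + 1)" by (intro mult_left_mono) auto
      moreover have "real D * 7 \<le> real D * L" using l(2) by (intro mult_left_mono) auto
      moreover have "real J = 2 + 12 * (real D * real (nat \<lceil>L\<rceil>))" by (simp only: J_def of_nat_add of_nat_mult of_nat_numeral)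
      moreover have "real D \<ge> 1" "real D * (L + 1) = real D * L + real D" using D(3) by (simp_all add: distrib_left)
      ultimately have "real J \<le> 14 * (real D * L)" by linarith
      then show ?thesis by simp
    qed
    have "{x \<in> residues. eqm (x * x) 1} = {x \<in> {0..<int m}. coprime x (int m) \<and> eqm (x * x) 1}"
      by (auto simp: residues_def)
    then have "card {x \<in> residues. eqm (x * x) 1} \<le> 2 ^ (n + 4)"
      using card_square_roots_of_one[OF m] by (simp add: n_def)
    then have "real (card {x \<in> residues. eqm (x * x) 1}) ^ k \<le> (2 ^ (n + 4)) ^ k"
      by (intro power_mono) (metis of_nat_le_iff of_nat_numeral of_nat_power, simp)
    then have "81 ^ (J * D) * real (card {x \<in> residues. eqm (x * x) 1}) ^ k \<le> 81 ^ (J * D) * (2 ^ (n + 4)) ^ k"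
      by (intro mult_left_mono) auto
    then have 1: "\<alpha> ^ 3 / 8 * totient m \<le> 81 ^ (J * D) * (2 ^ (n + 4)) ^ k" using k(2) by linarith
    \<comment> \<open>Replacing \<open>totient m\<close> by m costs only 2^n. The logarithm of the
      resulting inequality bounds l by the left side of the last parameter inequality, which is
      below l.\<close>
    have "\<alpha> ^ 3 / 8 * real m \<le> \<alpha> ^ 3 / 8 * (2 ^ n * totient m)"
      using totient_lower[of m] alpha0 by (intro mult_left_mono) (auto simp: n_def)
    also have "\<dots> = 2 ^ n * (\<alpha> ^ 3 / 8 * totient m)" by simp
    also have "\<dots> \<le> 2 ^ n * (81 ^ (J * D) * (2 ^ (n + 4)) ^ k)" using 1 by (intro mult_left_mono) auto
    finally have "ln (\<alpha> ^ 3 / 8 * real m) \<le> ln (2 ^ n * (81 ^ (J * D) * (2 ^ (n + 4)) ^ k))"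
      using alpha0 m by (subst ln_le_cancel_iff) auto
    moreover have "ln (\<alpha> ^ 3 / 8 * real m) = 3 * ln \<alpha> - ln 8 + l"
      using alpha0 m by (simp add: ln_mult ln_div ln_realpow l_def)
    moreover have "ln (2 ^ n * (81 ^ (J * D) * (2 ^ (n + 4)) ^ k) :: real)
        = real n * ln 2 + real J * real D * ln 81 + real k * (real n + 4) * ln 2"
      by (simp add: ln_mult ln_realpow algebra_simps)
    ultimately have "l \<le> ln 8 + 3 * (- ln \<alpha>) + real n * ln 2 + real J * real D * ln 81 + real k * (real n + 4) * ln 2"
      by linarith
    also have "ln (8::real) \<le> 3" using ln2_le_25_over_36 ln_realpow[of 2 3] by simp
    also have "3 * (- ln \<alpha>) \<le> 1.5 * L" using ln_alpha by simp
    also have "real n * ln 2 \<le> w * 0.7" using n ln2_le_25_over_36 by (intro mult_mono) auto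
    also have "real J * real D * ln 81 \<le> (14 * real D * L) * real D * 5"
      using J_le ln_81_le l(2) by (intro mult_mono) auto
    also have "(14 * real D * L) * real D * 5 = 70 * (real D)\<^sup>2 * L" by (simp add: power2_eq_square)
    also have "70 * (real D)\<^sup>2 * L \<le> 70 * (129 * q)\<^sup>2 * L"
      using D l(2) by (intro mult_right_mono mult_left_mono power_mono) auto
    also have "real k * (real n + 4) * ln 2 \<le> (1 + L) * (w + 4) * 0.7"
      using k_le n ln2_le_25_over_36 l(2) by (intro mult_mono) auto
    finally show False using l(9) by (simp add: mult_ac)
  qed
qed

subsection \<open>Residues modulo n\<close>

lemma residue_ring_simps:
  "carrier (residue_ring n) = {0..n - 1}" "x \<otimes>\<^bsub>residue_ring n\<^esub> y = x * y mod n"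
  "\<one>\<^bsub>residue_ring n\<^esub> = 1"
  by (simp_all add: residue_ring_def)

lemma residue_ring_square: "r [^]\<^bsub>residue_ring n\<^esub> (2::nat) = r * r mod n" if "0 \<le> r" "r < n"
  using that by (simp add: numeral_2_eq_2 nat_pow_def residue_ring_simps)

text \<open>The modulus of the class is m = n / gcd(x, n); the residue 0 has gcd n and forms the
  class m = 1 with u = 0.\<close>

lemma gcd_class_units:
  fixes x :: int
  assumes n: "n > 0" and x: "0 \<le> x" "x < int n"
  obtains m u where "m dvd n" "u \<in> unit_residues.residues m" "x = int (n div m) * u"
proof -
  define e where "e = nat (gcd x (int n))"
  have e: "int e = gcd x (int n)" by (simp add: e_def)
  have e0: "e > 0" using n e by (metis gcd_pos_int of_nat_0_less_iff of_nat_0_neq less_numeral_extra(3) zero_less_imp_eq_int)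
  have en: "e dvd n" using e by (metis gcd_dvd2 int_dvd_int_iff)
  then obtain m where m: "n = e * m" by blast
  have m0: "m > 0" using n m by (cases m) auto
  obtain u where u: "x = int e * u" using e by (metis dvdE gcd_dvd1)
  interpret unit_residues m by unfold_locales (rule m0)
  have "gcd (int e * u) (int e * int m) = int e" using e u m by simp
  then have "int e * gcd u (int m) = int e" by (metis gcd_mult_distrib_int abs_of_nat)
  then have "gcd u (int m) = 1" using e0 by simp
  then have "coprime u (int m)" by (simp add: coprime_iff_gcd_eq_1)
  moreover have "0 \<le> u" using x u e0 by (simp add: zero_le_mult_iff)
  moreover have "u < int m" using x u e0 m by simp
  ultimately have "u \<in> residues" by (simp add: residues_def)
  moreover have "n div m = e" using m m0 by simp
  ultimately show ?thesis using that[of m u] m u by simp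
qed

text \<open>The ratio r is b / a computed modulo m only. This suffices modulo n because all terms
  carry the factor n / m, and (n / m) * x modulo n depends only on x modulo m.\<close>

lemma three_term_GP_gcd_class:
  assumes n: "n > 0" "m dvd n" and abc: "a \<in> unit_residues.residues m" "b \<in> unit_residues.residues m"
      "c \<in> unit_residues.residues m" and eq: "[a * c = b * b] (mod int m)" and d: "distinct [a, b, c]"
  shows "three_term_GP n (int (n div m) * a, int (n div m) * b, int (n div m) * c)"
proof -
  define e where "e = int (n div m)"
  have m0: "m > 0" using n by (auto intro: Nat.gr0I)
  interpret unit_residues m by unfold_locales (rule m0)
  have em: "int n = e * int m" using n(2) by (simp add: e_def of_nat_mult[symmetric] del: of_nat_mult)
  then have e0: "e > 0" using n(1) m0 by (metis of_nat_0_less_iff zero_less_mult_pos2)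
  have R: "x \<in> {0..<int m}" "coprime x (int m)" if "x \<in> {a, b, c}" for x
    using that abc by (auto simp: residues_def)
  define r where "r = a ^ (totient m - 1) * b mod int m"
  have r: "0 \<le> r" "r < int m" using m0 by (simp_all add: r_def)
  have "int m \<le> int n" using n by (simp add: dvd_imp_le)
  then have rn: "r < int n" using r by simp
  have ar: "eqm (a * r) b"
  proof -
    have "eqm (a * r) (a * (a ^ (totient m - 1) * b))" by (intro cong_mult cong_refl) (simp add: r_def Cong.cong_def)
    also have "a * (a ^ (totient m - 1) * b) = a ^ (totient m - 1) * a * b" by simp
    also have "eqm (a ^ (totient m - 1) * a * b) (1 * b)" using unit_inverse[of a] R by (intro cong_mult cong_refl) auto
    finally show ?thesis by simp
  qed
  have arr: "eqm (a * (r * r)) c"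
  proof -
    have "eqm (a * (a * (r * r))) (a * c)"
    proof -
      have "a * (a * (r * r)) = (a * r) * (a * r)" by simp
      also have "eqm \<dots> (b * b)" using ar by (intro cong_mult)
      also have "eqm (b * b) (a * c)" using eq by (rule cong_sym)
      finally show ?thesis .
    qed
    then show ?thesis using R(2)[of a] by (subst (asm) cong_mult_lcancel) (auto simp: coprime_commute)
  qed
  have red: "e * x mod int n = e * y" if "eqm x y" "y \<in> {0..<int m}" for x y
  proof -
    have "x mod int m = y mod int m" using that(1) by (simp only: Cong.cong_def)
    also have "y mod int m = y" using that(2) by simp
    finally have "x mod int m = y" .
    then show ?thesis by (simp add: em mult_mod_right[symmetric])
  qed
  have y: "e * a * r mod int n = e * b" using red[OF ar] R by (simp add: mult.assoc)
  have "e * a * (r * r mod int n) mod int n = e * a * (r * r) mod int n" by (rule mod_mult_right_eq)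
  also have "e * a * (r * r) = e * (a * (r * r))" by simp
  finally have "e * a * (r * r mod int n) mod int n = e * (a * (r * r)) mod int n" .
  then have z: "e * a * (r * r mod int n) mod int n = e * c" using red[OF arr] R by simp
  show ?thesis
    unfolding three_term_GP_def Let_def e_def[symmetric]
  proof (rule bexI[of _ "e * a"], rule bexI[of _ r])
    show "r \<in> carrier (residue_ring (int n))" using r rn by (simp add: residue_ring_simps)
    have "e * a < e * int m" using R[of a] e0 by simp
    then show "e * a \<in> carrier (residue_ring (int n))" using R[of a] e0 by (simp add: residue_ring_simps em)
    show "(e * a, e * b, e * c) = (e * a, e * a \<otimes>\<^bsub>residue_ring (int n)\<^esub> r,
          e * a \<otimes>\<^bsub>residue_ring (int n)\<^esub> r [^]\<^bsub>residue_ring (int n)\<^esub> (2::nat)) \<and>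
        distinct [e * a, e * a \<otimes>\<^bsub>residue_ring (int n)\<^esub> r,
          e * a \<otimes>\<^bsub>residue_ring (int n)\<^esub> r [^]\<^bsub>residue_ring (int n)\<^esub> (2::nat)]"
      using d e0 by (simp add: residue_ring_square[OF r(1) rn] residue_ring_simps(2) y z)
  qed
qed

lemma GP_free_card_le:
  assumes n: "n > 0" and A: "A \<subseteq> carrier (residue_ring (int n))" "GP_free n A"
    and bound: "\<And>m B. m dvd n \<Longrightarrow> B \<subseteq> unit_residues.residues m \<Longrightarrow>
       (\<forall>a\<in>B. \<forall>b\<in>B. \<forall>c\<in>B. [a * c = b * b] (mod int m) \<longrightarrow> \<not> distinct [a, b, c]) \<Longrightarrow> real (card B) \<le> g m"
  shows "real (card A) \<le> (\<Sum>m | m dvd n. g m)"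
proof -
  define B where "B = (\<lambda>m. {u \<in> unit_residues.residues m. int (n div m) * u \<in> A})"
  have fd: "finite {m. m dvd n}" using n by simp
  have finB: "finite (B m)" if "m dvd n" for m
  proof -
    have "m > 0" using n that by (auto intro: Nat.gr0I)
    then interpret unit_residues m by unfold_locales
    show ?thesis using finite_residues by (simp add: B_def)
  qed
  have "A \<subseteq> (\<Union>m\<in>{m. m dvd n}. (\<lambda>u. int (n div m) * u) ` B m)"
  proof
    fix x assume x: "x \<in> A"
    then have "0 \<le> x" "x < int n" using A(1) by (auto simp: residue_ring_simps)
    from gcd_class_units[OF n this] obtain m u where
      "m dvd n" "u \<in> unit_residues.residues m" "x = int (n div m) * u" .
    then show "x \<in> (\<Union>m\<in>{m. m dvd n}. (\<lambda>u. int (n div m) * u) ` B m)"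
      using x by (auto simp: B_def)
  qed
  then have "card A \<le> card (\<Union>m\<in>{m. m dvd n}. (\<lambda>u. int (n div m) * u) ` B m)"
    using fd finB by (intro card_mono) auto
  also have "\<dots> \<le> (\<Sum>m | m dvd n. card ((\<lambda>u. int (n div m) * u) ` B m))"
    by (rule card_UN_le[OF fd])
  also have "\<dots> \<le> (\<Sum>m | m dvd n. card (B m))" using finB by (intro sum_mono card_image_le) auto
  finally have "real (card A) \<le> (\<Sum>m | m dvd n. real (card (B m)))" by (metis of_nat_le_iff of_nat_sum)
  also have "\<dots> \<le> (\<Sum>m | m dvd n. g m)"
  proof (intro sum_mono bound)
    fix m assume "m \<in> {m. m dvd n}"
    then show mn: "m dvd n" by simp
    show "B m \<subseteq> unit_residues.residues m" by (auto simp: B_def)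
    show "\<forall>a\<in>B m. \<forall>b\<in>B m. \<forall>c\<in>B m. [a * c = b * b] (mod int m) \<longrightarrow> \<not> distinct [a, b, c]"
    proof (intro ballI impI notI)
      fix a b c assume *: "a \<in> B m" "b \<in> B m" "c \<in> B m" "[a * c = b * b] (mod int m)" "distinct [a, b, c]"
      then have "three_term_GP n (int (n div m) * a, int (n div m) * b, int (n div m) * c)"
        by (intro three_term_GP_gcd_class n mn) (auto simp: B_def)
      then have "\<not> {int (n div m) * a, int (n div m) * b, int (n div m) * c} \<subseteq> A"
        using A(2) unfolding GP_free_def by blast
      then show False using * by (auto simp: B_def)
    qed
  qed
  finally show ?thesis .
qed

lemma E_attained:
  assumes n: "n > 0"
  obtains A where "A \<subseteq> carrier (residue_ring (int n))" "GP_free n A" "E n = card A"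
proof -
  define S where "S = {card A | A. A \<subseteq> carrier (residue_ring (int n)) \<and> GP_free n A}"
  have fin: "finite (carrier (residue_ring (int n)))" by (simp add: residue_ring_simps)
  have "S \<subseteq> card ` Pow (carrier (residue_ring (int n)))" by (auto simp: S_def)
  then have "finite S" using fin finite_subset by blast
  moreover have "card ({}::int set) \<in> S" unfolding S_def by (auto simp: GP_free_def intro!: exI[of _ "{}"])
  ultimately have "Max S \<in> S" by (intro Max_in) auto
  then show ?thesis using that by (auto simp: S_def E_def)
qed

section \<open>Summation over the divisors of n\<close>

lemma eventually_main_bound:
  "eventually (\<lambda>t::real. t \<ge> 3 \<and> ln t \<ge> 1 \<and> ln (ln t / 4) \<ge> 0 \<and> l0 \<le> ln t / 4 \<and> sqrt t \<le> t * ln (ln t) ^ 5 / sqrt (ln t)) at_top"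
  by (intro eventually_conj; real_asymp)

lemma small_divisors_sum_le:
  fixes s :: real
  assumes "s \<ge> 0" "finite S" "\<And>m. m \<in> S \<Longrightarrow> 0 < m \<and> real m \<le> s"
  shows "(\<Sum>m\<in>S. real (totient m)) \<le> s * s"
proof -
  have "S \<subseteq> {1..nat \<lfloor>s\<rfloor>}" using assms(3) by (force simp: le_nat_floor Suc_le_eq)
  then have "card S \<le> nat \<lfloor>s\<rfloor>" using card_mono[of "{1..nat \<lfloor>s\<rfloor>}" S] by simp
  then have c: "real (card S) \<le> s" using assms(1) by linarith
  have "(\<Sum>m\<in>S. real (totient m)) \<le> (\<Sum>m\<in>S. s)"
    using assms(3) totient_le by (intro sum_mono) (metis of_nat_le_iff order_trans)
  also have "\<dots> = card S * s" by simp
  also have "\<dots> \<le> s * s" using c assms(1) by (intro mult_right_mono)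
  finally show ?thesis .
qed

lemma E_le: "n > 0 \<Longrightarrow> E n \<le> n"
proof -
  assume n: "n > 0"
  obtain A where A: "A \<subseteq> carrier (residue_ring (int n))" "E n = card A" using E_attained[OF n] by blast
  have "card A \<le> card {0..int n - 1}" using A(1) by (intro card_mono) (auto simp: residue_ring_simps)
  then show ?thesis using A(2) by simp
qed

text \<open>Divisors are cut at n^(1/4). Above it ln m \<ge> ln n / 4, so the density bound for m is
  at most twice the one for n, and the totients of the divisors sum to n. Below it the trivial bound
  contributes at most sqrt n in total. This gives the constant 2 + 1.\<close>

lemma E_large:
  "\<exists>t0. \<forall>n. t0 \<le> real n \<longrightarrow> real (E n) \<le> 3 * (real n * ln (ln n) ^ 5 / sqrt (ln n))"
proof -
  obtain l0 where l0: "\<And>m A. l0 \<le> ln (real m) \<Longrightarrow> A \<subseteq> unit_residues.residues m \<Longrightarrow>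
     (\<forall>a\<in>A. \<forall>b\<in>A. \<forall>c\<in>A. [a * c = b * b] (mod int m) \<longrightarrow> \<not> distinct [a, b, c]) \<Longrightarrow>
     card A \<le> ln (ln m) ^ 5 / sqrt (ln m) * totient m"
    using large_progression_free_units by blast
  obtain t0 where t0: "\<And>t::real. t \<ge> t0 \<Longrightarrow> t \<ge> 3 \<and> ln t \<ge> 1 \<and> ln (ln t / 4) \<ge> 0 \<and> l0 \<le> ln t / 4 \<and>
      sqrt t \<le> t * ln (ln t) ^ 5 / sqrt (ln t)"
    using eventually_main_bound[of l0] unfolding eventually_at_top_linorder by blast
  show ?thesis
  proof (intro exI[of _ t0] allI impI)
    fix n :: nat assume "t0 \<le> real n"
    note t = t0[OF this]
    have n: "n > 0" using t by (cases n) auto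
    define s where "s = sqrt (sqrt (real n))"
    define F where "F = ln (ln n) ^ 5 / sqrt (ln n)"
    have s: "s > 0" "ln s = ln n / 4" "s * s = sqrt n" using n by (simp_all add: s_def ln_sqrt)
    have lnn: "ln n \<ge> 1" using t by blast
    define g where "g = (\<lambda>m. real (totient m) * (2 * F) + (if real m \<le> s then real (totient m) else 0))"
    have F0: "F \<ge> 0" using lnn by (simp add: F_def)
    obtain A where A: "A \<subseteq> carrier (residue_ring (int n))" "GP_free n A" "E n = card A"
      using E_attained[OF n] .
    have "real (card A) \<le> (\<Sum>m | m dvd n. g m)"
    proof (rule GP_free_card_le[OF n A(1,2)])
      fix m B assume m: "m dvd n" and B: "B \<subseteq> unit_residues.residues m"
        and free: "\<forall>a\<in>B. \<forall>b\<in>B. \<forall>c\<in>B. [a * c = b * b] (mod int m) \<longrightarrow> \<not> distinct [a, b, c]"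
      have m0: "m > 0" using n m by (auto intro: Nat.gr0I)
      then interpret unit_residues m by unfold_locales
      show "real (card B) \<le> g m"
      proof (cases "real m \<le> s")
        case True
        have "card B \<le> totient m" using card_mono[OF finite_residues B] by (simp add: card_residues)
        then have "real (card B) \<le> real (totient m)" by simp
        moreover have "0 \<le> real (totient m) * (2 * F)" using F0 by simp
        moreover have "g m = real (totient m) * (2 * F) + real (totient m)" using True by (simp add: g_def)
        ultimately show ?thesis by linarith
      next
        case False
        then have "ln s \<le> ln m" using s(1) m0 by (subst ln_le_cancel_iff) auto
        then have lm: "ln n / 4 \<le> ln m" by (simp only: s(2))
        have mn: "real m \<le> n" using m n by (simp add: dvd_imp_le)
        have lnm: "ln m > 0" "ln m \<le> ln n"
          using lm lnn by linarith (use mn m0 n in simp)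
        have "ln (ln n / 4) \<le> ln (ln m)" using lm lnn lnm by (subst ln_le_cancel_iff) auto
        then have "0 \<le> ln (ln m)" using t by linarith
        moreover have "ln (ln m) \<le> ln (ln n)" using lnm by (subst ln_le_cancel_iff) auto
        ultimately have p: "ln (ln m) ^ 5 \<le> ln (ln n) ^ 5" "0 \<le> ln (ln m) ^ 5" by (auto intro: power_mono)
        have "sqrt (ln n / 4) \<le> sqrt (ln m)" using lm by (rule real_sqrt_le_mono)
        then have q: "sqrt (ln n) / 2 \<le> sqrt (ln m)" by (simp add: real_sqrt_divide)
        have "ln (ln m) ^ 5 / sqrt (ln m) \<le> ln (ln n) ^ 5 / (sqrt (ln n) / 2)"
          using p q lnn by (intro frac_le) auto
        also have "\<dots> = 2 * F" by (simp add: F_def)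
        finally have "ln (ln m) ^ 5 / sqrt (ln m) * totient m \<le> 2 * F * totient m"
          by (intro mult_right_mono) auto
        moreover have "card B \<le> ln (ln m) ^ 5 / sqrt (ln m) * totient m"
          using lm t by (intro l0 B free) linarith
        ultimately show ?thesis using False by (simp add: g_def mult.commute)
      qed
    qed
    also have "(\<Sum>m | m dvd n. g m) = (\<Sum>m | m dvd n. real (totient m)) * (2 * F)
        + (\<Sum>m | m dvd n \<and> real m \<le> s. real (totient m))"
      using n by (simp add: g_def sum.distrib sum_distrib_right sum.If_cases Collect_conj_eq[symmetric])
    also have "(\<Sum>m | m dvd n. real (totient m)) = real n"
      using totient_divisor_sum[of n] by (metis of_nat_sum)
    also have "(\<Sum>m | m dvd n \<and> real m \<le> s. real (totient m)) \<le> s * s"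
      using n s(1) by (intro small_divisors_sum_le) (auto intro: Nat.gr0I)
    also have "s * s \<le> real n * F" using t by (simp add: s F_def)
    finally show "real (E n) \<le> 3 * (real n * ln (ln n) ^ 5 / sqrt (ln n))"
      by (simp add: A(3) F_def)
  qed
qed

theorem theorem2p3:
  shows "\<exists>C::real. C > 0 \<and>
    (\<forall>n::nat. n \<ge> 3 \<longrightarrow>
      real (E n) \<le> C * (real n * (ln (ln (real n))) ^ 5 / (ln (real n)) powr (1 / 2)))"
proof -
  obtain t0 where t0: "\<And>n. t0 \<le> real n \<Longrightarrow> real (E n) \<le> 3 * (real n * ln (ln n) ^ 5 / sqrt (ln n))"
    using E_large by blast
  define T where "T = max t0 3"
  \<comment> \<open>A positive lower bound, since ln 3 > 1, for the claimed density on 3 \<le> n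
    \<le> T; there the trivial estimate \<open>E n \<le> n\<close> suffices with constant 1 /
    \<delta>.\<close>
  define \<delta> where "\<delta> = ln (ln 3) ^ 5 / sqrt (ln T)"
  note ln3 = ln3_gt_1
  have "ln T \<ge> ln 3" by (simp add: T_def)
  then have lnT: "ln T > 1" using ln3 by linarith
  have d0: "\<delta> > 0" using ln3 lnT by (simp add: \<delta>_def)
  show ?thesis
  proof (intro exI[of _ "max 3 (1 / \<delta>)"] conjI allI impI)
    show "max 3 (1 / \<delta>) > 0" by simp
    fix n :: nat assume n: "n \<ge> 3"
    define F where "F = real n * ln (ln n) ^ 5 / sqrt (ln n)"
    have lnn: "ln n \<ge> ln 3" using n by simp
    then have lnn1: "ln n > 1" using ln3 by linarith
    then have F0: "F \<ge> 0" by (simp add: F_def)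
    have "real (E n) \<le> max 3 (1 / \<delta>) * F"
    proof (cases "t0 \<le> real n")
      case True
      then have "real (E n) \<le> 3 * F" using t0 by (simp add: F_def)
      also have "\<dots> \<le> max 3 (1 / \<delta>) * F" using F0 by (intro mult_right_mono) auto
      finally show ?thesis .
    next
      case False
      then have "ln n \<le> ln T" using n by (simp add: T_def)
      moreover have "ln (ln 3) ^ 5 \<le> ln (ln n) ^ 5" using ln3 lnn by (intro power_mono) auto
      ultimately have "\<delta> \<le> ln (ln n) ^ 5 / sqrt (ln n)"
        unfolding \<delta>_def using lnn1 ln3 by (intro frac_le) auto
      then have "real n * \<delta> \<le> F" unfolding F_def times_divide_eq_right[symmetric] by (intro mult_left_mono) auto
      then have "real n \<le> 1 / \<delta> * F" using d0 by (simp add: field_simps)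
      also have "\<dots> \<le> max 3 (1 / \<delta>) * F" using F0 by (intro mult_right_mono) auto
      finally show ?thesis using E_le[of n] n by linarith
    qed
    then show "real (E n) \<le> max 3 (1 / \<delta>) * (real n * (ln (ln (real n))) ^ 5 / (ln (real n)) powr (1 / 2))"
      using lnn1 by (simp add: F_def powr_half_sqrt)
  qed
qed

end
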